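(* Let $S^{(1)}_m$ be the region defined in the context and $\operatorname{T}$ the number of tilings. For every integer $n\ge0$, $$\operatorname{T}(S^{(1)}_{4n})=7^{n(2n-1)}37^{n(2n+1)},\qquad \operatorname{T}(S^{(1)}_{4n+1})=5\cdot7^{2n^2}37^{2n(n+1)},$$ $$\operatorname{T}(S^{(1)}_{4n+2})=7^{n(2n+1)}37^{(n+1)(2n+1)},\qquad \operatorname{T}(S^{(1)}_{4n+3})=2\cdot7^{2n(n+1)}37^{2n(n+2)+2}.$$
   Context: Tilings: given a subdivision of the plane into elementary regions, a tile is the union of two elementary regions sharing an edge; a tiling of a region (finite connected union of elementary regions) is a covering of it by tiles without gaps or overlaps; $\operatorname{T}(R)$ is the number of tilings of $R$. Node replacements for the unit square lattice (nodes $\mathbb{Z}^2$). First node replacement at a node $O$: add new vertices $O\pm(\tfrac12,0)$ at the midpoints of the two horizontal unit edges at $O$, and join each of them by straight segments to $O+(0,1)$ and to $O-(0,1)$; all existing segments are kept. Second node replacement at $O$: add new vertices $O\pm(0,\tfrac12)$ and join each of them by straight segments to $O+(1,0)$ and to $O-(1,0)$; all existing segments are kept. The lattice: start with the unit square lattice; for all integers $k,l$, apply the first node replacement at the nodes $(4k,4l+1)$ and $(4k+2,4l-1)$, and the second node replacement at the nodes $(4k+2,4l+1)$ and $(4k,4l-1)$. The elementary regions are the cells of the resulting subdivision. For $m\ge1$, let $\mathbb{D}_m(-1,1)=\{(x,y): |x-(m-1)|+|y-1|\le m\}$ be the diamond of side-length $m\sqrt2$ with western vertex $(-1,1)$. $S^{(1)}_m$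 is the union of all elementary regions lying completely or partially inside $\mathbb{D}_m(-1,1)$ (i.e. whose interior meets the interior of the diamond). Convention: $S^{(1)}_0$ is empty with $\operatorname{T}(S^{(1)}_0)=1$. *)

theory Defs
  imports "HOL-Analysis.Analysis"
begin

section \<open>Subdivisions, tiles and tilings\<close>

text \<open>A subdivision of the plane is given by the set \<open>K\<close> of its line segments. Elementary regions
  are taken closed, so that a union of tiles can be literally equal to the region it covers.\<close>

type_synonym plane = "real \<times> real"

definition elementary_regions :: "plane set set \<Rightarrow> plane set set" where
  "elementary_regions K = closure ` components (- \<Union>K)"

text \<open>Two distinct cells share an edge when they have a whole nondegenerate segment in common,
  not merely a vertex.\<close>

definition share_edge :: "plane set \<Rightarrow> plane set \<Rightarrow> bool" where
  "share_edge A B \<longleftrightarrow> (\<exists>a b. a \<noteq> b \<and> closed_segment a b \<subseteq> A \<inter> B)"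

definition tiles :: "plane set set \<Rightarrow> plane set set" where
  "tiles K = {A \<union> B | A B.
     A \<in> elementary_regions K \<and> B \<in> elementary_regions K \<and> A \<noteq> B \<and> share_edge A B}"

definition tilings :: "plane set set \<Rightarrow> plane set \<Rightarrow> plane set set set" where
  "tilings K R = {\<T>. \<T> \<subseteq> tiles K \<and> \<Union>\<T> = R \<and>
     pairwise (\<lambda>s t. interior s \<inter> interior t = {}) \<T>}"

definition num_tilings :: "plane set set \<Rightarrow> plane set \<Rightarrow> nat" where
  "num_tilings K R = card (tilings K R)"


section \<open>The lattice\<close>

definition square_lattice :: "plane set set" where
  "square_lattice =
     {closed_segment (of_int i, of_int j) (of_int i + 1, of_int j) | i j :: int. True} \<union>
     {closed_segment (of_int i, of_int j) (of_int i, of_int j + 1) | i j :: int. True}"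

text \<open>The segments added by a node replacement at the node \<open>P\<close>; the half-unit offset is the new
  vertex, the unit offset the old node it is joined to.\<close>

definition first_replacement :: "plane \<Rightarrow> plane set set" where
  "first_replacement P =
     {closed_segment (P + (s / 2, 0)) (P + (0, t)) | s t. s \<in> {-1, 1} \<and> t \<in> {-1, 1}}"

definition second_replacement :: "plane \<Rightarrow> plane set set" where
  "second_replacement P =
     {closed_segment (P + (0, s / 2)) (P + (t, 0)) | s t. s \<in> {-1, 1} \<and> t \<in> {-1, 1}}"

definition node :: "int \<Rightarrow> int \<Rightarrow> plane" where
  "node i j = (of_int i, of_int j)"

definition replaced_lattice :: "plane set set" where
  "replaced_lattice = square_lattice \<union>
     (\<Union>k l. first_replacement (node (4 * k) (4 * l + 1)) \<union>
            first_replacement (node (4 * k + 2) (4 * l - 1)) \<union>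
            second_replacement (node (4 * k + 2) (4 * l + 1)) \<union>
            second_replacement (node (4 * k) (4 * l - 1)))"


section \<open>The regions\<close>

definition diamond :: "nat \<Rightarrow> plane set" where
  "diamond m = {(x, y). \<bar>x - (real m - 1)\<bar> + \<bar>y - 1\<bar> \<le> real m}"

definition region_S1 :: "nat \<Rightarrow> plane set" where
  "region_S1 m = \<Union>{A \<in> elementary_regions replaced_lattice. interior A \<inter> interior (diamond m) \<noteq> {}}"

text \<open>For \<open>m = 0\<close> the diamond degenerates to a point, so the conventions for \<open>m = 0\<close> hold
  automatically.\<close>

lemma region_S1_0: "region_S1 0 = {}"
proof -
  have "diamond 0 \<subseteq> {(-1, 1)}"
    by (auto simp: diamond_def abs_if split: if_splits)
  then have "interior (diamond 0) \<subseteq> interior {(-1, 1)}"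
    by (rule interior_mono)
  then have "interior (diamond 0) = {}"
    by simp
  then show ?thesis
    by (simp add: region_S1_def)
qed

lemma num_tilings_empty: "num_tilings K {} = 1"
proof -
  have "{} \<notin> tiles K"
    by (auto simp: tiles_def elementary_regions_def dest: in_components_nonempty)
  then have "tilings K {} = {{}}"
    by (auto simp: tilings_def)
  then show ?thesis
    by (simp add: num_tilings_def)
qed

end

theory Submission
  imports Defs
begin

text \<open>
  Every unit square has exactly one corner at which a node replacement takes place; the replacement
  cuts the square into a triangle at that corner and a quadrilateral. Tilings are therefore perfect
  matchings of a graph in which the four triangles around a replaced node form a 4-cycle, each of
  them attached to the quadrilateral of its square. Eliminating the triangles (urban renewal) costs
  a factor 2 per replaced node inside the diamond and leaves the Aztec diamond graph of order \<open>m\<close>,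
  with weights \<open>3/2\<close> and \<open>1/2\<close> on the edges around replaced nodes and 1 elsewhere.

  An Aztec diamond graph is an edge-disjoint union of 4-cycles, and complementing, cycle by cycle,
  the set of vertices covered by that cycle turns it into the Aztec diamond graph of the next smaller
  order (Ciucu's complementation theorem, Propp's generalized domino shuffling). Under this reduction
  the present weights have period 4 up to scaling and translation, which gives
  \<open>T(m + 4) = 37^(m + 3) 7^(m + 1) T(m)\<close>.
\<close>

subsection \<open>Matching sums\<close>

text \<open>Both transformations rest on one principle. Split the vertices \<open>(a, b)\<close>
  with \<open>a + b\<close> of a given parity by the parity of \<open>a\<close>: blocks of edges in
  one class live on disjoint vertex sets, and the two classes overlap only in shared squares. A
  matching sum then expands over the ways to distribute the shared squares between the classes, each
  term being a product over blocks (\<open>matching_sum_block_union\<close>). A block enters only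
  through its matching sums as a function of the vertices it has to cover, so it can be exchanged
  for anything with proportional values. A 4-cycle of triangles has two perfect matchings, whence
  the factor 2 and new edges of weight \<open>1 / 2\<close>; the quadrilaterals at a node already
  meet across one pair of opposite segments, which makes that pair \<open>1 + 1 / 2\<close>. Per
  4-cycle, a reduction around odd vertices multiplies by \<open>h^2 + v^2\<close> or
  \<open>2 c^2\<close>, one around even vertices by \<open>h v + c^2\<close>. From weights
  \<open>(3/2, 1/2, 1)\<close> the latter is \<open>37 / 100\<close>, then \<open>7 / 16\<close>;
  these are the sources of 37 and 7, while all powers of 5 and the surplus powers of 2
  cancel.\<close>

definition matchings :: "'a set set \<Rightarrow> 'a set \<Rightarrow> 'a set set set" where
  "matchings E V = {M. M \<subseteq> E \<and> disjoint M \<and> \<Union>M = V}"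

text \<open>\<open>E\<close> may be infinite and may contain edges leaving \<open>V\<close>: a
  matching has union exactly \<open>V\<close>, so the edge set \<open>grid_edges\<close> can stay
  fixed while the diamond shrinks.\<close>

definition matching_sum :: "'a set set \<Rightarrow> ('a set \<Rightarrow> real) \<Rightarrow> 'a set \<Rightarrow> real" where
  "matching_sum E w V = (\<Sum>M\<in>matchings E V. \<Prod>e\<in>M. w e)"

lemma matchings_finite:
  assumes "finite V"
  shows "finite (matchings E V)" and "M \<in> matchings E V \<Longrightarrow> finite M"
proof -
  have "matchings E V \<subseteq> Pow (Pow V)"
    by (auto simp: matchings_def)
  then show "finite (matchings E V)"
    by (rule finite_subset) (simp add: assms)
  show "finite M" if "M \<in> matchings E V"
    using that assms by (auto simp: matchings_def intro: finite_UnionD)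
qed

lemma matching_sum_one: "matching_sum E (\<lambda>_. 1) V = card (matchings E V)"
  by (simp add: matching_sum_def)

lemma matching_sum_cong:
  assumes "\<And>e. e \<subseteq> V \<Longrightarrow> e \<in> E \<longleftrightarrow> e \<in> E'" "\<And>e. e \<subseteq> V \<Longrightarrow> e \<in> E \<Longrightarrow> w e = w' e"
  shows "matching_sum E w V = matching_sum E' w' V"
proof -
  have "matchings E V = matchings E' V"
    using assms(1) by (auto simp: matchings_def)
  moreover have "w e = w' e" if "M \<in> matchings E V" "e \<in> M" for M e
    using that by (intro assms(2)) (auto simp: matchings_def)
  ultimately show ?thesis
    unfolding matching_sum_def by (intro sum.cong prod.cong) auto
qed

lemma matching_sum_eq_0:
  assumes "\<not> V \<subseteq> \<Union>E"
  shows "matching_sum E w V = 0"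
proof -
  have "matchings E V = {}"
    using assms by (auto simp: matchings_def)
  then show ?thesis
    by (simp add: matching_sum_def)
qed

lemma matching_sum_no_edges: "matching_sum {} w V = (if V = {} then 1 else 0)"
proof -
  have "matchings {} V = (if V = {} then {{}} else {})"
    by (auto simp: matchings_def)
  then show ?thesis
    by (simp add: matching_sum_def)
qed

lemma matching_sum_no_vertices:
  assumes "{} \<notin> E"
  shows "matching_sum E w {} = 1"
proof -
  have "matchings E {} = {{}}"
    using assms by (auto simp: matchings_def)
  then show ?thesis
    by (simp add: matching_sum_def)
qed

text \<open>A matching splits uniquely into its edges from \<open>E1\<close> and from
  \<open>E2\<close>; \<open>S\<close> records the vertices covered by the first part.\<close>

lemma matching_sum_Un:
  assumes "finite V" "E1 \<inter> E2 = {}"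
  shows "matching_sum (E1 \<union> E2) w V =
    (\<Sum>S\<in>Pow V. matching_sum E1 w S * matching_sum E2 w (V - S))"
proof -
  have fin: "finite (matchings E S)" "M \<in> matchings E S \<Longrightarrow> finite M" if "S \<subseteq> V" for E S M
    using matchings_finite that assms(1) finite_subset by metis+
  have "(\<Sum>S\<in>Pow V. matching_sum E1 w S * matching_sum E2 w (V - S)) =
    (\<Sum>S\<in>Pow V. \<Sum>p\<in>matchings E1 S \<times> matchings E2 (V - S). prod w (fst p) * prod w (snd p))"
    by (simp add: matching_sum_def sum_product sum.cartesian_product case_prod_beta)
  also have "\<dots> = (\<Sum>q\<in>(SIGMA S:Pow V. matchings E1 S \<times> matchings E2 (V - S)).
      prod w (fst (snd q)) * prod w (snd (snd q)))"
    by (subst sum.Sigma) (auto simp: assms fin case_prod_beta)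
  also have "\<dots> = (\<Sum>M\<in>matchings (E1 \<union> E2) V. prod w M)"
  proof (rule sum.reindex_bij_witness[symmetric,
      where j = "\<lambda>M. (\<Union>(M \<inter> E1), M \<inter> E1, M \<inter> E2)" and i = "\<lambda>q. fst (snd q) \<union> snd (snd q)"])
    fix M assume M: "M \<in> matchings (E1 \<union> E2) V"
    then have split: "M = (M \<inter> E1) \<union> (M \<inter> E2)"
      by (auto simp: matchings_def)
    then show "fst (snd (\<Union>(M \<inter> E1), M \<inter> E1, M \<inter> E2)) \<union> snd (snd (\<Union>(M \<inter> E1), M \<inter> E1, M \<inter> E2)) = M"
      by simp
    have "e \<inter> f = {}" if "e \<in> M \<inter> E1" "f \<in> M \<inter> E2" for e f
    proof -
      have "e \<noteq> f"
        using that assms(2) by blast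
      then show ?thesis
        using that M by (auto simp: matchings_def disjoint_def)
    qed
    then have "\<Union>(M \<inter> E2) = V - \<Union>(M \<inter> E1)"
      using M by (auto simp: matchings_def)
    moreover have "disjoint (M \<inter> E1)" "disjoint (M \<inter> E2)"
      using M by (auto simp: matchings_def disjoint_def)
    ultimately show "(\<Union>(M \<inter> E1), M \<inter> E1, M \<inter> E2) \<in> (SIGMA S:Pow V. matchings E1 S \<times> matchings E2 (V - S))"
      using M by (auto simp: matchings_def)
    have "prod w (M \<inter> E1) * prod w (M \<inter> E2) = prod w ((M \<inter> E1) \<union> (M \<inter> E2))"
      using fin(2)[OF order_refl M] assms(2) by (intro prod.union_disjoint[symmetric]) auto
    then show "prod w (fst (snd (\<Union>(M \<inter> E1), M \<inter> E1, M \<inter> E2))) *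
        prod w (snd (snd (\<Union>(M \<inter> E1), M \<inter> E1, M \<inter> E2))) = prod w M"
      using split by simp
  next
    fix q assume "q \<in> (SIGMA S:Pow V. matchings E1 S \<times> matchings E2 (V - S))"
    then obtain S M1 M2 where q: "q = (S, M1, M2)" "S \<subseteq> V"
      "M1 \<in> matchings E1 S" "M2 \<in> matchings E2 (V - S)"
      by auto
    have *: "(M1 \<union> M2) \<inter> E1 = M1" "(M1 \<union> M2) \<inter> E2 = M2" "\<Union>M1 = S"
      using q assms(2) by (auto simp: matchings_def)
    then show "(\<Union>((fst (snd q) \<union> snd (snd q)) \<inter> E1), (fst (snd q) \<union> snd (snd q)) \<inter> E1,
        (fst (snd q) \<union> snd (snd q)) \<inter> E2) = q"
      using q by simp
    have "e \<inter> f = {}" if "e \<in> M1" "f \<in> M2" for e f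
      using that q by (auto simp: matchings_def)
    moreover have "disjoint M1" "disjoint M2"
      using q by (simp_all add: matchings_def)
    ultimately have "disjoint (M1 \<union> M2)"
      unfolding disjoint_def by (metis Int_commute Un_iff)
    then show "fst (snd q) \<union> snd (snd q) \<in> matchings (E1 \<union> E2) V"
      using q by (auto simp: matchings_def)
  qed
  finally show ?thesis
    by (simp add: matching_sum_def)
qed

lemma matching_sum_single:
  assumes "e \<noteq> {}"
  shows "matching_sum {e} w S = (if S = {} then 1 else if S = e then w e else 0)"
proof -
  have "matchings {e} S = (if S = {} then {{}} else if S = e then {{e}} else {})"
    using assms by (auto simp: matchings_def subset_singleton_iff)
  then show ?thesis
    by (auto simp: matching_sum_def)
qed

lemma matching_sum_insert:
  assumes "finite V" "e \<noteq> {}" "e \<notin> E"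
  shows "matching_sum (insert e E) w V =
    matching_sum E w V + (if e \<subseteq> V then w e * matching_sum E w (V - e) else 0)"
proof -
  have "matching_sum (insert e E) w V =
      (\<Sum>S\<in>Pow V. matching_sum {e} w S * matching_sum E w (V - S))"
    using matching_sum_Un[of V "{e}" E w] assms by simp
  also have "\<dots> = (\<Sum>S\<in>Pow V. (if S = {} then matching_sum E w V else 0) +
      (if S = e then w e * matching_sum E w (V - e) else 0))"
    using assms(2) by (intro sum.cong) (auto simp: matching_sum_single)
  also have "\<dots> = matching_sum E w V + (if e \<subseteq> V then w e * matching_sum E w (V - e) else 0)"
    using assms(1) by (simp add: sum.distrib sum.delta)
  finally show ?thesis .
qed

text \<open>All perfect matchings have the same number \<open>k\<close> of edges, half the number of
  vertices.\<close>

lemma matching_sum_scale: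
  assumes "finite V" "\<And>e. e \<in> E \<Longrightarrow> card e = 2" "card V = 2 * k"
  shows "matching_sum E (\<lambda>e. r * w e) V = r ^ k * matching_sum E w V"
proof -
  have "card M = k" if M: "M \<in> matchings E V" for M
  proof -
    have "card V = (\<Sum>e\<in>M. card e)"
      using M assms(1) card_Union_disjoint[of M]
      by (auto simp: matchings_def disjoint_def pairwise_def disjnt_def intro: finite_subset)
    also have "\<dots> = (\<Sum>e\<in>M. 2)"
      using M assms(2) by (intro sum.cong) (auto simp: matchings_def)
    finally show ?thesis
      using assms(3) by simp
  qed
  then show ?thesis
    by (simp add: matching_sum_def prod.distrib sum_distrib_left)
qed

lemma matching_sum_image:
  assumes "inj f"
  shows "matching_sum ((`) f ` E) w (f ` V) = matching_sum E (\<lambda>e. w (f ` e)) V"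
proof -
  have inj: "inj ((`) f)"
    using assms by (auto intro!: injI simp: inj_image_eq_iff)
  then have inj2: "inj ((`) ((`) f))"
    by (auto intro!: injI simp: inj_image_eq_iff)
  have "f ` e \<inter> f ` e' = {} \<longleftrightarrow> e \<inter> e' = {}" for e e'
    using assms by (auto simp: inj_eq)
  then have dis: "disjoint ((`) f ` M) \<longleftrightarrow> disjoint M" for M
    using inj by (auto simp: disjoint_def inj_eq)
  have "matchings ((`) f ` E) (f ` V) = (`) ((`) f) ` matchings E V"
  proof (intro equalityI subsetI)
    fix M' assume M': "M' \<in> matchings ((`) f ` E) (f ` V)"
    then obtain M where M: "M' = (`) f ` M" "M \<subseteq> E"
      by (auto simp: matchings_def subset_image_iff)
    have "f ` \<Union>M = f ` V"
      using M' M by (simp add: matchings_def image_Union)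
    then have "\<Union>M = V"
      using assms by (simp add: inj_image_eq_iff)
    then show "M' \<in> (`) ((`) f) ` matchings E V"
      using M M' dis by (auto simp: matchings_def)
  qed (use dis in \<open>auto simp: matchings_def\<close>)
  then show ?thesis
    unfolding matching_sum_def
    by (simp add: sum.reindex inj_on_subset[OF inj2] prod.reindex inj_on_subset[OF inj])
qed

section \<open>Graphs assembled from blocks of edges\<close>

text \<open>With disjoint vertex sets \<open>P c\<close> there is no choice left: block
  \<open>c\<close> must cover exactly \<open>S \<inter> P c\<close>.\<close>

lemma matching_sum_UN:
  assumes "finite I" "finite S" "S \<subseteq> (\<Union>c\<in>I. P c)" "disjoint_family_on P I"
    "\<And>c. c \<in> I \<Longrightarrow> E c \<subseteq> Pow (P c) - {{}}"
  shows "matching_sum (\<Union>c\<in>I. E c) w S = (\<Prod>c\<in>I. matching_sum (E c) w (S \<inter> P c))"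
  using assms
proof (induction I arbitrary: S rule: finite_induct)
  case empty
  then show ?case
    by (simp add: matching_sum_no_edges)
next
  case (insert c I)
  have P: "P c \<inter> P d = {}" if "d \<in> I" for d
    using insert that by (auto simp: disjoint_family_on_def)
  have E: "E c \<inter> (\<Union>d\<in>I. E d) = {}"
  proof -
    have "E c \<inter> E d = {}" if "d \<in> I" for d
      using P[OF that] insert.prems(4)[of c] insert.prems(4)[of d] that by blast
    then show ?thesis by blast
  qed
  \<comment> \<open>Only one term of the splitting survives: if \<open>S'\<close> misses a vertex of
    \<open>S \<inter> P c\<close>, no other block can cover it, and if \<open>S'\<close> leaves
    \<open>P c\<close>, block \<open>c\<close> cannot.\<close>
  have 0: "matching_sum (E c) w S' * matching_sum (\<Union>d\<in>I. E d) w (S - S') = 0"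
    if "S' \<noteq> S \<inter> P c" "S' \<subseteq> S" for S'
  proof (cases "S' \<subseteq> P c")
    case True
    then have "S \<inter> P c - S' \<noteq> {}"
      using that by blast
    then obtain v where v: "v \<in> S - S'" "v \<in> P c"
      by blast
    have "v \<notin> (\<Union>d\<in>I. \<Union>(E d))"
      using P v(2) insert.prems(4) by fastforce
    then have "\<not> S - S' \<subseteq> \<Union>(\<Union>d\<in>I. E d)"
      using v(1) by auto
    then show ?thesis
      by (simp add: matching_sum_eq_0)
  next
    case False
    then have "\<not> S' \<subseteq> \<Union>(E c)"
      using insert.prems(4)[of c] by auto
    then show ?thesis
      by (simp add: matching_sum_eq_0)
  qed
  have "matching_sum (\<Union>d\<in>insert c I. E d) w S =
      (\<Sum>S'\<in>Pow S. matching_sum (E c) w S' * matching_sum (\<Union>d\<in>I. E d) w (S - S'))"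
    using matching_sum_Un[OF insert.prems(1) E] by simp
  also have "\<dots> = (\<Sum>S'\<in>{S \<inter> P c}. matching_sum (E c) w S' * matching_sum (\<Union>d\<in>I. E d) w (S - S'))"
    using insert.prems(1) 0 by (intro sum.mono_neutral_right) auto
  also have "\<dots> = matching_sum (E c) w (S \<inter> P c) * matching_sum (\<Union>d\<in>I. E d) w (S - S \<inter> P c)"
    by simp
  also have "matching_sum (\<Union>d\<in>I. E d) w (S - S \<inter> P c) =
      (\<Prod>d\<in>I. matching_sum (E d) w ((S - S \<inter> P c) \<inter> P d))"
    using insert.prems by (intro insert.IH) (auto simp: disjoint_family_on_def)
  also have "\<dots> = (\<Prod>d\<in>I. matching_sum (E d) w (S \<inter> P d))"
    using P by (intro prod.cong refl arg_cong[of _ _ "matching_sum _ w"]) auto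
  finally show ?case
    using insert by simp
qed

text \<open>On the union every unshared vertex is forced upon its own family; on the intersection
  the unshared vertices are absent. In the first formula \<open>S\<close> is the set of shared
  vertices covered by the first family, in the second the set covered by the second family. With
  this choice, complementation inside each block carries one sum into the other term by
  term.\<close>

lemma two_block_families:
  assumes "finite I1" "finite I2"
    "\<And>c. c \<in> I1 \<union> I2 \<Longrightarrow> finite (P c)"
    "disjoint_family_on P I1" "disjoint_family_on P I2"
    "\<And>c. c \<in> I1 \<union> I2 \<Longrightarrow> E c \<subseteq> Pow (P c) - {{}}"
    "(\<Union>c\<in>I1. E c) \<inter> (\<Union>c\<in>I2. E c) = {}"
  defines "V1 \<equiv> \<Union>c\<in>I1. P c" and "V2 \<equiv> \<Union>c\<in>I2. P c"
  shows matching_sum_block_union: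
      "matching_sum (\<Union>c\<in>I1 \<union> I2. E c) w (V1 \<union> V2) = (\<Sum>S\<in>Pow (V1 \<inter> V2).
        (\<Prod>c\<in>I1. matching_sum (E c) w (P c - (V1 \<inter> V2 - S))) * (\<Prod>c\<in>I2. matching_sum (E c) w (P c - S)))"
    and matching_sum_block_inter:
      "matching_sum (\<Union>c\<in>I1 \<union> I2. E c) w (V1 \<inter> V2) = (\<Sum>S\<in>Pow (V1 \<inter> V2).
        (\<Prod>c\<in>I1. matching_sum (E c) w (P c \<inter> (V1 \<inter> V2 - S))) * (\<Prod>c\<in>I2. matching_sum (E c) w (P c \<inter> S)))"
proof -
  have fin: "finite V1" "finite V2"
    using assms by (auto simp: V1_def V2_def)
  have sub: "\<Union>(\<Union>c\<in>I1. E c) \<subseteq> V1" "\<Union>(\<Union>c\<in>I2. E c) \<subseteq> V2"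
    using assms(6) unfolding V1_def V2_def by blast+
  have UN1: "matching_sum (\<Union>c\<in>I1. E c) w S = (\<Prod>c\<in>I1. matching_sum (E c) w (S \<inter> P c))"
    if "S \<subseteq> V1" for S
    using assms that fin by (intro matching_sum_UN) (auto intro: finite_subset)
  have UN2: "matching_sum (\<Union>c\<in>I2. E c) w S = (\<Prod>c\<in>I2. matching_sum (E c) w (S \<inter> P c))"
    if "S \<subseteq> V2" for S
    using assms that fin by (intro matching_sum_UN) (auto intro: finite_subset)
  have split: "matching_sum (\<Union>c\<in>I1 \<union> I2. E c) w V =
      (\<Sum>S\<in>Pow V. matching_sum (\<Union>c\<in>I1. E c) w S * matching_sum (\<Union>c\<in>I2. E c) w (V - S))"
    if "finite V" for V
    using matching_sum_Un[OF that assms(7), of w] by (simp add: UN_Un)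
  have "matching_sum (\<Union>c\<in>I1 \<union> I2. E c) w (V1 \<union> V2) =
      (\<Sum>S\<in>Pow (V1 \<union> V2). matching_sum (\<Union>c\<in>I1. E c) w S * matching_sum (\<Union>c\<in>I2. E c) w (V1 \<union> V2 - S))"
    using fin by (intro split) auto
  \<comment> \<open>A nonzero term needs \<open>S \<subseteq> V1\<close> and
    \<open>V1 \<union> V2 - S \<subseteq> V2\<close>, so \<open>S\<close> is \<open>V1\<close> with
    some shared vertices removed.\<close>
  also have "\<dots> = (\<Sum>S\<in>(\<lambda>S. V1 - (V1 \<inter> V2 - S)) ` Pow (V1 \<inter> V2).
      matching_sum (\<Union>c\<in>I1. E c) w S * matching_sum (\<Union>c\<in>I2. E c) w (V1 \<union> V2 - S))"
  proof (intro sum.mono_neutral_right ballI)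
    fix S assume S: "S \<in> Pow (V1 \<union> V2) - (\<lambda>S. V1 - (V1 \<inter> V2 - S)) ` Pow (V1 \<inter> V2)"
    have "S = V1 - (V1 \<inter> V2 - S \<inter> V2)" if "S \<subseteq> V1" "V1 \<union> V2 - S \<subseteq> V2"
      using that by blast
    then have "\<not> S \<subseteq> V1 \<or> \<not> V1 \<union> V2 - S \<subseteq> V2"
      using S by blast
    then have "matching_sum (\<Union>c\<in>I1. E c) w S = 0 \<or> matching_sum (\<Union>c\<in>I2. E c) w (V1 \<union> V2 - S) = 0"
      using sub by (meson matching_sum_eq_0 order_trans)
    then show "matching_sum (\<Union>c\<in>I1. E c) w S * matching_sum (\<Union>c\<in>I2. E c) w (V1 \<union> V2 - S) = 0"
      by simp
  qed (use fin in auto)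
  also have "\<dots> = (\<Sum>S\<in>Pow (V1 \<inter> V2). matching_sum (\<Union>c\<in>I1. E c) w (V1 - (V1 \<inter> V2 - S)) *
      matching_sum (\<Union>c\<in>I2. E c) w (V1 \<union> V2 - (V1 - (V1 \<inter> V2 - S))))"
    by (subst sum.reindex) (auto simp: inj_on_def)
  also have "\<dots> = (\<Sum>S\<in>Pow (V1 \<inter> V2).
        (\<Prod>c\<in>I1. matching_sum (E c) w (P c - (V1 \<inter> V2 - S))) * (\<Prod>c\<in>I2. matching_sum (E c) w (P c - S)))"
  proof (intro sum.cong refl)
    fix S assume S: "S \<in> Pow (V1 \<inter> V2)"
    have "(V1 - (V1 \<inter> V2 - S)) \<inter> P c = P c - (V1 \<inter> V2 - S)" if "c \<in> I1" for c
      using that by (auto simp: V1_def)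
    moreover have "(V1 \<union> V2 - (V1 - (V1 \<inter> V2 - S))) \<inter> P c = P c - S" if "c \<in> I2" for c
      using that S by (auto simp: V2_def)
    ultimately show "matching_sum (\<Union>c\<in>I1. E c) w (V1 - (V1 \<inter> V2 - S)) *
        matching_sum (\<Union>c\<in>I2. E c) w (V1 \<union> V2 - (V1 - (V1 \<inter> V2 - S))) =
        (\<Prod>c\<in>I1. matching_sum (E c) w (P c - (V1 \<inter> V2 - S))) * (\<Prod>c\<in>I2. matching_sum (E c) w (P c - S))"
      using S by (subst UN1, blast, subst UN2, blast) simp
  qed
  finally show "matching_sum (\<Union>c\<in>I1 \<union> I2. E c) w (V1 \<union> V2) = (\<Sum>S\<in>Pow (V1 \<inter> V2).
        (\<Prod>c\<in>I1. matching_sum (E c) w (P c - (V1 \<inter> V2 - S))) * (\<Prod>c\<in>I2. matching_sum (E c) w (P c - S)))" .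
  have "matching_sum (\<Union>c\<in>I1 \<union> I2. E c) w (V1 \<inter> V2) =
      (\<Sum>S\<in>Pow (V1 \<inter> V2). matching_sum (\<Union>c\<in>I1. E c) w S * matching_sum (\<Union>c\<in>I2. E c) w (V1 \<inter> V2 - S))"
    using fin by (intro split) auto
  also have "\<dots> = (\<Sum>S\<in>Pow (V1 \<inter> V2).
      matching_sum (\<Union>c\<in>I1. E c) w (V1 \<inter> V2 - S) * matching_sum (\<Union>c\<in>I2. E c) w S)"
    by (rule sum.reindex_bij_witness[where i = "\<lambda>S. V1 \<inter> V2 - S" and j = "\<lambda>S. V1 \<inter> V2 - S"])
      (auto simp: double_diff)
  also have "\<dots> = (\<Sum>S\<in>Pow (V1 \<inter> V2).
        (\<Prod>c\<in>I1. matching_sum (E c) w (P c \<inter> (V1 \<inter> V2 - S))) * (\<Prod>c\<in>I2. matching_sum (E c) w (P c \<inter> S)))"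
    by (intro sum.cong refl, subst UN1, blast, subst UN2, blast) (simp add: Int_commute)
  finally show "matching_sum (\<Union>c\<in>I1 \<union> I2. E c) w (V1 \<inter> V2) = (\<Sum>S\<in>Pow (V1 \<inter> V2).
        (\<Prod>c\<in>I1. matching_sum (E c) w (P c \<inter> (V1 \<inter> V2 - S))) * (\<Prod>c\<in>I2. matching_sum (E c) w (P c \<inter> S)))" .
qed

text \<open>A vertex in both \<open>V1\<close> and \<open>V2\<close> is covered by exactly one of its two blocks; complementing in every block
  swaps the two, while a vertex in a single block must be covered by it and disappears.\<close>

lemma matching_sum_complement:
  assumes "finite I1" "finite I2"
    "\<And>c. c \<in> I1 \<union> I2 \<Longrightarrow> finite (P c)"
    "disjoint_family_on P I1" "disjoint_family_on P I2"
    "\<And>c. c \<in> I1 \<union> I2 \<Longrightarrow> E c \<subseteq> Pow (P c) - {{}}"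
    "(\<Union>c\<in>I1. E c) \<inter> (\<Union>c\<in>I2. E c) = {}"
    and flip: "\<And>c S. c \<in> I1 \<union> I2 \<Longrightarrow> S \<subseteq> P c \<Longrightarrow>
      matching_sum (E c) w S = \<Delta> c * matching_sum (E c) w' (P c - S)"
  shows "matching_sum (\<Union>c\<in>I1 \<union> I2. E c) w ((\<Union>c\<in>I1. P c) \<union> (\<Union>c\<in>I2. P c)) =
    (\<Prod>c\<in>I1. \<Delta> c) * (\<Prod>c\<in>I2. \<Delta> c) *
    matching_sum (\<Union>c\<in>I1 \<union> I2. E c) w' ((\<Union>c\<in>I1. P c) \<inter> (\<Union>c\<in>I2. P c))"
proof -
  have 1: "matching_sum (E c) w (P c - T) = \<Delta> c * matching_sum (E c) w' (P c \<inter> T)"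
    if "c \<in> I1 \<union> I2" for c T
    using flip[OF that, of "P c - T"] by (simp add: Diff_Diff_Int)
  let ?V = "(\<Union>c\<in>I1. P c) \<inter> (\<Union>c\<in>I2. P c)"
  have "matching_sum (\<Union>c\<in>I1 \<union> I2. E c) w ((\<Union>c\<in>I1. P c) \<union> (\<Union>c\<in>I2. P c)) = (\<Sum>S\<in>Pow ?V.
      (\<Prod>c\<in>I1. matching_sum (E c) w (P c - (?V - S))) * (\<Prod>c\<in>I2. matching_sum (E c) w (P c - S)))"
    by (rule matching_sum_block_union[OF assms(1-7)])
  also have "\<dots> = (\<Prod>c\<in>I1. \<Delta> c) * (\<Prod>c\<in>I2. \<Delta> c) * (\<Sum>S\<in>Pow ?V.
      (\<Prod>c\<in>I1. matching_sum (E c) w' (P c \<inter> (?V - S))) * (\<Prod>c\<in>I2. matching_sum (E c) w' (P c \<inter> S)))"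
    by (simp add: 1 prod.distrib sum_distrib_left mult_ac cong: sum.cong)
  also have "(\<Sum>S\<in>Pow ?V.
      (\<Prod>c\<in>I1. matching_sum (E c) w' (P c \<inter> (?V - S))) * (\<Prod>c\<in>I2. matching_sum (E c) w' (P c \<inter> S))) =
      matching_sum (\<Union>c\<in>I1 \<union> I2. E c) w' ?V"
    by (rule matching_sum_block_inter[OF assms(1-7), symmetric])
  finally show ?thesis .
qed

lemma subset4_cases:
  assumes "S \<subseteq> {p, q, r, s}"
  obtains "S = {}" | "S = {p}" | "S = {q}" | "S = {r}" | "S = {s}"
  | "S = {p, q}" | "S = {p, r}" | "S = {p, s}" | "S = {q, r}" | "S = {q, s}" | "S = {r, s}"
  | "S = {p, q, r}" | "S = {p, q, s}" | "S = {p, r, s}" | "S = {q, r, s}" | "S = {p, q, r, s}"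
proof -
  have "S \<in> Pow {p, q, r, s}"
    using assms by simp
  then show thesis
    unfolding Pow_insert Pow_empty image_insert image_empty Un_insert_left Un_empty_left insert_iff empty_iff
    using that by fast
qed

text \<open>Local form of complementation: \<open>w'\<close> gives each edge the weight of the
  opposite edge divided by \<open>\<Delta>\<close>, the matching sum of the whole cycle. For
  \<open>S\<close> the ends of an edge, the complement consists of the ends of the opposite edge;
  for odd or diagonal \<open>S\<close> both sides vanish.\<close>

lemma matching_sum_4_cycle:
  assumes "distinct [p, q, r, s]" "S \<subseteq> {p, q, r, s}"
    and \<Delta>: "\<Delta> = w {p, q} * w {r, s} + w {q, r} * w {p, s}" "\<Delta> \<noteq> 0"
    and w': "w' {p, q} = w {r, s} / \<Delta>" "w' {r, s} = w {p, q} / \<Delta>"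
      "w' {q, r} = w {p, s} / \<Delta>" "w' {p, s} = w {q, r} / \<Delta>"
  shows "matching_sum {{p, q}, {q, r}, {r, s}, {p, s}} w S =
    \<Delta> * matching_sum {{p, q}, {q, r}, {r, s}, {p, s}} w' ({p, q, r, s} - S)"
proof -
  have d: "p \<noteq> q" "p \<noteq> r" "p \<noteq> s" "q \<noteq> p" "q \<noteq> r" "q \<noteq> s" "r \<noteq> p" "r \<noteq> q" "r \<noteq> s" "s \<noteq> p" "s \<noteq> q" "s \<noteq> r"
    using assms(1) by auto
  \<comment> \<open>The case \<open>S = {}\<close>: under \<open>w'\<close> the whole cycle has
    matching sum \<open>1 / \<Delta>\<close>.\<close>
  have 1: "w {r, s} / \<Delta> * (w {p, q} / \<Delta>) + w {p, s} / \<Delta> * (w {q, r} / \<Delta>) = 1 / \<Delta>"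
    using \<Delta>(2) by (simp add: \<Delta>(1)[symmetric] field_simps power2_eq_square)
       (simp add: \<Delta>(1) field_simps)
  show ?thesis
    using assms(2)
    by (cases rule: subset4_cases)
      (use 1 \<Delta>(2) in \<open>simp_all add: matching_sum_insert matching_sum_no_edges d doubleton_eq_iff insert_Diff_if w'\<close>,
       simp_all add: \<Delta>(1) mult_ac add_ac)
qed

subsection \<open>The dual square grid\<close>

text \<open>A unit square is named by its lower left corner; \<open>up n\<close> is the pair of squares separated by the unit
  segment from \<open>n\<close> to its upper neighbour, and likewise for the other directions.\<close>

type_synonym square = "int \<times> int"
type_synonym vertex = "int \<times> int"

definition up :: "vertex \<Rightarrow> square set" where
  "up = (\<lambda>(a, b). {(a - 1, b), (a, b)})"

definition right :: "vertex \<Rightarrow> square set" where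
  "right = (\<lambda>(a, b). {(a, b), (a, b - 1)})"

definition down :: "vertex \<Rightarrow> square set" where
  "down = (\<lambda>(a, b). {(a, b - 1), (a - 1, b - 1)})"

definition left :: "vertex \<Rightarrow> square set" where
  "left = (\<lambda>(a, b). {(a - 1, b), (a - 1, b - 1)})"

definition star :: "vertex \<Rightarrow> square set" where
  "star = (\<lambda>(a, b). {(a - 1, b), (a, b), (a, b - 1), (a - 1, b - 1)})"

definition star_edges :: "vertex \<Rightarrow> square set set" where
  "star_edges n = {up n, right n, down n, left n}"

text \<open>\<open>down\<close> and \<open>right\<close> add nothing, being \<open>up\<close> and
  \<open>left\<close> of a neighbouring vertex.\<close>

definition grid_edges :: "square set set" where
  "grid_edges = range up \<union> range left"

lemma down_eq_up: "down (a, b) = up (a, b - 1)"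
  by (auto simp: down_def up_def)

lemma right_eq_left: "right (a, b) = left (a + 1, b)"
  by (auto simp: right_def left_def)

lemma star_iff: "(i, j) \<in> star (a, b) \<longleftrightarrow> (a = i \<or> a = i + 1) \<and> (b = j \<or> b = j + 1)"
  by (auto simp: star_def)

lemma finite_star [simp]: "finite (star n)"
  by (simp add: star_def split: prod.split)

lemma card_star: "card (star n) = 4"
  by (simp add: star_def split: prod.split)

lemma star_edges_subset: "star_edges n \<subseteq> Pow (star n) - {{}}"
  by (auto simp: star_edges_def star_def up_def right_def down_def left_def split: prod.splits)

lemma card_grid_edge: "e \<in> grid_edges \<Longrightarrow> card e = 2"
  by (auto simp: grid_edges_def up_def left_def)

lemma star_edges_subset_grid: "star_edges n \<subseteq> grid_edges"
  by (cases n) (auto simp: star_edges_def grid_edges_def down_eq_up right_eq_left)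

text \<open>A dual edge crosses a unit segment whose two endpoints have coordinate sums of opposite
  parity, so one of them lies in the prescribed class. Uniqueness is
  \<open>star_edges_unique\<close>.\<close>

lemma grid_edge_star_edges:
  assumes "e \<in> grid_edges"
  obtains a b where "even (a + b) = \<pi>" "e \<in> star_edges (a, b)"
proof -
  from assms consider a b where "e = up (a, b)" | a b where "e = left (a, b)"
    by (auto simp: grid_edges_def)
  then show thesis
  proof cases
    case 1
    then have "e \<in> star_edges (a, b)" "e \<in> star_edges (a, b + 1)"
      by (simp_all add: star_edges_def down_eq_up)
    moreover have "even (a + b) = \<pi> \<or> even (a + (b + 1)) = \<pi>"
      by auto
    ultimately show thesis
      using that by metis
  next
    case 2
    then have "e \<in> star_edges (a, b)" "e \<in> star_edges (a - 1, b)"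
      by (simp_all add: star_edges_def right_eq_left)
    moreover have "even (a + b) = \<pi> \<or> even (a - 1 + b) = \<pi>"
      by auto
    ultimately show thesis
      using that by metis
  qed
qed

lemma edge_eq_iff:
  "up (a, b) = up (c, d) \<longleftrightarrow> a = c \<and> b = d"
  "left (a, b) = left (c, d) \<longleftrightarrow> a = c \<and> b = d"
  "up (a, b) \<noteq> left (c, d)"
  "left (a, b) \<noteq> up (c, d)"
  by (auto simp: up_def left_def doubleton_eq_iff)

lemma star_edges_unique:
  assumes "e \<in> star_edges (a, b)" "e \<in> star_edges (c, d)" "even (a + b) = even (c + d)"
  shows "a = c \<and> b = d"
proof -
  have "a + b \<noteq> c + d + 1" "c + d \<noteq> a + b + 1"
    using assms(3) by presburger+
  then show ?thesis
    using assms(1,2) by (auto simp: star_edges_def down_eq_up right_eq_left edge_eq_iff)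
qed

subsection \<open>Aztec diamonds\<close>

text \<open>The 4-cycles of an Aztec diamond surround the lattice points of one coordinate parity: the Boolean
  says whether the coordinate sum is even. The centre is \<open>(p, 1)\<close>.\<close>

definition aztec_vertices :: "bool \<Rightarrow> int \<Rightarrow> int \<Rightarrow> vertex set" where
  "aztec_vertices \<pi> p r = {(a, b). \<bar>a - p\<bar> + \<bar>b - 1\<bar> \<le> r \<and> even (a + b) = \<pi>}"

definition aztec :: "bool \<Rightarrow> int \<Rightarrow> int \<Rightarrow> square set" where
  "aztec \<pi> p r = \<Union>(star ` aztec_vertices \<pi> p r)"

text \<open>Once the parity of \<open>a + b\<close> is fixed, two distinct vertices with first
  coordinates of equal parity differ by even amounts in both coordinates, so their stars are
  disjoint. This supplies the two block families.\<close>

definition aztec_even :: "bool \<Rightarrow> int \<Rightarrow> int \<Rightarrow> vertex set" where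
  "aztec_even \<pi> p r = {n \<in> aztec_vertices \<pi> p r. even (fst n)}"

definition aztec_odd :: "bool \<Rightarrow> int \<Rightarrow> int \<Rightarrow> vertex set" where
  "aztec_odd \<pi> p r = {n \<in> aztec_vertices \<pi> p r. odd (fst n)}"

lemmas aztec_parts = aztec_even_def aztec_odd_def

lemma finite_aztec_vertices [simp]:
  "finite (aztec_vertices \<pi> p r)" "finite (aztec_even \<pi> p r)" "finite (aztec_odd \<pi> p r)"
proof -
  have "aztec_vertices \<pi> p r \<subseteq> {p - r..p + r} \<times> {1 - r..1 + r}"
    by (auto simp: aztec_vertices_def)
  then show "finite (aztec_vertices \<pi> p r)"
    by (rule finite_subset) simp
  then show "finite (aztec_even \<pi> p r)" "finite (aztec_odd \<pi> p r)"
    by (simp_all add: aztec_parts)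
qed

lemma aztec_vertices_split: "aztec_vertices \<pi> p r = aztec_even \<pi> p r \<union> aztec_odd \<pi> p r"
  by (auto simp: aztec_parts)

lemma aztec_split: "aztec \<pi> p r = (\<Union>n\<in>aztec_even \<pi> p r. star n) \<union> (\<Union>n\<in>aztec_odd \<pi> p r. star n)"
  by (simp add: aztec_def aztec_vertices_split)

lemma finite_aztec [simp]: "finite (aztec \<pi> p r)"
  by (simp add: aztec_def)

lemma disjoint_stars:
  "disjoint_family_on star (aztec_even \<pi> p r)" "disjoint_family_on star (aztec_odd \<pi> p r)"
proof -
  have *: "(a, b) = (c, d)" if "even (a + b) = even (c + d)" "even a = even c"
      "star (a, b) \<inter> star (c, d) \<noteq> {}" for a b c d
  proof -
    from that(3) obtain i j where "(i, j) \<in> star (a, b)" "(i, j) \<in> star (c, d)"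
      by auto
    then have "a = i \<or> a = i + 1" "c = i \<or> c = i + 1" "b = j \<or> b = j + 1" "d = j \<or> d = j + 1"
      unfolding star_iff by blast+
    moreover have "even b = even d"
      using that(1,2) by simp blast
    ultimately show ?thesis
      using that(2) by auto
  qed
  have "star m \<inter> star n = {}" if "m \<in> aztec_vertices \<pi> p r" "n \<in> aztec_vertices \<pi> p r"
    "even (fst m) = even (fst n)" "m \<noteq> n" for m n
  proof -
    obtain a b c d where mn: "m = (a, b)" "n = (c, d)"
      by fastforce
    have "even (a + b) = \<pi>" "even (c + d) = \<pi>"
      using that(1,2) unfolding mn aztec_vertices_def by blast+
    moreover have "even a = even c" "(a, b) \<noteq> (c, d)"
      using that(3,4) unfolding mn by simp_all
    ultimately show ?thesis
      using *[of a b c d] unfolding mn by argo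
  qed
  then show "disjoint_family_on star (aztec_even \<pi> p r)" "disjoint_family_on star (aztec_odd \<pi> p r)"
    unfolding disjoint_family_on_def aztec_parts by blast+
qed

lemma disjoint_star_edges:
  "(\<Union>n\<in>aztec_even \<pi> p r. star_edges n) \<inter> (\<Union>n\<in>aztec_odd \<pi> p r. star_edges n) = {}"
proof -
  have False if "e \<in> star_edges m" "e \<in> star_edges n" "m \<in> aztec_even \<pi> p r" "n \<in> aztec_odd \<pi> p r"
    for m n e
  proof -
    obtain a b c d where mn: "m = (a, b)" "n = (c, d)"
      by fastforce
    have "even (a + b) = \<pi>" "even (c + d) = \<pi>" "even a" "odd c"
      using that(3,4) unfolding mn aztec_parts aztec_vertices_def mem_Collect_eq case_prod_conv fst_conv
      by argo+
    moreover from this have "a = c"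
      using star_edges_unique[of e a b c d] that(1,2) unfolding mn by simp
    ultimately show ?thesis
      by simp
  qed
  then show ?thesis
    by blast
qed

lemma ex_corner:
  "(\<exists>a b. (a = i \<or> a = i + 1) \<and> (b = j \<or> b = j + 1) \<and> Q a b) \<longleftrightarrow>
    Q i j \<or> Q (i + 1) j \<or> Q i (j + 1) \<or> Q (i + 1) (j + (1::int))" for i :: int
  by (simp add: conj_disj_distribR ex_disj_distrib disj_ac)

lemma mem_stars_iff:
  "(i, j) \<in> \<Union>(star ` {(a, b). Q a b}) \<longleftrightarrow> Q i j \<or> Q (i + 1) j \<or> Q i (j + 1) \<or> Q (i + 1) (j + 1)"
proof -
  have "(i, j) \<in> \<Union>(star ` {(a, b). Q a b}) \<longleftrightarrow> (\<exists>a b. (i, j) \<in> star (a, b) \<and> Q a b)"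
    by (simp only: UN_iff Bex_def split_paired_Ex mem_Collect_eq case_prod_conv conj_commute)
  then show ?thesis
    unfolding star_iff conj_assoc ex_corner .
qed

text \<open>Of the four corners of a square two opposite ones have parity \<open>\<pi>\<close>; the
  parity of \<open>i + j\<close> decides which diagonal it is.\<close>

lemma mem_aztec_iff:
  "(i, j) \<in> aztec \<pi> p r \<longleftrightarrow> (if even (i + j) = \<pi>
    then \<bar>i - p\<bar> + \<bar>j - 1\<bar> \<le> r \<or> \<bar>i + 1 - p\<bar> + \<bar>j\<bar> \<le> r
    else \<bar>i + 1 - p\<bar> + \<bar>j - 1\<bar> \<le> r \<or> \<bar>i - p\<bar> + \<bar>j\<bar> \<le> r)"
  unfolding aztec_def aztec_vertices_def mem_stars_iff by auto

text \<open>Of the two corners of parity \<open>\<pi>\<close> exactly one has an even first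
  coordinate, so each class contributes a single inequality.\<close>

lemma mem_aztec_parts_iff:
  "(i, j) \<in> \<Union>(star ` aztec_even \<pi> p r) \<longleftrightarrow> (if even (i + j) = \<pi>
    then (if even i then \<bar>i - p\<bar> + \<bar>j - 1\<bar> \<le> r else \<bar>i + 1 - p\<bar> + \<bar>j\<bar> \<le> r)
    else (if even i then \<bar>i - p\<bar> + \<bar>j\<bar> \<le> r else \<bar>i + 1 - p\<bar> + \<bar>j - 1\<bar> \<le> r))"
  "(i, j) \<in> \<Union>(star ` aztec_odd \<pi> p r) \<longleftrightarrow> (if even (i + j) = \<pi>
    then (if odd i then \<bar>i - p\<bar> + \<bar>j - 1\<bar> \<le> r else \<bar>i + 1 - p\<bar> + \<bar>j\<bar> \<le> r)
    else (if odd i then \<bar>i - p\<bar> + \<bar>j\<bar> \<le> r else \<bar>i + 1 - p\<bar> + \<bar>j - 1\<bar> \<le> r))"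
proof -
  have "aztec_even \<pi> p r = {(a, b). \<bar>a - p\<bar> + \<bar>b - 1\<bar> \<le> r \<and> even (a + b) = \<pi> \<and> even a}"
    "aztec_odd \<pi> p r = {(a, b). \<bar>a - p\<bar> + \<bar>b - 1\<bar> \<le> r \<and> even (a + b) = \<pi> \<and> odd a}"
    by (auto simp: aztec_parts aztec_vertices_def)
  note * = this
  show "(i, j) \<in> \<Union>(star ` aztec_even \<pi> p r) \<longleftrightarrow> (if even (i + j) = \<pi>
    then (if even i then \<bar>i - p\<bar> + \<bar>j - 1\<bar> \<le> r else \<bar>i + 1 - p\<bar> + \<bar>j\<bar> \<le> r)
    else (if even i then \<bar>i - p\<bar> + \<bar>j\<bar> \<le> r else \<bar>i + 1 - p\<bar> + \<bar>j - 1\<bar> \<le> r))"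
    unfolding * mem_stars_iff by auto
  show "(i, j) \<in> \<Union>(star ` aztec_odd \<pi> p r) \<longleftrightarrow> (if even (i + j) = \<pi>
    then (if odd i then \<bar>i - p\<bar> + \<bar>j - 1\<bar> \<le> r else \<bar>i + 1 - p\<bar> + \<bar>j\<bar> \<le> r)
    else (if odd i then \<bar>i - p\<bar> + \<bar>j\<bar> \<le> r else \<bar>i + 1 - p\<bar> + \<bar>j - 1\<bar> \<le> r))"
    unfolding * mem_stars_iff by auto
qed

text \<open>Along a side of a square the taxicab distance to the centre changes by exactly 1. Both
  corners on one diagonal are therefore within \<open>r\<close> iff some corner on the other
  diagonal is within \<open>r - 1\<close>.\<close>

lemma aztec_inter:
  "\<Union>(star ` aztec_even \<pi> p r) \<inter> \<Union>(star ` aztec_odd \<pi> p r) = aztec (\<not> \<pi>) p (r - 1)"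
proof -
  have "(\<bar>i - p\<bar> + \<bar>j - 1\<bar> \<le> r \<and> \<bar>i + 1 - p\<bar> + \<bar>j\<bar> \<le> r) =
      (\<bar>i + 1 - p\<bar> + \<bar>j - 1\<bar> \<le> r - 1 \<or> \<bar>i - p\<bar> + \<bar>j\<bar> \<le> r - 1)"
    "(\<bar>i + 1 - p\<bar> + \<bar>j - 1\<bar> \<le> r \<and> \<bar>i - p\<bar> + \<bar>j\<bar> \<le> r) =
      (\<bar>i - p\<bar> + \<bar>j - 1\<bar> \<le> r - 1 \<or> \<bar>i + 1 - p\<bar> + \<bar>j\<bar> \<le> r - 1)" for i j
    by linarith+
  note * = this
  have "(i, j) \<in> \<Union>(star ` aztec_even \<pi> p r) \<inter> \<Union>(star ` aztec_odd \<pi> p r) \<longleftrightarrow>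
      (i, j) \<in> aztec (\<not> \<pi>) p (r - 1)" for i j
    unfolding Int_iff mem_aztec_parts_iff mem_aztec_iff using *[of i j]
    by (cases "even (i + j)"; cases \<pi>; cases "even i"; simp only: if_True if_False simp_thms; blast)
  then show ?thesis by auto
qed

text \<open>The Aztec graph is an induced subgraph of the grid. If the vertex \<open>(a, b)\<close>
  itself were too far away, the other corners of parity \<open>\<pi>\<close> of both squares would
  have to be within \<open>r\<close>; they lie on both sides of \<open>(a, b)\<close>, which forces
  \<open>(a, b)\<close> to be within \<open>r\<close> as well.\<close>

lemma edge_in_aztec:
  assumes "e \<in> grid_edges" "e \<subseteq> aztec \<pi> p r"
  shows "e \<in> (\<Union>n\<in>aztec_vertices \<pi> p r. star_edges n)"
proof -
  obtain a b where ab: "even (a + b) = \<pi>" "e \<in> star_edges (a, b)"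
    using assms(1) grid_edge_star_edges by metis
  have par: "(even (a - 1 + b) = \<pi>) = False" "(even (a + (b - 1)) = \<pi>) = False"
    "(even (a - 1 + (b - 1)) = \<pi>) = True" "(even (a + b) = \<pi>) = True"
    using ab(1) by auto
  consider "e = up (a, b)" | "e = right (a, b)" | "e = down (a, b)" | "e = left (a, b)"
    using ab(2) by (auto simp: star_edges_def)
  then have "\<bar>a - p\<bar> + \<bar>b - 1\<bar> \<le> r"
  proof cases
    case 1
    then have "(a - 1, b) \<in> aztec \<pi> p r" "(a, b) \<in> aztec \<pi> p r"
      using assms(2) by (auto simp: up_def)
    then show ?thesis
      unfolding mem_aztec_iff par if_True if_False by linarith
  next
    case 2
    then have "(a, b) \<in> aztec \<pi> p r" "(a, b - 1) \<in> aztec \<pi> p r"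
      using assms(2) by (auto simp: right_def)
    then show ?thesis
      unfolding mem_aztec_iff par if_True if_False by linarith
  next
    case 3
    then have "(a, b - 1) \<in> aztec \<pi> p r" "(a - 1, b - 1) \<in> aztec \<pi> p r"
      using assms(2) by (auto simp: down_def)
    then show ?thesis
      unfolding mem_aztec_iff par if_True if_False by linarith
  next
    case 4
    then have "(a - 1, b) \<in> aztec \<pi> p r" "(a - 1, b - 1) \<in> aztec \<pi> p r"
      using assms(2) by (auto simp: left_def)
    then show ?thesis
      unfolding mem_aztec_iff par if_True if_False by linarith
  qed
  then show ?thesis
    using ab by (auto simp: aztec_vertices_def)
qed

lemma matching_sum_aztec:
  assumes "V \<subseteq> aztec \<pi> p r"
  shows "matching_sum grid_edges w V =
    matching_sum (\<Union>n\<in>aztec_even \<pi> p r \<union> aztec_odd \<pi> p r. star_edges n) w V"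
proof (rule matching_sum_cong)
  fix e assume "e \<subseteq> V"
  then have sub: "e \<subseteq> aztec \<pi> p r"
    using assms by (rule order_trans)
  show "e \<in> grid_edges \<longleftrightarrow> e \<in> \<Union>(star_edges ` (aztec_even \<pi> p r \<union> aztec_odd \<pi> p r))"
    unfolding aztec_vertices_split[symmetric]
  proof
    show "e \<in> \<Union>(star_edges ` aztec_vertices \<pi> p r)" if "e \<in> grid_edges"
      using that sub by (rule edge_in_aztec)
    show "e \<in> grid_edges" if "e \<in> \<Union>(star_edges ` aztec_vertices \<pi> p r)"
      using that star_edges_subset_grid unfolding UN_iff by (meson subsetD)
  qed
qed simp

text \<open>The stars are the blocks, with \<open>up\<close> opposite to \<open>down\<close> and
  \<open>left\<close> opposite to \<open>right\<close>. The squares shared by the two classes form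
  the smaller diamond (\<open>aztec_inter\<close>), whose edges regroup into stars around vertices
  of the other parity.\<close>

theorem aztec_reduction:
  assumes w': "\<And>n. n \<in> aztec_vertices \<pi> p r \<Longrightarrow> w (up n) * w (down n) + w (right n) * w (left n) = \<Delta> n"
    "\<And>n. n \<in> aztec_vertices \<pi> p r \<Longrightarrow> \<Delta> n \<noteq> 0"
    "\<And>n. n \<in> aztec_vertices \<pi> p r \<Longrightarrow> w' (up n) = w (down n) / \<Delta> n"
    "\<And>n. n \<in> aztec_vertices \<pi> p r \<Longrightarrow> w' (down n) = w (up n) / \<Delta> n"
    "\<And>n. n \<in> aztec_vertices \<pi> p r \<Longrightarrow> w' (right n) = w (left n) / \<Delta> n"
    "\<And>n. n \<in> aztec_vertices \<pi> p r \<Longrightarrow> w' (left n) = w (right n) / \<Delta> n"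
  shows "matching_sum grid_edges w (aztec \<pi> p r) =
    (\<Prod>n\<in>aztec_even \<pi> p r. \<Delta> n) * (\<Prod>n\<in>aztec_odd \<pi> p r. \<Delta> n) *
    matching_sum grid_edges w' (aztec (\<not> \<pi>) p (r - 1))"
proof -
  have flip: "matching_sum (star_edges n) w S = \<Delta> n * matching_sum (star_edges n) w' (star n - S)"
    if n: "n \<in> aztec_vertices \<pi> p r" and S: "S \<subseteq> star n" for n S
  proof -
    obtain a b where ab: "n = (a, b)" by fastforce
    show ?thesis
      using matching_sum_4_cycle[of "(a - 1, b)" "(a, b)" "(a, b - 1)" "(a - 1, b - 1)" S "\<Delta> n" w w']
        w'[OF n] S
      by (simp add: ab star_edges_def star_def up_def right_def down_def left_def)
  qed
  have "matching_sum grid_edges w (aztec \<pi> p r) =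
    matching_sum (\<Union>n\<in>aztec_even \<pi> p r \<union> aztec_odd \<pi> p r. star_edges n) w
      ((\<Union>n\<in>aztec_even \<pi> p r. star n) \<union> (\<Union>n\<in>aztec_odd \<pi> p r. star n))"
    unfolding matching_sum_aztec[OF order_refl] by (simp add: aztec_split)
  also have "\<dots> = (\<Prod>n\<in>aztec_even \<pi> p r. \<Delta> n) * (\<Prod>n\<in>aztec_odd \<pi> p r. \<Delta> n) *
    matching_sum (\<Union>n\<in>aztec_even \<pi> p r \<union> aztec_odd \<pi> p r. star_edges n) w'
      ((\<Union>n\<in>aztec_even \<pi> p r. star n) \<inter> (\<Union>n\<in>aztec_odd \<pi> p r. star n))"
    by (rule matching_sum_complement)
      (use flip star_edges_subset in \<open>auto simp: disjoint_stars disjoint_star_edges simp flip: aztec_vertices_split\<close>)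
  also have "matching_sum (\<Union>n\<in>aztec_even \<pi> p r \<union> aztec_odd \<pi> p r. star_edges n) w'
      ((\<Union>n\<in>aztec_even \<pi> p r. star n) \<inter> (\<Union>n\<in>aztec_odd \<pi> p r. star n)) =
    matching_sum grid_edges w' ((\<Union>n\<in>aztec_even \<pi> p r. star n) \<inter> (\<Union>n\<in>aztec_odd \<pi> p r. star n))"
    by (rule matching_sum_aztec[symmetric]) (auto simp: aztec_split)
  finally show ?thesis
    by (simp only: aztec_inter)
qed

subsection \<open>Counting the vertices of an Aztec diamond\<close>

text \<open>Rotation by 45 degrees, with \<open>u\<close> and \<open>v\<close> counting steps along
  the diagonals. The parity hypothesis says that the extreme points such as
  \<open>(p + r, 1)\<close> are themselves vertices of the class, so a full \<open>m\<close> by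
  \<open>m\<close> square of indices arises.\<close>

lemma aztec_vertices_image:
  assumes "even (p + r) \<noteq> \<pi>" "r = int m - 1"
  shows "aztec_vertices \<pi> p r =
    (\<lambda>(u, v). (p - r + int u + int v, 1 + int u - int v)) ` ({..<m} \<times> {..<m})"
proof (intro equalityI subsetI)
  fix n assume n: "n \<in> aztec_vertices \<pi> p r"
  obtain a b where ab: "n = (a, b)"
    by fastforce
  have le: "\<bar>a - p\<bar> + \<bar>b - 1\<bar> \<le> r" and "even (a + b) = \<pi>"
    using n unfolding ab aztec_vertices_def by simp_all
  then have "even ((a - p + r) + (b - 1))"
    using assms(1) by auto
  then obtain u where u: "(a - p + r) + (b - 1) = 2 * u"
    by (elim evenE)
  define v where "v = u - (b - 1)"
  have "0 \<le> u" "u \<le> r" "0 \<le> v" "v \<le> r" "a = p - r + u + v" "b = 1 + u - v"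
    using le u unfolding v_def by linarith+
  then have "n = (\<lambda>(u, v). (p - r + int u + int v, 1 + int u - int v)) (nat u, nat v)"
    "(nat u, nat v) \<in> {..<m} \<times> {..<m}"
    using assms(2) ab by auto
  then show "n \<in> (\<lambda>(u, v). (p - r + int u + int v, 1 + int u - int v)) ` ({..<m} \<times> {..<m})"
    by (rule image_eqI)
next
  fix n assume "n \<in> (\<lambda>(u, v). (p - r + int u + int v, 1 + int u - int v)) ` ({..<m} \<times> {..<m})"
  then obtain u v where uv: "n = (p - r + int u + int v, 1 + int u - int v)" "u < m" "v < m"
    by auto
  have "\<bar>p - r + int u + int v - p\<bar> + \<bar>1 + int u - int v - 1\<bar> \<le> r"
    using uv(2,3) assms(2) by linarith
  moreover have "even (p - r + int u + int v + (1 + int u - int v)) = \<pi>"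
  proof -
    have "p - r + int u + int v + (1 + int u - int v) = p + r + 1 + 2 * (int u - r)"
      by simp
    then show ?thesis
      using assms(1) by (cases \<pi>) simp_all
  qed
  ultimately show "n \<in> aztec_vertices \<pi> p r"
    unfolding uv(1) aztec_vertices_def mem_Collect_eq case_prod_conv by (rule conjI)
qed

lemma inj_on_diagonal: "inj_on (\<lambda>(u, v). (q + int u + int v, 1 + int u - int v)) A"
  by (auto simp: inj_on_def)

lemma card_aztec_vertices:
  assumes "even (p + r) \<noteq> \<pi>" "r = int m - 1"
  shows "card (aztec_vertices \<pi> p r) = m ^ 2"
  unfolding aztec_vertices_image[OF assms]
  by (subst card_image[OF inj_on_diagonal]) (simp add: power2_eq_square)

lemma card_even_pairs: "card {(u, v) \<in> {..<m} \<times> {..<m}. even (u + v)} = (m ^ 2 + 1) div 2"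
proof -
  have 1: "card {v. v < k \<and> even v} = (k + 1) div 2" "card {v. v < k \<and> odd v} = k div 2" for k :: nat
  proof (induction k)
    case (Suc k)
    have "{v. v < Suc k \<and> even v} = (if even k then insert k {v. v < k \<and> even v} else {v. v < k \<and> even v})"
      "{v. v < Suc k \<and> odd v} = (if odd k then insert k {v. v < k \<and> odd v} else {v. v < k \<and> odd v})"
      by (auto simp: less_Suc_eq)
    then show "card {v. v < Suc k \<and> even v} = (Suc k + 1) div 2" "card {v. v < Suc k \<and> odd v} = Suc k div 2"
      using Suc by (auto elim!: oddE evenE)
  qed simp_all
  have "{(u, v) \<in> {..<m} \<times> {..<m}. even (u + v)} =
      ({u. u < m \<and> even u} \<times> {v. v < m \<and> even v}) \<union> ({u. u < m \<and> odd u} \<times> {v. v < m \<and> odd v})"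
    by auto
  then have "card {(u, v) \<in> {..<m} \<times> {..<m}. even (u + v)} = ((m + 1) div 2) ^ 2 + (m div 2) ^ 2"
    by (simp add: card_Un_disjoint disjoint_iff card_cartesian_product 1 power2_eq_square)
  also have "\<dots> = (m ^ 2 + 1) div 2"
    by (cases "even m") (auto elim!: oddE evenE simp: power2_eq_square algebra_simps)
  finally show ?thesis .
qed

text \<open>For \<open>p = r\<close> the first coordinate is \<open>u + v\<close>, so this counts
  the chessboard colour that contains the corner of an \<open>m\<close> by \<open>m\<close>
  board.\<close>

lemma card_aztec_even:
  assumes "r = int m - 1"
  shows "card (aztec_even False r r) = (m ^ 2 + 1) div 2"
proof -
  let ?f = "\<lambda>(u, v). (0 + int u + int v, 1 + int u - int v)"
  have "aztec_vertices False r r = ?f ` ({..<m} \<times> {..<m})"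
    using aztec_vertices_image[of r r False m] assms by simp
  then have "aztec_even False r r = {n \<in> ?f ` ({..<m} \<times> {..<m}). even (fst n)}"
    unfolding aztec_even_def by simp
  also have "\<dots> = ?f ` {n \<in> {..<m} \<times> {..<m}. even (fst (?f n))}"
    by blast
  also have "{n \<in> {..<m} \<times> {..<m}. even (fst (?f n))} = {(u, v) \<in> {..<m} \<times> {..<m}. even (u + v)}"
    by (auto simp: case_prod_beta)
  finally have "card (aztec_even False r r) = card {(u, v) \<in> {..<m} \<times> {..<m}. even (u + v)}"
    by (simp only: card_image[OF inj_on_diagonal])
  then show ?thesis
    by (simp only: card_even_pairs)
qed

lemma card_aztec_odd:
  assumes "r = int m - 1"
  shows "card (aztec_odd False r r) = m ^ 2 div 2"
proof -
  have "card (aztec_even False r r) + card (aztec_odd False r r) = card (aztec_vertices False r r)"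
    unfolding aztec_vertices_split by (rule card_Un_disjoint[symmetric]) (auto simp: aztec_parts)
  also have "\<dots> = m ^ 2"
    using assms by (intro card_aztec_vertices) auto
  finally show ?thesis
    using card_aztec_even[OF assms] by linarith
qed

text \<open>Inclusion-exclusion: each class consists of disjoint 4-element stars and the overlap is
  the next smaller diamond, so consecutive sizes add up to four times a square.\<close>

lemma card_aztec:
  assumes "even (p + r) \<noteq> \<pi>" "r = int m - 1"
  shows "card (aztec \<pi> p r) = 2 * (m * (m + 1))"
  using assms
proof (induction m arbitrary: r \<pi>)
  case 0
  then have "aztec_vertices \<pi> p r = {}"
    by (auto simp: aztec_vertices_def)
  then show ?case
    by (simp add: aztec_def)
next
  case (Suc m)
  have card_stars: "card (\<Union>(star ` A)) = 4 * card A" if "disjoint_family_on star A" "finite A" for A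
    using that by (subst card_UN_disjoint) (auto simp: disjoint_family_on_def card_star)
  have "card (aztec \<pi> p r) + card (aztec (\<not> \<pi>) p (r - 1)) =
      card (\<Union>(star ` aztec_even \<pi> p r)) + card (\<Union>(star ` aztec_odd \<pi> p r))"
    unfolding aztec_split[of \<pi>] aztec_inter[symmetric] by (rule card_Un_Int[symmetric]) auto
  also have "\<dots> = 4 * (card (aztec_even \<pi> p r) + card (aztec_odd \<pi> p r))"
    by (simp add: card_stars disjoint_stars)
  also have "card (aztec_even \<pi> p r) + card (aztec_odd \<pi> p r) = card (aztec_vertices \<pi> p r)"
    unfolding aztec_vertices_split by (rule card_Un_disjoint[symmetric]) (auto simp: aztec_parts)
  also have "\<dots> = (Suc m) ^ 2"
    using Suc.prems by (rule card_aztec_vertices)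
  also have "card (aztec (\<not> \<pi>) p (r - 1)) = 2 * (m * (m + 1))"
    using Suc.prems by (intro Suc.IH) auto
  finally show ?case
    by (simp add: power2_eq_square algebra_simps)
qed

subsection \<open>The periodic weights\<close>

text \<open>One congruence for both families \<open>(4k, 4l + 1)\<close> and
  \<open>(4k + 2, 4l - 1)\<close>, see \<open>first_node_iff\<close>; the value 3 gives the nodes of
  the second kind. Together they are all points with \<open>a\<close> even and \<open>b\<close>
  odd.\<close>

definition first_node :: "vertex \<Rightarrow> bool" where
  "first_node = (\<lambda>(a, b). even a \<and> (a + b) mod 4 = 1)"

definition second_node :: "vertex \<Rightarrow> bool" where
  "second_node = (\<lambda>(a, b). even a \<and> (a + b) mod 4 = 3)"

text \<open>\<open>h\<close> and \<open>v\<close> are the weights of the edges crossing horizontal and vertical segments at a node of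
  the first kind, with the roles exchanged at a node of the second kind.\<close>

definition wt :: "real \<Rightarrow> real \<Rightarrow> real \<Rightarrow> square set \<Rightarrow> real" where
  "wt h v c e =
    (if \<exists>n. first_node n \<and> e \<in> {left n, right n} \<or> second_node n \<and> e \<in> {up n, down n} then h
     else if \<exists>n. first_node n \<and> e \<in> {up n, down n} \<or> second_node n \<and> e \<in> {left n, right n} then v
     else c)"

lemma first_node_odd: "first_node (a, b) \<Longrightarrow> even a \<and> odd b"
  unfolding first_node_def case_prod_conv by presburger

lemma second_node_odd: "second_node (a, b) \<Longrightarrow> even a \<and> odd b"
  unfolding second_node_def case_prod_conv by presburger

lemma not_first_second: "first_node n \<Longrightarrow> \<not> second_node n"
  by (auto simp: first_node_def second_node_def)

lemma first_or_second: "even a \<Longrightarrow> odd b \<Longrightarrow> first_node (a, b) \<or> second_node (a, b)"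
  unfolding first_node_def second_node_def case_prod_conv by presburger

lemma node_shift:
  "first_node (a + 2, b) = second_node (a, b)" "second_node (a + 2, b) = first_node (a, b)"
  unfolding first_node_def second_node_def case_prod_conv by presburger+

text \<open>Nodes have odd coordinate sum, and an edge lies in the star of only one vertex of that
  parity, so \<open>(a, b)\<close> is the only candidate for the existential quantifiers in
  \<open>wt\<close>.\<close>

lemma wt_star:
  assumes "odd (a + b)"
  shows "wt h v c (up (a, b)) = (if first_node (a, b) then v else if second_node (a, b) then h else c)"
    and "wt h v c (down (a, b)) = (if first_node (a, b) then v else if second_node (a, b) then h else c)"
    and "wt h v c (left (a, b)) = (if first_node (a, b) then h else if second_node (a, b) then v else c)"
    and "wt h v c (right (a, b)) = (if first_node (a, b) then h else if second_node (a, b) then v else c)"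
proof -
  have uniq: "n = (a, b)"
    if "e \<in> star_edges (a, b)" "e \<in> star_edges n" "first_node n \<or> second_node n" for e n
  proof -
    obtain x y where n: "n = (x, y)"
      by fastforce
    have "odd (x + y)"
      using that(3) first_node_odd[of x y] second_node_odd[of x y] n by auto
    then show ?thesis
      using star_edges_unique[of e a b x y] that(1,2) assms n by simp
  qed
  have eq: "wt h v c e =
    (if first_node (a, b) \<and> e \<in> {left (a, b), right (a, b)} \<or> second_node (a, b) \<and> e \<in> {up (a, b), down (a, b)} then h
     else if first_node (a, b) \<and> e \<in> {up (a, b), down (a, b)} \<or> second_node (a, b) \<and> e \<in> {left (a, b), right (a, b)} then v
     else c)" if e: "e \<in> star_edges (a, b)" for e
  proof -
    have "(\<exists>n. first_node n \<and> e \<in> {left n, right n} \<or> second_node n \<and> e \<in> {up n, down n}) \<longleftrightarrow>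
      first_node (a, b) \<and> e \<in> {left (a, b), right (a, b)} \<or> second_node (a, b) \<and> e \<in> {up (a, b), down (a, b)}"
      "(\<exists>n. first_node n \<and> e \<in> {up n, down n} \<or> second_node n \<and> e \<in> {left n, right n}) \<longleftrightarrow>
      first_node (a, b) \<and> e \<in> {up (a, b), down (a, b)} \<or> second_node (a, b) \<and> e \<in> {left (a, b), right (a, b)}"
      using uniq[OF e] unfolding star_edges_def insert_iff empty_iff by metis+
    note * = this
    show ?thesis
      unfolding wt_def * ..
  qed
  have "up (a, b) \<in> star_edges (a, b)" "down (a, b) \<in> star_edges (a, b)"
    "left (a, b) \<in> star_edges (a, b)" "right (a, b) \<in> star_edges (a, b)"
    by (simp_all add: star_edges_def)
  note * = eq[OF this(1)] eq[OF this(2)] eq[OF this(3)] eq[OF this(4)]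
  have "up (a, b) \<noteq> left (a, b)" "up (a, b) \<noteq> right (a, b)" "down (a, b) \<noteq> left (a, b)" "down (a, b) \<noteq> right (a, b)"
    by (simp_all add: down_eq_up right_eq_left edge_eq_iff)
  note ** = this this[symmetric]
  show "wt h v c (up (a, b)) = (if first_node (a, b) then v else if second_node (a, b) then h else c)"
    "wt h v c (down (a, b)) = (if first_node (a, b) then v else if second_node (a, b) then h else c)"
    "wt h v c (left (a, b)) = (if first_node (a, b) then h else if second_node (a, b) then v else c)"
    "wt h v c (right (a, b)) = (if first_node (a, b) then h else if second_node (a, b) then v else c)"
    using ** not_first_second[of "(a, b)"] by (simp_all add: *)
qed

text \<open>Opposite edges of a star around an odd vertex have equal weights: \<open>h, h\<close>
  and \<open>v, v\<close> at a node, four times \<open>c\<close> elsewhere. Exchanging opposite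
  edges changes nothing, so the pattern is only rescaled, by \<open>s\<close> or by
  \<open>2 * c\<^sup>2\<close>.\<close>

lemma wt_reduction_odd:
  assumes "h\<^sup>2 + v\<^sup>2 = s" "s \<noteq> 0" "c \<noteq> 0"
  shows "matching_sum grid_edges (wt h v c) (aztec False p r) =
    s ^ card (aztec_even False p r) * (2 * c\<^sup>2) ^ card (aztec_odd False p r) *
    matching_sum grid_edges (wt (h / s) (v / s) (1 / (2 * c))) (aztec True p (r - 1))"
proof -
  define \<Delta> where "\<Delta> n = (if even (fst n) then s else 2 * c\<^sup>2)" for n :: vertex
  have cell: "wt h v c (up n) * wt h v c (down n) + wt h v c (right n) * wt h v c (left n) = \<Delta> n \<and>
      \<Delta> n \<noteq> 0 \<and>
      wt (h / s) (v / s) (1 / (2 * c)) (up n) = wt h v c (down n) / \<Delta> n \<and>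
      wt (h / s) (v / s) (1 / (2 * c)) (down n) = wt h v c (up n) / \<Delta> n \<and>
      wt (h / s) (v / s) (1 / (2 * c)) (right n) = wt h v c (left n) / \<Delta> n \<and>
      wt (h / s) (v / s) (1 / (2 * c)) (left n) = wt h v c (right n) / \<Delta> n"
    if n: "n \<in> aztec_vertices False p r" for n
  proof -
    obtain a b where ab: "n = (a, b)"
      by fastforce
    then have odd: "odd (a + b)"
      using n by (simp add: aztec_vertices_def)
    show ?thesis
    proof (cases "even a")
      case True
      then have "first_node (a, b) \<or> second_node (a, b)"
        using odd first_or_second[of a b] by simp
      then show ?thesis
        using True assms not_first_second[of "(a, b)"]
        by (auto simp: ab wt_star[OF odd] \<Delta>_def power2_eq_square)
    next
      case False
      then have "\<not> first_node (a, b)" "\<not> second_node (a, b)"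
        using first_node_odd second_node_odd by blast+
      then show ?thesis
        using False assms by (simp add: ab wt_star[OF odd] \<Delta>_def power2_eq_square)
    qed
  qed
  have "(\<Prod>n\<in>aztec_even False p r. \<Delta> n) = s ^ card (aztec_even False p r)"
    "(\<Prod>n\<in>aztec_odd False p r. \<Delta> n) = (2 * c\<^sup>2) ^ card (aztec_odd False p r)"
    by (simp_all add: \<Delta>_def aztec_parts)
  then show ?thesis
    using aztec_reduction[of False p r "wt h v c" \<Delta> "wt (h / s) (v / s) (1 / (2 * c))"] cell
    by simp
qed

text \<open>A star around an even vertex has a node of each kind on one pair of opposite sides,
  contributing \<open>h\<close> and \<open>v\<close>, and two vertices that are not nodes on the
  other pair, contributing \<open>c\<close> twice. Exchanging opposite edges therefore swaps
  \<open>h\<close> and \<open>v\<close>.\<close>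

lemma wt_reduction_even:
  assumes "h * v + c\<^sup>2 = D" "D \<noteq> 0"
  shows "matching_sum grid_edges (wt h v c) (aztec True p r) =
    D ^ card (aztec_vertices True p r) *
    matching_sum grid_edges (wt (v / D) (h / D) (c / D)) (aztec False p (r - 1))"
proof -
  have cell: "wt h v c (up n) * wt h v c (down n) + wt h v c (right n) * wt h v c (left n) = D \<and>
      wt (v / D) (h / D) (c / D) (up n) = wt h v c (down n) / D \<and>
      wt (v / D) (h / D) (c / D) (down n) = wt h v c (up n) / D \<and>
      wt (v / D) (h / D) (c / D) (right n) = wt h v c (left n) / D \<and>
      wt (v / D) (h / D) (c / D) (left n) = wt h v c (right n) / D"
    if n: "n \<in> aztec_vertices True p r" for n
  proof -
    obtain a b where ab: "n = (a, b)"
      by fastforce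
    then have even: "even (a + b)"
      using n by (simp add: aztec_vertices_def)
    have eqs: "up (a, b) = down (a, b + 1)" "down (a, b) = up (a, b - 1)"
      "left (a, b) = right (a - 1, b)" "right (a, b) = left (a + 1, b)"
      by (simp_all add: down_eq_up right_eq_left)
    have "odd (a + (b + 1))" "odd (a + (b - 1))" "odd (a - 1 + b)" "odd (a + 1 + b)"
      using even by simp_all
    note wts = this[THEN wt_star(1)] this[THEN wt_star(2)] this[THEN wt_star(3)] this[THEN wt_star(4)]
    show ?thesis
    proof (cases "even a")
      case True
      then have "\<not> first_node (a - 1, b)" "\<not> second_node (a - 1, b)"
        "\<not> first_node (a + 1, b)" "\<not> second_node (a + 1, b)"
        "first_node (a, b + 1) \<longleftrightarrow> second_node (a, b - 1)"
        "second_node (a, b + 1) \<longleftrightarrow> first_node (a, b - 1)"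
        "first_node (a, b + 1) \<longleftrightarrow> \<not> second_node (a, b + 1)"
        using even unfolding first_node_def second_node_def case_prod_conv by presburger+
      then show ?thesis
        using assms by (auto simp: ab eqs wts power2_eq_square mult_ac)
    next
      case False
      then have "\<not> first_node (a, b - 1)" "\<not> second_node (a, b - 1)"
        "\<not> first_node (a, b + 1)" "\<not> second_node (a, b + 1)"
        "first_node (a + 1, b) \<longleftrightarrow> second_node (a - 1, b)"
        "second_node (a + 1, b) \<longleftrightarrow> first_node (a - 1, b)"
        "first_node (a + 1, b) \<longleftrightarrow> \<not> second_node (a + 1, b)"
        using even unfolding first_node_def second_node_def case_prod_conv by presburger+
      then show ?thesis
        using assms by (auto simp: ab eqs wts power2_eq_square mult_ac)
    qed
  qed
  have "(\<Prod>n\<in>aztec_even True p r. D) * (\<Prod>n\<in>aztec_odd True p r. D) =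
      D ^ card (aztec_vertices True p r)"
    unfolding aztec_vertices_split
    by (subst card_Un_disjoint) (auto simp: aztec_parts power_add)
  then show ?thesis
    using aztec_reduction[of True p r "wt h v c" "\<lambda>_. D" "wt (v / D) (h / D) (c / D)"] cell assms(2)
    by simp
qed

text \<open>Translation by \<open>(2, 0)\<close> exchanges the two kinds of nodes. It undoes the
  swap of \<open>h\<close> and \<open>v\<close> caused by a reduction around even vertices.\<close>

lemma wt_shift:
  "matching_sum grid_edges (wt h v c) (aztec False (p + 2) r) =
    matching_sum grid_edges (wt v h c) (aztec False p r)"
proof -
  define f :: "square \<Rightarrow> square" where "f = (\<lambda>(i, j). (i + 2, j))"
  have inj: "inj f"
    by (auto simp: f_def inj_def)
  have edges: "f ` up (a, b) = up (a + 2, b)" "f ` down (a, b) = down (a + 2, b)"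
    "f ` left (a, b) = left (a + 2, b)" "f ` right (a, b) = right (a + 2, b)"
    "f ` star (a, b) = star (a + 2, b)" for a b
    by (auto simp: f_def up_def down_def left_def right_def star_def)
  have surj: "range (\<lambda>(a, b). (a + 2 :: int, b)) = (UNIV :: vertex set)"
    by (rule surjI[of _ "\<lambda>(a, b). (a - 2, b)"]) auto
  have f_comp: "(`) f \<circ> up = up \<circ> (\<lambda>(a, b). (a + 2, b))" "(`) f \<circ> left = left \<circ> (\<lambda>(a, b). (a + 2, b))"
    by (auto simp: edges)
  have "(`) f ` range up = range up" "(`) f ` range left = range left"
    unfolding image_comp f_comp unfolding image_comp[symmetric] surj by simp_all
  then have grid: "(`) f ` grid_edges = grid_edges"
    by (simp add: grid_edges_def image_Un)
  have "aztec_vertices False (p + 2) r = (\<lambda>(a, b). (a + 2, b)) ` aztec_vertices False p r"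
  proof (intro equalityI subsetI)
    fix n assume "n \<in> aztec_vertices False (p + 2) r"
    then have "n = (\<lambda>(a, b). (a + 2, b)) (fst n - 2, snd n)" "(fst n - 2, snd n) \<in> aztec_vertices False p r"
      by (auto simp: aztec_vertices_def algebra_simps)
    then show "n \<in> (\<lambda>(a, b). (a + 2, b)) ` aztec_vertices False p r"
      by (rule image_eqI)
  qed (auto simp: aztec_vertices_def)
  moreover have "star \<circ> (\<lambda>(a, b). (a + 2, b)) = (`) f \<circ> star"
    by (auto simp: edges)
  ultimately have "aztec False (p + 2) r = f ` aztec False p r"
    unfolding aztec_def by (simp add: image_comp image_Union)
  then have "matching_sum grid_edges (wt h v c) (aztec False (p + 2) r) =
      matching_sum grid_edges (\<lambda>e. wt h v c (f ` e)) (aztec False p r)"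
    using matching_sum_image[OF inj, of grid_edges "wt h v c" "aztec False p r"] grid by simp
  also have "\<dots> = matching_sum grid_edges (wt v h c) (aztec False p r)"
  proof (rule matching_sum_cong)
    fix e assume "e \<in> grid_edges"
    then obtain a b where ab: "even (a + b) = False" "e \<in> star_edges (a, b)"
      using grid_edge_star_edges by metis
    then have odd: "odd (a + b)" "odd (a + 2 + b)"
      by simp_all
    show "wt h v c (f ` e) = wt v h c e"
      using ab(2) not_first_second[of "(a, b)"]
      by (auto simp: star_edges_def edges wt_star[OF odd(1)] wt_star[OF odd(2)] node_shift)
  qed simp
  finally show ?thesis .
qed

section \<open>The recurrence with step 4 and its closed form\<close>

definition aztec_sum :: "nat \<Rightarrow> real \<Rightarrow> real \<Rightarrow> real \<Rightarrow> real" where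
  "aztec_sum m h v c = matching_sum grid_edges (wt h v c) (aztec False (int m - 1) (int m - 1))"

lemma aztec_sum_scale: "aztec_sum m (k * h) (k * v) (k * c) = k ^ (m * (m + 1)) * aztec_sum m h v c"
proof -
  have "wt (k * h) (k * v) (k * c) = (\<lambda>e. k * wt h v c e)"
    unfolding wt_def by (simp only: if_distrib[of "(*) k"])
  then show ?thesis
    unfolding aztec_sum_def
    by (simp only:) (rule matching_sum_scale; (simp add: card_grid_edge card_aztec[where m = m])?)
qed

text \<open>Two reductions, then the scaling that makes the weights proportional to the original ones; this scaling
  absorbs all but \<open>m + 1\<close> of the \<open>(m + 1)\<^sup>2\<close> factors \<open>D\<close>.\<close>

lemma aztec_sum_step:
  assumes "h\<^sup>2 + v\<^sup>2 = s" "s > 0" "c > 0" "h / s * (v / s) + (1 / (2 * c))\<^sup>2 = D" "D > 0"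
  shows "aztec_sum (m + 2) h v c =
    s ^ (((m + 2)\<^sup>2 + 1) div 2) * (2 * c\<^sup>2) ^ ((m + 2)\<^sup>2 div 2) * D ^ (m + 1) *
    aztec_sum m (h / s) (v / s) (1 / (2 * c))"
proof -
  let ?r = "int (m + 2) - 1"
  have r: "?r - 1 - 1 = int m - 1" "?r = (int m - 1) + 2"
    by simp_all
  have "aztec_sum (m + 2) h v c =
      s ^ card (aztec_even False ?r ?r) * (2 * c\<^sup>2) ^ card (aztec_odd False ?r ?r) *
      matching_sum grid_edges (wt (h / s) (v / s) (1 / (2 * c))) (aztec True ?r (?r - 1))"
    unfolding aztec_sum_def using assms by (intro wt_reduction_odd) auto
  also have "matching_sum grid_edges (wt (h / s) (v / s) (1 / (2 * c))) (aztec True ?r (?r - 1)) =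
      D ^ card (aztec_vertices True ?r (?r - 1)) *
      matching_sum grid_edges (wt (v / s / D) (h / s / D) (1 / (2 * c) / D)) (aztec False ?r (?r - 1 - 1))"
    using assms by (intro wt_reduction_even) auto
  also have "card (aztec_even False ?r ?r) = ((m + 2)\<^sup>2 + 1) div 2"
    by (rule card_aztec_even) simp
  also have "card (aztec_odd False ?r ?r) = (m + 2)\<^sup>2 div 2"
    by (rule card_aztec_odd) simp
  also have "card (aztec_vertices True ?r (?r - 1)) = (m + 1)\<^sup>2"
    by (rule card_aztec_vertices) auto
  \<comment> \<open>The reductions keep the centre at \<open>m + 1\<close>; the shift moves it to
    \<open>m - 1\<close>, the standard position for order \<open>m\<close>.\<close>
  also have "matching_sum grid_edges (wt (v / s / D) (h / s / D) (1 / (2 * c) / D)) (aztec False ?r (?r - 1 - 1)) =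
      aztec_sum m (1 / D * (h / s)) (1 / D * (v / s)) (1 / D * (1 / (2 * c)))"
    unfolding r(1) unfolding r(2) wt_shift aztec_sum_def by (simp add: mult.commute)
  also have "\<dots> = (1 / D) ^ (m * (m + 1)) * aztec_sum m (h / s) (v / s) (1 / (2 * c))"
    by (rule aztec_sum_scale)
  also have "D ^ (m + 1)\<^sup>2 = D ^ (m + 1) * D ^ (m * (m + 1))"
    by (simp add: power_add[symmetric] power2_eq_square algebra_simps)
  finally show ?thesis
    using assms(5) by (simp add: power_one_over field_simps)
qed

lemma aztec_sum_0: "aztec_sum 0 h v c = 1"
proof -
  have "aztec_vertices False (- 1) (- 1) = {}"
    by (auto simp: aztec_vertices_def)
  then have "aztec False (- 1) (- 1) = {}"
    by (simp add: aztec_def)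
  moreover have "{} \<notin> grid_edges"
    by (auto simp: grid_edges_def up_def left_def)
  ultimately show ?thesis
    by (simp add: aztec_sum_def matching_sum_no_vertices)
qed

lemma aztec_sum_1:
  assumes "h\<^sup>2 + v\<^sup>2 > 0" "c > 0"
  shows "aztec_sum 1 h v c = h\<^sup>2 + v\<^sup>2"
proof -
  have "aztec_vertices True 0 (- 1) = {}"
    by (auto simp: aztec_vertices_def)
  then have "aztec True 0 (- 1) = {}"
    by (simp add: aztec_def)
  moreover have "{} \<notin> grid_edges"
    by (auto simp: grid_edges_def up_def left_def)
  moreover have nz: "h\<^sup>2 + v\<^sup>2 \<noteq> 0" "c \<noteq> 0"
    using assms by linarith+
  moreover have "card (aztec_even False 0 0) = 1" "card (aztec_odd False 0 0) = 0"
    using card_aztec_even[of 0 1] card_aztec_odd[of 0 1] by simp_all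
  ultimately show ?thesis
    using wt_reduction_odd[OF refl nz, of 0 0] by (simp add: aztec_sum_def matching_sum_no_vertices)
qed

text \<open>The exponent of 2 is the number of replaced nodes of the diamond
  (\<open>card_aztec_even\<close>), one factor for each use of urban renewal. That this counts
  tilings is shown in \<open>matchings_region\<close>.\<close>

definition tiling_number :: "nat \<Rightarrow> real" where
  "tiling_number m = 2 ^ ((m\<^sup>2 + 1) div 2) * aztec_sum m (3 / 2) (1 / 2) 1"

lemma tiling_number_step: "tiling_number (m + 4) = 37 ^ (m + 3) * 7 ^ (m + 1) * tiling_number m"
proof -
  define x where "x = (m\<^sup>2 + 1) div 2"
  define y where "y = m\<^sup>2 div 2"
  \<comment> \<open>The three squares differ by even numbers, so their halves rounded up
    (\<open>x\<close>) and rounded down (\<open>y\<close>) grow by the same amounts.\<close>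
  have sq: "(m + 2)\<^sup>2 = m\<^sup>2 + 2 * (2 * m + 2)" "(m + 4)\<^sup>2 = m\<^sup>2 + 2 * (4 * m + 8)"
    by (simp_all add: power2_eq_square algebra_simps)
  have exps: "((m + 4)\<^sup>2 + 1) div 2 = x + 4 * m + 8" "(m + 4)\<^sup>2 div 2 = y + 4 * m + 8"
    "((m + 2)\<^sup>2 + 1) div 2 = x + 2 * m + 2" "(m + 2)\<^sup>2 div 2 = y + 2 * m + 2"
    unfolding sq x_def y_def by presburger+
  have xy: "m * m = x + y"
    unfolding x_def y_def power2_eq_square[symmetric] by presburger
  have m: "m + 4 = m + 2 + 2" "m + 2 + 1 = m + 3"
    by simp_all
  \<comment> \<open>One pair of reductions turns \<open>(3/2, 1/2, 1)\<close> into half of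
    \<open>(6/5, 2/5, 1)\<close>, with \<open>37/100 = 3/5 * 1/5 + 1/4\<close>; the next pair turns
    \<open>(6/5, 2/5, 1)\<close> into half of \<open>(3/2, 1/2, 1)\<close>, with
    \<open>7/16 = 3/4 * 1/4 + 1/4\<close>. This closes the cycle.\<close>
  have halves: "3 / 2 / (5 / 2) = 1 / 2 * (6 / 5 :: real)" "1 / 2 / (5 / 2) = 1 / 2 * (2 / 5 :: real)"
    "6 / 5 / (8 / 5) = 1 / 2 * (3 / 2 :: real)" "2 / 5 / (8 / 5) = 1 / 2 * (1 / 2 :: real)"
    "1 / (2 * 1) = 1 / 2 * (1 :: real)" "2 * 1\<^sup>2 = (2 :: real)"
    by simp_all
  have "aztec_sum (m + 4) (3 / 2) (1 / 2) 1 =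
      (5 / 2) ^ (((m + 4)\<^sup>2 + 1) div 2) * (2 * 1\<^sup>2) ^ ((m + 4)\<^sup>2 div 2) * (37 / 100) ^ (m + 2 + 1) *
      aztec_sum (m + 2) (3 / 2 / (5 / 2)) (1 / 2 / (5 / 2)) (1 / (2 * 1))"
    unfolding m(1) by (rule aztec_sum_step) (simp_all add: power2_eq_square)
  also have "\<dots> = (5 / 2) ^ (x + 4 * m + 8) * 2 ^ (y + 4 * m + 8) * (37 / 100) ^ (m + 3) *
      aztec_sum (m + 2) (1 / 2 * (6 / 5)) (1 / 2 * (2 / 5)) (1 / 2 * 1)"
    unfolding exps halves m(2) ..
  also have "aztec_sum (m + 2) (1 / 2 * (6 / 5)) (1 / 2 * (2 / 5)) (1 / 2 * 1) =
      (1 / 2) ^ ((m + 2) * (m + 2 + 1)) * aztec_sum (m + 2) (6 / 5) (2 / 5) 1"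
    by (rule aztec_sum_scale)
  also have "aztec_sum (m + 2) (6 / 5) (2 / 5) 1 =
      (8 / 5) ^ (((m + 2)\<^sup>2 + 1) div 2) * (2 * 1\<^sup>2) ^ ((m + 2)\<^sup>2 div 2) * (7 / 16) ^ (m + 1) *
      aztec_sum m (6 / 5 / (8 / 5)) (2 / 5 / (8 / 5)) (1 / (2 * 1))"
    by (rule aztec_sum_step) (simp_all add: power2_eq_square)
  also have "\<dots> = (8 / 5) ^ (x + 2 * m + 2) * 2 ^ (y + 2 * m + 2) * (7 / 16) ^ (m + 1) *
      aztec_sum m (1 / 2 * (3 / 2)) (1 / 2 * (1 / 2)) (1 / 2 * 1)"
    unfolding exps halves ..
  also have "aztec_sum m (1 / 2 * (3 / 2)) (1 / 2 * (1 / 2)) (1 / 2 * 1) =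
      (1 / 2) ^ (m * (m + 1)) * aztec_sum m (3 / 2) (1 / 2) 1"
    by (rule aztec_sum_scale)
  finally have 1: "tiling_number (m + 4) = 2 ^ (x + 4 * m + 8) *
     ((5 / 2) ^ (x + 4 * m + 8) * 2 ^ (y + 4 * m + 8) * (37 / 100) ^ (m + 3) *
     ((1 / 2) ^ ((m + 2) * (m + 3)) *
     ((8 / 5) ^ (x + 2 * m + 2) * 2 ^ (y + 2 * m + 2) * (7 / 16) ^ (m + 1) *
     (1 / 2) ^ (m * (m + 1))))) * aztec_sum m (3 / 2) (1 / 2) 1"
    unfolding tiling_number_def exps m(2) by (simp only: mult.assoc)
  have 2: "tiling_number m = 2 ^ x * aztec_sum m (3 / 2) (1 / 2) 1"
    by (simp add: tiling_number_def x_def)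
  have 6: "(2::real) ^ (x + 4 * m + 8) *
     ((5 / 2) ^ (x + 4 * m + 8) * 2 ^ (y + 4 * m + 8) * (37 / 100) ^ (m + 3) *
     ((1 / 2) ^ ((m + 2) * (m + 3)) *
     ((8 / 5) ^ (x + 2 * m + 2) * 2 ^ (y + 2 * m + 2) * (7 / 16) ^ (m + 1) *
     (1 / 2) ^ (m * (m + 1))))) = 37 ^ (m + 3) * 7 ^ (m + 1) * 2 ^ x"
  proof -
    have 4: "(8 :: real) = 2 ^ 3" "(16 :: real) = 2 ^ 4" "(100 :: real) = 2 ^ 2 * 5 ^ 2"
      by simp_all
    have 3: "(m + 2) * (m + 3) = x + y + 5 * m + 6" "m * (m + 1) = x + y + m"
      using xy by (simp_all add: algebra_simps)
    have 5: "(8 :: real) ^ x = 2 ^ x * 2 ^ x * 2 ^ x" "(64 :: real) ^ m = 2 ^ m * 32 ^ m"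
      "(625 :: real) ^ m = 25 ^ m * 25 ^ m"
      unfolding power_mult_distrib[symmetric] by simp_all
    show ?thesis
      unfolding 3 4 power_divide power_mult_distrib power_mult[symmetric] power_one
      by (simp add: divide_simps power_add power_mult power_mult_distrib) (simp only: 5 mult_ac)
  qed
  show ?thesis
    unfolding 1 2 6 by (simp only: mult.assoc)
qed

lemma tiling_number_base:
  "tiling_number 0 = 1" "tiling_number 1 = 5" "tiling_number 2 = 37" "tiling_number 3 = 2738"
proof -
  show "tiling_number 0 = 1"
    by (simp add: tiling_number_def aztec_sum_0)
  show "tiling_number 1 = 5"
    unfolding tiling_number_def by (subst aztec_sum_1) (simp_all add: power2_eq_square)
  have step: "aztec_sum k (3 / 2) (1 / 2) 1 =
      (5 / 2) ^ ((k\<^sup>2 + 1) div 2) * 2 ^ (k\<^sup>2 div 2) * (37 / 100) ^ (m + 1) *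
      aztec_sum m (3 / 5) (1 / 5) (1 / 2)" if "k = m + 2" for m k
    using aztec_sum_step[of "3 / 2" "1 / 2" "5 / 2" 1 "37 / 100" m] unfolding that
    by (simp add: power2_eq_square)
  show "tiling_number 2 = 37"
    using step[of 2 0] by (simp add: tiling_number_def aztec_sum_0 power2_eq_square)
  have "aztec_sum 1 (3 / 5) (1 / 5) (1 / 2) = 2 / 5"
    by (subst aztec_sum_1) (simp_all add: power2_eq_square)
  then show "tiling_number 3 = 2738"
    using step[of 3 1] by (simp add: tiling_number_def power_divide)
qed

lemma tiling_number_eq:
  "tiling_number (4 * n) = 7 ^ (n * (2 * n - 1)) * 37 ^ (n * (2 * n + 1))"
  "tiling_number (4 * n + 1) = 5 * 7 ^ (2 * n ^ 2) * 37 ^ (2 * n * (n + 1))"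
  "tiling_number (4 * n + 2) = 7 ^ (n * (2 * n + 1)) * 37 ^ ((n + 1) * (2 * n + 1))"
  "tiling_number (4 * n + 3) = 2 * 7 ^ (2 * n * (n + 1)) * 37 ^ (2 * n * (n + 2) + 2)"
proof (induction n)
  case 0
  show "tiling_number (4 * 0) = 7 ^ (0 * (2 * 0 - 1)) * 37 ^ (0 * (2 * 0 + 1))"
    "tiling_number (4 * 0 + 1) = 5 * 7 ^ (2 * 0 ^ 2) * 37 ^ (2 * 0 * (0 + 1))"
    "tiling_number (4 * 0 + 2) = 7 ^ (0 * (2 * 0 + 1)) * 37 ^ ((0 + 1) * (2 * 0 + 1))"
    "tiling_number (4 * 0 + 3) = 2 * 7 ^ (2 * 0 * (0 + 1)) * 37 ^ (2 * 0 * (0 + 2) + 2)"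
    using tiling_number_base by (simp_all add: numeral_eq_Suc)
next
  case (Suc n)
  have step: "tiling_number (4 * Suc n + i) = 37 ^ (4 * n + i + 3) * 7 ^ (4 * n + i + 1) * tiling_number (4 * n + i)" for i
    using tiling_number_step[of "4 * n + i"] by (simp add: algebra_simps)
  \<comment> \<open>The truncated \<open>2 * n - 1\<close> is harmless at \<open>n = 0\<close>
    because of the factor \<open>n\<close>, but it needs the case distinction.\<close>
  have exps: "Suc n * (2 * Suc n - 1) = (4 * n + 1) + n * (2 * n - 1)"
    "Suc n * (2 * Suc n + 1) = (4 * n + 3) + n * (2 * n + 1)"
    by (cases n; simp add: algebra_simps)+
  show "tiling_number (4 * Suc n) = 7 ^ (Suc n * (2 * Suc n - 1)) * 37 ^ (Suc n * (2 * Suc n + 1))"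
    using step[of 0] Suc(1) unfolding exps add_0_right by (simp only: power_add mult_ac)
  have exps1: "2 * (Suc n)\<^sup>2 = (4 * n + 1 + 1) + 2 * n\<^sup>2"
    "2 * Suc n * (Suc n + 1) = (4 * n + 1 + 3) + 2 * n * (n + 1)"
    by (simp_all add: power2_eq_square)
  show "tiling_number (4 * Suc n + 1) = 5 * 7 ^ (2 * (Suc n)\<^sup>2) * 37 ^ (2 * Suc n * (Suc n + 1))"
    unfolding step Suc exps1 by (simp only: power_add mult_ac)
  have exps2: "Suc n * (2 * Suc n + 1) = (4 * n + 2 + 1) + n * (2 * n + 1)"
    "(Suc n + 1) * (2 * Suc n + 1) = (4 * n + 2 + 3) + (n + 1) * (2 * n + 1)"
    by simp_all
  show "tiling_number (4 * Suc n + 2) = 7 ^ (Suc n * (2 * Suc n + 1)) * 37 ^ ((Suc n + 1) * (2 * Suc n + 1))"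
    unfolding step Suc exps2 by (simp only: power_add mult_ac)
  have exps3: "2 * Suc n * (Suc n + 1) = (4 * n + 3 + 1) + 2 * n * (n + 1)"
    "2 * Suc n * (Suc n + 2) + 2 = (4 * n + 3 + 3) + (2 * n * (n + 2) + 2)"
    by simp_all
  show "tiling_number (4 * Suc n + 3) = 2 * 7 ^ (2 * Suc n * (Suc n + 1)) * 37 ^ (2 * Suc n * (Suc n + 2) + 2)"
    unfolding step Suc exps3 by (simp only: power_add mult_ac)
qed

subsection \<open>Tilings and matchings of the dual graph\<close>

text \<open>Separates topology from the particular lattice: once the complement of the segments is
  an indexed disjoint union of nonempty connected open sets, tilings are perfect matchings on the
  index set.\<close>

locale cell_decomposition =
  fixes K :: "plane set set" and U :: "'i \<Rightarrow> plane set"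
  assumes open_cell: "open (U i)"
    and connected_cell: "connected (U i)"
    and nonempty_cell: "U i \<noteq> {}"
    and disjoint_cells: "i \<noteq> j \<Longrightarrow> U i \<inter> U j = {}"
    and cells_cover: "- \<Union>K = (\<Union>i. U i)"
begin

definition cells_union :: "'i set \<Rightarrow> plane set" where
  "cells_union J = (\<Union>i\<in>J. closure (U i))"

definition dual_edges :: "'i set set" where
  "dual_edges = {{i, j} | i j. i \<noteq> j \<and> share_edge (closure (U i)) (closure (U j))}"

text \<open>A connected set inside the complement that contains \<open>U i\<close> cannot meet
  another cell: \<open>U i\<close> and the union of all other cells are disjoint open sets covering
  it.\<close>

lemma components_eq_cells: "components (- \<Union>K) = range U"
proof -
  have cell: "U i \<in> components (- \<Union>K)" for i
    unfolding in_components_maximal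
  proof (intro conjI allI impI)
    show "U i \<noteq> {}" "connected (U i)"
      by (rule nonempty_cell connected_cell)+
    show "U i \<subseteq> - \<Union>K"
      unfolding cells_cover by blast
    fix d assume d: "d \<noteq> {} \<and> U i \<subseteq> d \<and> d \<subseteq> - \<Union>K \<and> connected d"
    define V where "V = (\<Union>j\<in>-{i}. U j)"
    have "open V"
      unfolding V_def by (intro open_UN ballI open_cell)
    have "U i \<inter> U j = {}" if "j \<in> -{i}" for j
      using disjoint_cells[of i j] that by simp
    then have "U i \<inter> V = {}"
      unfolding V_def by blast
    have "d \<subseteq> U i \<union> V"
      using d unfolding cells_cover V_def by blast
    have "U i \<inter> d = {} \<or> V \<inter> d = {}"
    proof (rule connectedD)
      show "U i \<inter> V \<inter> d = {}"
        using \<open>U i \<inter> V = {}\<close> by simp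
    qed (use d open_cell \<open>open V\<close> \<open>d \<subseteq> U i \<union> V\<close> in auto)
    moreover have "U i \<inter> d = U i"
      using d by (intro Int_absorb2) simp
    ultimately have "V \<inter> d = {}"
      using nonempty_cell[of i] by simp
    then show "d = U i"
      using d \<open>d \<subseteq> U i \<union> V\<close> by blast
  qed
  have "c \<in> range U" if c: "c \<in> components (- \<Union>K)" for c
  proof -
    obtain x where x: "x \<in> c"
      using in_components_nonempty[OF c] by blast
    then have "x \<in> (\<Union>i. U i)"
      using in_components_subset[OF c] unfolding cells_cover by (rule rev_subsetD)
    then obtain i where "x \<in> U i"
      by blast
    then have "c \<inter> U i \<noteq> {}"
      using x by blast
    then have "c = U i"
      using components_eq[OF c cell[of i]] by simp
    then show ?thesis
      by simp
  qed
  moreover have "range U \<subseteq> components (- \<Union>K)"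
    using cell by (rule image_subsetI)
  ultimately show ?thesis
    by (intro equalityI subsetI) (assumption | erule subsetD)+
qed

lemma elementary_regions_eq: "elementary_regions K = range (\<lambda>i. closure (U i))"
  by (simp add: elementary_regions_def components_eq_cells image_image)

text \<open>An open set that misses a set also misses its closure. Hence the index of a cell can be
  recovered from its closed region, and an index set from the union of its closed regions.\<close>

lemma cell_meets_closure: "U i \<inter> closure (U j) \<noteq> {} \<longleftrightarrow> i = j"
  using open_Int_closure_eq_empty[OF open_cell, of i "U j"] disjoint_cells[of i j] nonempty_cell[of i] by auto

lemma cell_meets_union: "U i \<inter> cells_union J \<noteq> {} \<longleftrightarrow> i \<in> J"
proof -
  have "U i \<inter> cells_union J \<noteq> {} \<longleftrightarrow> (\<exists>j\<in>J. U i \<inter> closure (U j) \<noteq> {})"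
    unfolding cells_union_def by blast
  then show ?thesis
    unfolding cell_meets_closure by blast
qed

lemma inj_cells_union: "inj cells_union"
proof (rule injI)
  fix I J assume "cells_union I = cells_union J"
  then have "i \<in> I \<longleftrightarrow> i \<in> J" for i
    using cell_meets_union[of i I] cell_meets_union[of i J] by simp
  then show "I = J" by blast
qed

lemma inj_closure_cell: "inj (\<lambda>i. closure (U i))"
proof (rule injI)
  fix i j assume "closure (U i) = closure (U j)"
  then show "i = j"
    using cell_meets_closure[of i j] closure_subset[of "U i"] nonempty_cell[of i] by blast
qed

lemma tiles_eq: "tiles K = cells_union ` dual_edges"
proof -
  have pair: "cells_union {i, j} = closure (U i) \<union> closure (U j)" for i j
    by (simp add: cells_union_def)
  have "tiles K = {closure (U i) \<union> closure (U j) | i j. closure (U i) \<noteq> closure (U j) \<and>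
      share_edge (closure (U i)) (closure (U j))}"
    unfolding tiles_def elementary_regions_eq by blast
  also have "\<dots> = {cells_union {i, j} | i j. i \<noteq> j \<and> share_edge (closure (U i)) (closure (U j))}"
    unfolding pair inj_eq[OF inj_closure_cell] ..
  also have "\<dots> = cells_union ` dual_edges"
    unfolding dual_edges_def by blast
  finally show ?thesis .
qed

text \<open>Nonoverlapping tiles become disjoint index sets. An open set inside both unions would
  meet some closed region of \<open>I\<close>, hence its open cell, and an open cell meets the union
  over \<open>J\<close> only if its index is in \<open>J\<close>.\<close>

lemma interior_cells_disjoint_iff:
  "interior (cells_union I) \<inter> interior (cells_union J) = {} \<longleftrightarrow> I \<inter> J = {}"
proof
  assume *: "interior (cells_union I) \<inter> interior (cells_union J) = {}"
  have sub: "U i \<subseteq> interior (cells_union L)" if "i \<in> L" for i L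
  proof (rule interior_maximal)
    show "U i \<subseteq> cells_union L"
      using that closure_subset[of "U i"] unfolding cells_union_def by blast
  qed (rule open_cell)
  have False if "i \<in> I" "i \<in> J" for i
    using sub[OF that(1)] sub[OF that(2)] * nonempty_cell[of i] by blast
  then show "I \<inter> J = {}"
    by blast
next
  assume *: "I \<inter> J = {}"
  define W where "W = interior (cells_union I) \<inter> interior (cells_union J)"
  have W: "open W" "W \<subseteq> cells_union I" "W \<subseteq> cells_union J"
    unfolding W_def using interior_subset[of "cells_union I"] interior_subset[of "cells_union J"]
    by (auto intro: open_Int)
  have False if x: "x \<in> W" for x
  proof -
    obtain i where i: "i \<in> I" "x \<in> closure (U i)"
      using subsetD[OF W(2) x] unfolding cells_union_def by blast
    then have "W \<inter> closure (U i) \<noteq> {}"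
      using x by blast
    then have "W \<inter> U i \<noteq> {}"
      using open_Int_closure_eq_empty[OF W(1), of "U i"] by simp
    then obtain y where "y \<in> W" "y \<in> U i"
      by blast
    then have "U i \<inter> cells_union J \<noteq> {}"
      using subsetD[OF W(3)] by blast
    then show False
      using cell_meets_union[of i J] i(1) * by blast
  qed
  then show "interior (cells_union I) \<inter> interior (cells_union J) = {}"
    unfolding W_def by blast
qed

lemma cells_union_UN: "\<Union>(cells_union ` M) = cells_union (\<Union>M)"
  by (auto simp: cells_union_def)

lemma tilings_eq: "tilings K (cells_union J) = (`) cells_union ` matchings dual_edges J"
proof -
  have dis: "pairwise (\<lambda>s t. interior s \<inter> interior t = {}) (cells_union ` M) \<longleftrightarrow> disjoint M" for M
    using inj_cells_union
    by (auto simp: pairwise_def disjoint_def interior_cells_disjoint_iff inj_eq disjnt_def)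
  have un: "\<Union>(cells_union ` M) = cells_union J \<longleftrightarrow> \<Union>M = J" for M
    unfolding cells_union_UN using inj_cells_union by (simp add: inj_eq)
  have "\<T> \<in> tilings K (cells_union J) \<longleftrightarrow>
      (\<exists>M. M \<subseteq> dual_edges \<and> \<T> = cells_union ` M \<and> \<Union>(cells_union ` M) = cells_union J \<and>
        pairwise (\<lambda>s t. interior s \<inter> interior t = {}) (cells_union ` M))" for \<T>
    unfolding tilings_def tiles_eq mem_Collect_eq subset_image_iff by metis
  then show ?thesis
    unfolding dis un matchings_def by (intro set_eqI) (simp add: image_iff conj_ac)
qed

theorem num_tilings_eq: "num_tilings K (cells_union J) = card (matchings dual_edges J)"
proof -
  have "inj ((`) cells_union)"
    using inj_cells_union by (auto intro!: injI simp: inj_image_eq_iff)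
  then show ?thesis
    unfolding num_tilings_def tilings_eq by (intro card_image) (auto intro: inj_on_subset)
qed

lemma union_of_regions_meeting:
  assumes "open W"
  shows "\<Union>{A \<in> elementary_regions K. interior A \<inter> W \<noteq> {}} = cells_union {i. U i \<inter> W \<noteq> {}}"
proof -
  have "interior (closure (U i)) \<inter> W \<noteq> {} \<longleftrightarrow> U i \<inter> W \<noteq> {}" for i
  proof
    assume *: "U i \<inter> W \<noteq> {}"
    have "U i \<subseteq> interior (closure (U i))"
      by (rule interior_maximal[OF closure_subset open_cell])
    then show "interior (closure (U i)) \<inter> W \<noteq> {}"
      using * by blast
  next
    assume "interior (closure (U i)) \<inter> W \<noteq> {}"
    then have "W \<inter> closure (U i) \<noteq> {}"
      using interior_subset[of "closure (U i)"] by blast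
    then show "U i \<inter> W \<noteq> {}"
      using open_Int_closure_eq_empty[OF assms, of "U i"] by (simp add: Int_commute)
  qed
  then show ?thesis
    unfolding elementary_regions_eq cells_union_def by blast
qed

end

subsection \<open>Triangles and quadrilaterals\<close>

text \<open>The corner of a square where the replacement takes place is \<open>(even_end i, odd_end j)\<close>; the segment added
  inside the square is given by \<open>level = 1\<close>.\<close>

definition even_end :: "int \<Rightarrow> int" where
  "even_end i = (if even i then i else i + 1)"

definition odd_end :: "int \<Rightarrow> int" where
  "odd_end j = (if odd j then j else j + 1)"

text \<open>Inside the strip this is the distance to the line through the replaced corner. Unlike an
  absolute value it is affine in \<open>x\<close> everywhere, which makes \<open>level\<close>
  affine and the cells convex.\<close>

definition even_dist :: "int \<Rightarrow> real \<Rightarrow> real" where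
  "even_dist i x = (if even i then x - of_int i else of_int i + 1 - x)"

definition odd_dist :: "int \<Rightarrow> real \<Rightarrow> real" where
  "odd_dist j y = (if odd j then y - of_int j else of_int j + 1 - y)"

text \<open>In offsets \<open>(s, t)\<close> from the replaced corner, the added segment joins
  \<open>(1/2, 0)\<close> to \<open>(0, 1)\<close> at a node of the first kind, hence
  \<open>2 s + t = 1\<close>, and \<open>(0, 1/2)\<close> to \<open>(1, 0)\<close> at one of the
  second kind.\<close>

definition level :: "square \<Rightarrow> plane \<Rightarrow> real" where
  "level = (\<lambda>(i, j) (x, y). if first_node (even_end i, odd_end j)
     then 2 * even_dist i x + odd_dist j y else even_dist i x + 2 * odd_dist j y)"

text \<open>\<open>Inl\<close> stands for the quadrilateral and \<open>Inr\<close> for the triangle in a square.\<close>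

fun cell :: "square + square \<Rightarrow> plane set" where
  "cell (Inl (i, j)) = {p. of_int i < fst p \<and> fst p < of_int i + 1 \<and> of_int j < snd p \<and>
     snd p < of_int j + 1 \<and> level (i, j) p > 1}"
| "cell (Inr (i, j)) = {p. of_int i < fst p \<and> fst p < of_int i + 1 \<and> of_int j < snd p \<and>
     snd p < of_int j + 1 \<and> level (i, j) p < 1}"

fun closed_cell :: "square + square \<Rightarrow> plane set" where
  "closed_cell (Inl (i, j)) = {p. of_int i \<le> fst p \<and> fst p \<le> of_int i + 1 \<and> of_int j \<le> snd p \<and>
     snd p \<le> of_int j + 1 \<and> level (i, j) p \<ge> 1}"
| "closed_cell (Inr (i, j)) = {p. of_int i \<le> fst p \<and> fst p \<le> of_int i + 1 \<and> of_int j \<le> snd p \<and>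
     snd p \<le> of_int j + 1 \<and> level (i, j) p \<le> 1}"

lemma cell_exhaust:
  obtains i j where "k = Inl (i, j)" | i j where "k = Inr (i, j)"
  by (metis surj_pair sumE)

lemma level_pair: "level (i, j) (x, y) = (if first_node (even_end i, odd_end j)
     then 2 * even_dist i x + odd_dist j y else even_dist i x + 2 * odd_dist j y)"
  by (simp add: level_def)

lemma continuous_level: "continuous_on UNIV (\<lambda>p. level s p)"
proof -
  obtain i j where s: "s = (i, j)"
    by fastforce
  have *: "level s = (\<lambda>p. if first_node (even_end i, odd_end j)
     then 2 * even_dist i (fst p) + odd_dist j (snd p) else even_dist i (fst p) + 2 * odd_dist j (snd p))"
    by (auto simp: s level_def)
  have "continuous_on UNIV (\<lambda>p :: plane. even_dist i (fst p))" "continuous_on UNIV (\<lambda>p :: plane. odd_dist j (snd p))"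
    unfolding even_dist_def odd_dist_def by (cases "even i"; simp; intro continuous_intros; fail)
      (cases "even j"; simp; intro continuous_intros; fail)
  then show ?thesis
    unfolding * by (cases "first_node (even_end i, odd_end j)")
      (simp_all add: continuous_on_add continuous_on_mult_left)
qed

lemma open_cell: "open (cell k)"
proof -
  have "open {p :: plane. of_int i < fst p \<and> fst p < of_int i + 1 \<and> of_int j < snd p \<and> snd p < of_int j + 1 \<and> level (i, j) p > 1}"
    "open {p :: plane. of_int i < fst p \<and> fst p < of_int i + 1 \<and> of_int j < snd p \<and> snd p < of_int j + 1 \<and> level (i, j) p < 1}"
    for i j
    by (intro open_Collect_conj open_Collect_less continuous_intros continuous_level)+
  then show ?thesis
    by (cases k rule: cell_exhaust) simp_all
qed

lemma closed_closed_cell: "closed (closed_cell k)"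
proof -
  have "closed {p :: plane. of_int i \<le> fst p \<and> fst p \<le> of_int i + 1 \<and> of_int j \<le> snd p \<and> snd p \<le> of_int j + 1 \<and> level (i, j) p \<ge> 1}"
    "closed {p :: plane. of_int i \<le> fst p \<and> fst p \<le> of_int i + 1 \<and> of_int j \<le> snd p \<and> snd p \<le> of_int j + 1 \<and> level (i, j) p \<le> 1}"
    for i j
    by (intro closed_Collect_conj closed_Collect_le continuous_intros continuous_level)+
  then show ?thesis
    by (cases k rule: cell_exhaust) simp_all
qed

lemma level_affine:
  "level s ((1 - u) *\<^sub>R p + u *\<^sub>R q) = (1 - u) * level s p + u * level s q"
proof -
  obtain i j where s: "s = (i, j)"
    by fastforce
  have "even_dist i ((1 - u) * x + u * x') = (1 - u) * even_dist i x + u * even_dist i x'"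
    "odd_dist j ((1 - u) * x + u * x') = (1 - u) * odd_dist j x + u * odd_dist j x'" for x x'
    by (simp_all add: even_dist_def odd_dist_def algebra_simps)
  note affine = this
  show ?thesis
    by (simp add: s level_def case_prod_beta affine) (simp add: algebra_simps)
qed

lemma closed_cell_combination:
  assumes "p \<in> closed_cell k" "q \<in> closed_cell k" "0 \<le> u" "u \<le> 1"
  shows "(1 - u) *\<^sub>R p + u *\<^sub>R q \<in> closed_cell k"
proof -
  have le: "(1 - u) * a + u * b \<le> (1 - u) * a' + u * b'" if "a \<le> a'" "b \<le> b'" for a b a' b' :: real
    using that assms(3,4) by (intro add_mono mult_left_mono) auto
  have eq: "(1 - u) * c + u * c = c" for c :: real
    by (simp add: algebra_simps)
  show ?thesis
  proof (cases k rule: cell_exhaust)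
    case (1 i j)
    then show ?thesis
      using assms(1,2) le[of "of_int i" "fst p" "of_int i" "fst q"] le[of "fst p" "of_int i + 1" "fst q" "of_int i + 1"]
        le[of "of_int j" "snd p" "of_int j" "snd q"] le[of "snd p" "of_int j + 1" "snd q" "of_int j + 1"]
        le[of 1 "level (i, j) p" 1 "level (i, j) q"] level_affine[of "(i, j)" u p q]
      unfolding eq by simp
  next
    case (2 i j)
    then show ?thesis
      using assms(1,2) le[of "of_int i" "fst p" "of_int i" "fst q"] le[of "fst p" "of_int i + 1" "fst q" "of_int i + 1"]
        le[of "of_int j" "snd p" "of_int j" "snd q"] le[of "snd p" "of_int j + 1" "snd q" "of_int j + 1"]
        le[of "level (i, j) p" 1 "level (i, j) q" 1] level_affine[of "(i, j)" u p q]
      unfolding eq by simp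
  qed
qed

text \<open>A segment from a point of the closed cell to a point of the open one is in the open cell
  except possibly at its start. Both \<open>convex_cell\<close> and \<open>closure_cell\<close>
  follow from this.\<close>

lemma cell_combination:
  assumes "p \<in> closed_cell k" "q \<in> cell k" "0 < u" "u \<le> 1"
  shows "(1 - u) *\<^sub>R p + u *\<^sub>R q \<in> cell k"
proof -
  have le: "(1 - u) * a + u * b < (1 - u) * a' + u * b'" if "a \<le> a'" "b < b'" for a b a' b' :: real
    using that assms(3,4) by (intro add_le_less_mono mult_left_mono mult_strict_left_mono) auto
  have eq: "(1 - u) * c + u * c = c" for c :: real
    by (simp add: algebra_simps)
  show ?thesis
  proof (cases k rule: cell_exhaust)
    case (1 i j)
    then show ?thesis
      using assms(1,2) le[of "of_int i" "fst p" "of_int i" "fst q"] le[of "fst p" "of_int i + 1" "fst q" "of_int i + 1"]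
        le[of "of_int j" "snd p" "of_int j" "snd q"] le[of "snd p" "of_int j + 1" "snd q" "of_int j + 1"]
        le[of 1 "level (i, j) p" 1 "level (i, j) q"] level_affine[of "(i, j)" u p q]
      unfolding eq by simp
  next
    case (2 i j)
    then show ?thesis
      using assms(1,2) le[of "of_int i" "fst p" "of_int i" "fst q"] le[of "fst p" "of_int i + 1" "fst q" "of_int i + 1"]
        le[of "of_int j" "snd p" "of_int j" "snd q"] le[of "snd p" "of_int j + 1" "snd q" "of_int j + 1"]
        le[of "level (i, j) p" 1 "level (i, j) q" 1] level_affine[of "(i, j)" u p q]
      unfolding eq by simp
  qed
qed

lemma cell_subset_closed_cell: "cell k \<subseteq> closed_cell k"
  by (cases k rule: cell_exhaust) auto

lemma convex_closed_cell: "convex (closed_cell k)"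
  unfolding convex_alt using closed_cell_combination by blast

lemma convex_cell: "convex (cell k)"
  unfolding convex_alt
proof (intro ballI allI impI)
  fix p q u assume "p \<in> cell k" "q \<in> cell k" "0 \<le> u \<and> u \<le> (1 :: real)"
  then show "(1 - u) *\<^sub>R p + u *\<^sub>R q \<in> cell k"
    using cell_combination[of p k q u] cell_subset_closed_cell[of k] by (cases "u = 0") auto
qed

text \<open>Inverse of the pair \<open>even_dist\<close>, \<open>odd_dist\<close>: the point with
  offsets \<open>s\<close>, \<open>t\<close> from the replaced corner. It provides the witness
  points in cells.\<close>

definition at_dist :: "square \<Rightarrow> real \<Rightarrow> real \<Rightarrow> plane" where
  "at_dist = (\<lambda>(i, j) s t. (if even i then of_int i + s else of_int i + 1 - s,
    if odd j then of_int j + t else of_int j + 1 - t))"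

lemma level_at_dist:
  "level (i, j) (at_dist (i, j) s t) = (if first_node (even_end i, odd_end j) then 2 * s + t else s + 2 * t)"
  by (simp add: at_dist_def level_def even_dist_def odd_dist_def)

lemma at_dist_in_cell:
  assumes "0 < s" "s < 1" "0 < t" "t < 1"
  shows "at_dist (i, j) s t \<in> cell (Inl (i, j)) \<longleftrightarrow> level (i, j) (at_dist (i, j) s t) > 1"
    "at_dist (i, j) s t \<in> cell (Inr (i, j)) \<longleftrightarrow> level (i, j) (at_dist (i, j) s t) < 1"
proof -
  have "of_int i < fst (at_dist (i, j) s t) \<and> fst (at_dist (i, j) s t) < of_int i + 1 \<and>
    of_int j < snd (at_dist (i, j) s t) \<and> snd (at_dist (i, j) s t) < of_int j + 1"
    using assms by (simp add: at_dist_def)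
  then show "at_dist (i, j) s t \<in> cell (Inl (i, j)) \<longleftrightarrow> level (i, j) (at_dist (i, j) s t) > 1"
    "at_dist (i, j) s t \<in> cell (Inr (i, j)) \<longleftrightarrow> level (i, j) (at_dist (i, j) s t) < 1"
    by simp_all
qed

lemma nonempty_cell: "cell k \<noteq> {}"
proof (cases k rule: cell_exhaust)
  case (1 i j)
  \<comment> \<open>Equal offsets \<open>u\<close> give level \<open>3 * u\<close> at either kind of
    node, so \<open>3 / 4\<close> and \<open>1 / 4\<close> serve for both.\<close>
  have "at_dist (i, j) (3 / 4) (3 / 4) \<in> cell k"
    unfolding 1 by (subst at_dist_in_cell) (simp_all add: level_at_dist)
  then show ?thesis by blast
next
  case (2 i j)
  have "at_dist (i, j) (1 / 4) (1 / 4) \<in> cell k"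
    unfolding 2 by (subst at_dist_in_cell) (simp_all add: level_at_dist)
  then show ?thesis by blast
qed

lemma closure_cell: "closure (cell k) = closed_cell k"
proof
  show "closure (cell k) \<subseteq> closed_cell k"
    by (rule closure_minimal[OF cell_subset_closed_cell closed_closed_cell])
  show "closed_cell k \<subseteq> closure (cell k)"
  proof
    fix p assume p: "p \<in> closed_cell k"
    obtain q where q: "q \<in> cell k"
      using nonempty_cell by blast
    have "((\<lambda>u. (1 - u) *\<^sub>R p + u *\<^sub>R q) \<longlongrightarrow> (1 - 0) *\<^sub>R p + 0 *\<^sub>R q) (at_right (0::real))"
      by (intro tendsto_intros)
    moreover have "eventually (\<lambda>u. (1 - u) *\<^sub>R p + u *\<^sub>R q \<in> closure (cell k)) (at_right (0::real))"
    proof -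
      have "eventually (\<lambda>u :: real. u \<in> {0<..<1}) (at_right 0)"
        by (rule eventually_at_right_real) simp
      then show ?thesis
        by eventually_elim (use cell_combination[OF p q] closure_subset in force)
    qed
    ultimately have "(1 - 0) *\<^sub>R p + 0 *\<^sub>R q \<in> closure (cell k)"
      by (intro Lim_in_closed_set[of "closure (cell k)"]) auto
    then show "p \<in> closure (cell k)"
      by simp
  qed
qed

text \<open>The floors name the only square whose cells can contain \<open>p\<close>, so
  disjointness and covering reduce to comparing \<open>level\<close> with 1.\<close>

lemma mem_cell_iff:
  "p \<in> cell k \<longleftrightarrow> fst p \<notin> \<int> \<and> snd p \<notin> \<int> \<and>
    (k = Inl (\<lfloor>fst p\<rfloor>, \<lfloor>snd p\<rfloor>) \<and> level (\<lfloor>fst p\<rfloor>, \<lfloor>snd p\<rfloor>) p > 1 \<or>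
     k = Inr (\<lfloor>fst p\<rfloor>, \<lfloor>snd p\<rfloor>) \<and> level (\<lfloor>fst p\<rfloor>, \<lfloor>snd p\<rfloor>) p < 1)"
proof -
  have *: "of_int i < x \<and> x < of_int i + 1 \<longleftrightarrow> x \<notin> \<int> \<and> i = \<lfloor>x\<rfloor>" for i and x :: real
  proof
    assume x: "of_int i < x \<and> x < of_int i + 1"
    then have "\<lfloor>x\<rfloor> = i"
      by (intro floor_unique) auto
    then show "x \<notin> \<int> \<and> i = \<lfloor>x\<rfloor>"
      using x by (auto elim!: Ints_cases)
  next
    assume x: "x \<notin> \<int> \<and> i = \<lfloor>x\<rfloor>"
    then have "x \<noteq> of_int i"
      using Ints_of_int[of i] by metis
    then show "of_int i < x \<and> x < of_int i + 1"
      using x floor_correct[of x] by linarith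
  qed
  have Inl: "p \<in> cell (Inl (i, j)) \<longleftrightarrow> (of_int i < fst p \<and> fst p < of_int i + 1) \<and>
      (of_int j < snd p \<and> snd p < of_int j + 1) \<and> level (i, j) p > 1" for i j
    by simp
  have Inr: "p \<in> cell (Inr (i, j)) \<longleftrightarrow> (of_int i < fst p \<and> fst p < of_int i + 1) \<and>
      (of_int j < snd p \<and> snd p < of_int j + 1) \<and> level (i, j) p < 1" for i j
    by simp
  show ?thesis
    by (cases k rule: cell_exhaust) (auto simp only: Inl Inr * sum.inject sum.distinct prod.inject)
qed

lemma disjoint_cells: "k \<noteq> k' \<Longrightarrow> cell k \<inter> cell k' = {}"
  by (auto simp del: cell.simps simp: mem_cell_iff)

subsection \<open>The segments of the lattice\<close>

lemma Union_square_lattice: "\<Union>square_lattice = {(x, y). x \<in> \<int> \<or> y \<in> \<int>}"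
proof (intro equalityI subsetI)
  fix p assume "p \<in> \<Union>square_lattice"
  then consider i j :: int where "p \<in> closed_segment (of_int i, of_int j) (of_int i + 1, of_int j)"
    | i j :: int where "p \<in> closed_segment (of_int i, of_int j) (of_int i, of_int j + 1)"
    unfolding square_lattice_def by blast
  then show "p \<in> {(x, y). x \<in> \<int> \<or> y \<in> \<int>}"
  proof cases
    case 1
    then have "snd p = of_int j"
      by (auto simp: in_segment algebra_simps)
    then show ?thesis
      by (auto simp: case_prod_beta)
  next
    case 2
    then have "fst p = of_int i"
      by (auto simp: in_segment algebra_simps)
    then show ?thesis
      by (auto simp: case_prod_beta)
  qed
next
  fix p :: plane assume "p \<in> {(x, y). x \<in> \<int> \<or> y \<in> \<int>}"
  then consider i where "fst p = of_int i" | j where "snd p = of_int j"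
    by (auto elim!: Ints_cases)
  then show "p \<in> \<Union>square_lattice"
  proof cases
    case 1
    have "p \<in> closed_segment (of_int i, of_int \<lfloor>snd p\<rfloor>) (of_int i, of_int \<lfloor>snd p\<rfloor> + 1)"
      unfolding in_segment
      by (rule exI[of _ "frac (snd p)"]) (use 1 in \<open>auto simp: prod_eq_iff frac_def algebra_simps\<close>, linarith?)
    then show ?thesis
      unfolding square_lattice_def by blast
  next
    case 2
    have "p \<in> closed_segment (of_int \<lfloor>fst p\<rfloor>, of_int j) (of_int \<lfloor>fst p\<rfloor> + 1, of_int j)"
      unfolding in_segment
      by (rule exI[of _ "frac (fst p)"]) (use 2 in \<open>auto simp: prod_eq_iff frac_def algebra_simps\<close>, linarith?)
    then show ?thesis
      unfolding square_lattice_def by blast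
  qed
qed

lemma first_node_iff:
  "first_node (a, b) \<longleftrightarrow> (\<exists>k l. a = 4 * k \<and> b = 4 * l + 1 \<or> a = 4 * k + 2 \<and> b = 4 * l - 1)"
  unfolding first_node_def case_prod_conv by presburger

lemma second_node_iff:
  "second_node (a, b) \<longleftrightarrow> (\<exists>k l. a = 4 * k + 2 \<and> b = 4 * l + 1 \<or> a = 4 * k \<and> b = 4 * l - 1)"
  unfolding second_node_def case_prod_conv by presburger

lemma Union_replaced_lattice:
  "p \<in> \<Union>replaced_lattice \<longleftrightarrow> p \<in> \<Union>square_lattice \<or>
    (\<exists>a b. first_node (a, b) \<and> p \<in> \<Union>(first_replacement (node a b)) \<or>
      second_node (a, b) \<and> p \<in> \<Union>(second_replacement (node a b)))"
proof -
  have "p \<in> \<Union>replaced_lattice \<longleftrightarrow> p \<in> \<Union>square_lattice \<or> (\<exists>k l.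
      p \<in> \<Union>(first_replacement (node (4 * k) (4 * l + 1))) \<or>
      p \<in> \<Union>(first_replacement (node (4 * k + 2) (4 * l - 1))) \<or>
      p \<in> \<Union>(second_replacement (node (4 * k + 2) (4 * l + 1))) \<or>
      p \<in> \<Union>(second_replacement (node (4 * k) (4 * l - 1))))"
    unfolding replaced_lattice_def by (simp add: bex_Un ex_disj_distrib)
  also have "\<dots> \<longleftrightarrow> p \<in> \<Union>square_lattice \<or>
    (\<exists>a b. first_node (a, b) \<and> p \<in> \<Union>(first_replacement (node a b)) \<or>
      second_node (a, b) \<and> p \<in> \<Union>(second_replacement (node a b)))"
    unfolding first_node_iff second_node_iff by metis
  finally show ?thesis .
qed

lemma mem_first_replacement_iff:
  "p \<in> \<Union>(first_replacement (node a b)) \<longleftrightarrow> (\<exists>s\<in>{-1, 1}. \<exists>t\<in>{-1, 1}. \<exists>u. 0 \<le> u \<and> u \<le> 1 \<and>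
    fst p = of_int a + (1 - u) * s / 2 \<and> snd p = of_int b + u * t)"
proof -
  have "p \<in> \<Union>(first_replacement (node a b)) \<longleftrightarrow>
      (\<exists>s\<in>{-1, 1}. \<exists>t\<in>{-1, 1}. p \<in> closed_segment (node a b + (s / 2, 0)) (node a b + (0, t)))"
    unfolding first_replacement_def by blast
  moreover have "p = (1 - u) *\<^sub>R (node a b + (s / 2, 0)) + u *\<^sub>R (node a b + (0, t)) \<longleftrightarrow>
      fst p = of_int a + (1 - u) * s / 2 \<and> snd p = of_int b + u * t" for s t u
    by (simp add: prod_eq_iff node_def algebra_simps)
  ultimately show ?thesis
    unfolding in_segment by (simp only:)
qed

lemma mem_second_replacement_iff:
  "p \<in> \<Union>(second_replacement (node a b)) \<longleftrightarrow> (\<exists>s\<in>{-1, 1}. \<exists>t\<in>{-1, 1}. \<exists>u. 0 \<le> u \<and> u \<le> 1 \<and>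
    fst p = of_int a + u * t \<and> snd p = of_int b + (1 - u) * s / 2)"
proof -
  have "p \<in> \<Union>(second_replacement (node a b)) \<longleftrightarrow>
      (\<exists>s\<in>{-1, 1}. \<exists>t\<in>{-1, 1}. p \<in> closed_segment (node a b + (0, s / 2)) (node a b + (t, 0)))"
    unfolding second_replacement_def by blast
  moreover have "p = (1 - u) *\<^sub>R (node a b + (0, s / 2)) + u *\<^sub>R (node a b + (t, 0)) \<longleftrightarrow>
      fst p = of_int a + u * t \<and> snd p = of_int b + (1 - u) * s / 2" for s t u
    by (simp add: prod_eq_iff node_def algebra_simps)
  ultimately show ?thesis
    unfolding in_segment by (simp only:)
qed

lemma node_of_square: "first_node (even_end i, odd_end j) \<or> second_node (even_end i, odd_end j)"
  by (rule first_or_second) (simp_all add: even_end_def odd_end_def)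

text \<open>Decides on which side of the node coordinate \<open>a\<close> the unit interval lies,
  and thereby which of the four squares at a node contains a point of an added segment.\<close>

lemma half_open_interval_unique:
  fixes x :: real
  assumes "of_int i < x" "x < of_int i + 1" "x = of_int a + r * s" "s \<in> {-1, 1}" "0 \<le> r" "r \<le> 1"
  shows "0 < r \<and> (s = 1 \<and> i = a \<or> s = -1 \<and> i = a - 1)"
proof -
  have "r \<noteq> 0"
  proof
    assume "r = 0"
    then have "of_int i < (of_int a :: real)" "of_int a < (of_int (i + 1) :: real)"
      using assms by simp_all
    then show False
      unfolding of_int_less_iff by linarith
  qed
  then have r: "0 < r"
    using assms(5) by simp
  have "i = a" if "s = 1"
  proof -
    have "of_int i < (of_int (a + 1) :: real)" "of_int a < (of_int (i + 1) :: real)"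
      using assms r that by simp_all
    then show ?thesis
      unfolding of_int_less_iff by linarith
  qed
  moreover have "i = a - 1" if "s = -1"
  proof -
    have "of_int i < (of_int a :: real)" "of_int (a - 1) < (of_int (i + 1) :: real)"
      using assms r that by simp_all
    then show ?thesis
      unfolding of_int_less_iff by linarith
  qed
  ultimately show ?thesis
    using r assms(4) by blast
qed

lemma even_dist_from_node:
  assumes "even a" "s = 1 \<and> i = a \<or> s = -1 \<and> i = a - 1" "x = of_int a + r * s"
  shows "even_end i = a" "even_dist i x = r"
  using assms by (auto simp: even_end_def even_dist_def)

lemma odd_dist_from_node:
  assumes "odd b" "t = 1 \<and> j = b \<or> t = -1 \<and> j = b - 1" "y = of_int b + r * t"
  shows "odd_end j = b" "odd_dist j y = r"
  using assms by (auto simp: odd_end_def odd_dist_def)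

text \<open>Inside an open square only the segment cutting off its replaced corner is visible. The
  parameter \<open>u\<close> of the segment is the offset along the unit leg and
  \<open>(1 - u) / 2\<close> the offset along the half-unit leg, so the level is 1.\<close>

lemma replacement_iff_level:
  assumes "of_int i < fst p" "fst p < of_int i + 1" "of_int j < snd p" "snd p < of_int j + 1"
  shows "(\<exists>a b. first_node (a, b) \<and> p \<in> \<Union>(first_replacement (node a b)) \<or>
      second_node (a, b) \<and> p \<in> \<Union>(second_replacement (node a b))) \<longleftrightarrow> level (i, j) p = 1"
proof
  assume "\<exists>a b. first_node (a, b) \<and> p \<in> \<Union>(first_replacement (node a b)) \<or>
      second_node (a, b) \<and> p \<in> \<Union>(second_replacement (node a b))"
  then consider a b where "first_node (a, b)" "p \<in> \<Union>(first_replacement (node a b))"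
    | a b where "second_node (a, b)" "p \<in> \<Union>(second_replacement (node a b))"
    by blast
  then show "level (i, j) p = 1"
  proof cases
    case 1
    then obtain s t u where stu: "s \<in> {-1, 1}" "t \<in> {-1, 1}" "0 \<le> u" "u \<le> 1"
      "fst p = of_int a + (1 - u) * s / 2" "snd p = of_int b + u * t"
      unfolding mem_first_replacement_iff by blast
    then have x: "fst p = of_int a + (1 - u) / 2 * s"
      by simp
    have i: "s = 1 \<and> i = a \<or> s = -1 \<and> i = a - 1"
      using half_open_interval_unique[OF assms(1,2) x stu(1)] stu(3,4) by simp
    have j: "t = 1 \<and> j = b \<or> t = -1 \<and> j = b - 1"
      using half_open_interval_unique[OF assms(3,4) stu(6,2)] stu(3,4) by simp
    have ab: "even a" "odd b"
      using first_node_odd 1(1) by blast+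
    have "level (i, j) (fst p, snd p) = 2 * ((1 - u) / 2) + u"
      unfolding level_pair even_dist_from_node[OF ab(1) i x] odd_dist_from_node[OF ab(2) j stu(6)]
      using 1(1) by simp
    then show ?thesis
      by (simp add: field_simps)
  next
    case 2
    then obtain s t u where stu: "s \<in> {-1, 1}" "t \<in> {-1, 1}" "0 \<le> u" "u \<le> 1"
      "fst p = of_int a + u * t" "snd p = of_int b + (1 - u) * s / 2"
      unfolding mem_second_replacement_iff by blast
    then have y: "snd p = of_int b + (1 - u) / 2 * s"
      by simp
    have i: "t = 1 \<and> i = a \<or> t = -1 \<and> i = a - 1"
      using half_open_interval_unique[OF assms(1,2) stu(5,2)] stu(3,4) by simp
    have j: "s = 1 \<and> j = b \<or> s = -1 \<and> j = b - 1"
      using half_open_interval_unique[OF assms(3,4) y stu(1)] stu(3,4) by simp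
    have ab: "even a" "odd b"
      using second_node_odd 2(1) by blast+
    have "\<not> first_node (a, b)"
      using 2(1) not_first_second by blast
    then have "level (i, j) (fst p, snd p) = u + 2 * ((1 - u) / 2)"
      unfolding level_pair even_dist_from_node[OF ab(1) i stu(5)] odd_dist_from_node[OF ab(2) j y]
      by simp
    then show ?thesis
      by (simp add: field_simps)
  qed
next
  assume level: "level (i, j) p = 1"
  define a b where "a = even_end i" and "b = odd_end j"
  define r r' where "r = even_dist i (fst p)" and "r' = odd_dist j (snd p)"
  define s t :: real where "s = (if even i then 1 else -1)" and "t = (if odd j then 1 else -1)"
  have st: "s \<in> {-1, 1}" "t \<in> {-1, 1}"
    by (simp_all add: s_def t_def)
  have p: "fst p = of_int a + r * s" "snd p = of_int b + r' * t" "0 < r" "0 < r'"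
    using assms by (simp_all add: a_def b_def r_def r'_def s_def t_def even_end_def odd_end_def
        even_dist_def odd_dist_def)
  have "level (i, j) (fst p, snd p) = 1"
    using level by simp
  then have l: "(if first_node (a, b) then 2 * r + r' else r + 2 * r') = 1"
    unfolding level_pair a_def b_def r_def r'_def .
  consider "first_node (a, b)" | "second_node (a, b)" "\<not> first_node (a, b)"
    using node_of_square[of i j] unfolding a_def b_def by blast
  then have "first_node (a, b) \<and> p \<in> \<Union>(first_replacement (node a b)) \<or>
      second_node (a, b) \<and> p \<in> \<Union>(second_replacement (node a b))"
  proof cases
    case 1
    then have "2 * r + r' = 1"
      using l by simp
    then have "r' \<le> 1" "(1 - r') * s / 2 = r * s"
      using p(3) by (simp_all add: algebra_simps flip: \<open>2 * r + r' = 1\<close>)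
    then have "p \<in> \<Union>(first_replacement (node a b))"
      unfolding mem_first_replacement_iff using st p by (intro bexI[of _ s] bexI[of _ t] exI[of _ r']) auto
    then show ?thesis
      using 1 by blast
  next
    case 2
    then have "r + 2 * r' = 1"
      using l by simp
    then have "r \<le> 1" "(1 - r) * t / 2 = r' * t"
      using p(4) by (simp_all add: algebra_simps flip: \<open>r + 2 * r' = 1\<close>)
    then have "p \<in> \<Union>(second_replacement (node a b))"
      unfolding mem_second_replacement_iff using st p by (intro bexI[of _ t] bexI[of _ s] exI[of _ r]) auto
    then show ?thesis
      using 2 by blast
  qed
  then show "\<exists>a b. first_node (a, b) \<and> p \<in> \<Union>(first_replacement (node a b)) \<or>
      second_node (a, b) \<and> p \<in> \<Union>(second_replacement (node a b))"
    by blast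
qed

lemma mem_lattice_iff:
  "p \<in> \<Union>replaced_lattice \<longleftrightarrow> fst p \<in> \<int> \<or> snd p \<in> \<int> \<or> level (\<lfloor>fst p\<rfloor>, \<lfloor>snd p\<rfloor>) p = 1"
proof (cases "fst p \<in> \<int> \<or> snd p \<in> \<int>")
  case True
  then have "p \<in> \<Union>square_lattice"
    unfolding Union_square_lattice by (simp add: case_prod_beta)
  then show ?thesis
    unfolding Union_replaced_lattice using True by blast
next
  case False
  then have "p \<notin> \<Union>square_lattice"
    unfolding Union_square_lattice by (simp add: case_prod_beta)
  moreover have strict: "of_int \<lfloor>x\<rfloor> < x" "x < of_int \<lfloor>x\<rfloor> + 1" if "x \<notin> \<int>" for x :: real
  proof -
    have "x \<noteq> of_int \<lfloor>x\<rfloor>"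
      using that Ints_of_int[of "\<lfloor>x\<rfloor>"] by metis
    then show "of_int \<lfloor>x\<rfloor> < x" "x < of_int \<lfloor>x\<rfloor> + 1"
      using floor_correct[of x] by linarith+
  qed
  have "fst p \<notin> \<int>" "snd p \<notin> \<int>"
    using False by simp_all
  note replacement_iff_level[OF strict[OF this(1)] strict[OF this(2)]]
  ultimately show ?thesis
    unfolding Union_replaced_lattice using False by simp
qed

lemma cell_decomposition_replaced_lattice: "cell_decomposition replaced_lattice cell"
proof
  show "open (cell k)" "cell k \<noteq> {}" for k
    by (rule open_cell nonempty_cell)+
  show "connected (cell k)" for k
    by (rule convex_connected[OF convex_cell])
  show "cell k \<inter> cell k' = {}" if "k \<noteq> k'" for k k'
    using that by (rule disjoint_cells)
  have "p \<notin> \<Union>replaced_lattice \<longleftrightarrow> (\<exists>k. p \<in> cell k)" for p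
    unfolding mem_lattice_iff mem_cell_iff de_Morgan_disj linorder_neq_iff by fast
  then show "- \<Union>replaced_lattice = (\<Union>k. cell k)"
    by blast
qed

interpretation replaced: cell_decomposition replaced_lattice cell
  by (rule cell_decomposition_replaced_lattice)

subsection \<open>Adjacency of cells\<close>

text \<open>The Boolean tag allows adjacency to be stated for all pairings of triangles and
  quadrilaterals at once.\<close>

definition part :: "bool \<Rightarrow> square \<Rightarrow> square + square" where
  "part q s = (if q then Inl s else Inr s)"

lemma part_inject: "part q s = part q' s' \<longleftrightarrow> q = q' \<and> s = s'"
  by (simp add: part_def)

lemma mem_closed_part_iff:
  "(x, y) \<in> closed_cell (part q (i, j)) \<longleftrightarrow>
    0 \<le> even_dist i x \<and> even_dist i x \<le> 1 \<and> 0 \<le> odd_dist j y \<and> odd_dist j y \<le> 1 \<and>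
    (if q then 1 \<le> level (i, j) (x, y) else level (i, j) (x, y) \<le> 1)"
  by (auto simp: part_def even_dist_def odd_dist_def)

text \<open>The intersection is convex, so two distinct common points already carry a common
  segment.\<close>

lemma share_edge_convex_iff:
  assumes "convex A" "convex B"
  shows "share_edge A B \<longleftrightarrow> (\<exists>p q. p \<noteq> q \<and> p \<in> A \<inter> B \<and> q \<in> A \<inter> B)"
proof
  assume "share_edge A B"
  then obtain p q where "p \<noteq> q" "closed_segment p q \<subseteq> A \<inter> B"
    unfolding share_edge_def by blast
  then have "p \<noteq> q \<and> p \<in> A \<inter> B \<and> q \<in> A \<inter> B"
    using ends_in_segment by blast
  then show "\<exists>p q. p \<noteq> q \<and> p \<in> A \<inter> B \<and> q \<in> A \<inter> B"
    by blast
next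
  assume "\<exists>p q. p \<noteq> q \<and> p \<in> A \<inter> B \<and> q \<in> A \<inter> B"
  then obtain p q where "p \<noteq> q" "p \<in> A \<inter> B" "q \<in> A \<inter> B"
    by blast
  moreover from this have "closed_segment p q \<subseteq> A \<inter> B"
    using convex_Int[OF assms] by (intro closed_segment_subset)
  ultimately show "share_edge A B"
    unfolding share_edge_def by blast
qed

lemma share_edge_parts_iff:
  "share_edge (closed_cell k) (closed_cell k') \<longleftrightarrow> (\<exists>p q. p \<noteq> q \<and>
    p \<in> closed_cell k \<and> p \<in> closed_cell k' \<and> q \<in> closed_cell k \<and> q \<in> closed_cell k')"
  unfolding share_edge_convex_iff[OF convex_closed_cell convex_closed_cell] by blast

lemma share_edge_commute: "share_edge A B = share_edge B A"
  unfolding share_edge_def by (simp add: Int_commute)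

text \<open>For even \<open>i\<close> the side \<open>x = i + 1\<close> is opposite to the replaced
  corner: it belongs to the quadrilateral, and a triangle of the second kind touches it in one
  point. For odd \<open>i\<close> it contains the corner: the triangle takes the whole side at a
  node of the first kind and the near half at one of the second kind. For horizontal sides the kinds
  exchange roles.\<close>

lemma vertical_side:
  "(of_int i + 1, y) \<in> closed_cell (part q (i, j)) \<longleftrightarrow> 0 \<le> odd_dist j y \<and> odd_dist j y \<le> 1 \<and>
    (if even i then q \<or> (\<not> first_node (even_end i, odd_end j) \<and> odd_dist j y = 0)
     else if first_node (i + 1, odd_end j) then (if q then odd_dist j y = 1 else True)
     else (if q then 1 / 2 \<le> odd_dist j y else odd_dist j y \<le> 1 / 2))"
  "(of_int i + 1, y) \<in> closed_cell (part q (i + 1, j)) \<longleftrightarrow> 0 \<le> odd_dist j y \<and> odd_dist j y \<le> 1 \<and>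
    (if even i then q \<or> (\<not> first_node (even_end (i + 1), odd_end j) \<and> odd_dist j y = 0)
     else if first_node (i + 1, odd_end j) then (if q then odd_dist j y = 1 else True)
     else (if q then 1 / 2 \<le> odd_dist j y else odd_dist j y \<le> 1 / 2))"
  unfolding mem_closed_part_iff level_pair by (auto simp: even_dist_def even_end_def)

lemma horizontal_side:
  "(x, of_int j + 1) \<in> closed_cell (part q (i, j)) \<longleftrightarrow> 0 \<le> even_dist i x \<and> even_dist i x \<le> 1 \<and>
    (if odd j then q \<or> (first_node (even_end i, odd_end j) \<and> even_dist i x = 0)
     else if first_node (even_end i, j + 1) then (if q then 1 / 2 \<le> even_dist i x else even_dist i x \<le> 1 / 2)
     else (if q then even_dist i x = 1 else True))"
  "(x, of_int j + 1) \<in> closed_cell (part q (i, j + 1)) \<longleftrightarrow> 0 \<le> even_dist i x \<and> even_dist i x \<le> 1 \<and>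
    (if odd j then q \<or> (first_node (even_end i, odd_end (j + 1)) \<and> even_dist i x = 0)
     else if first_node (even_end i, j + 1) then (if q then 1 / 2 \<le> even_dist i x else even_dist i x \<le> 1 / 2)
     else (if q then even_dist i x = 1 else True))"
  unfolding mem_closed_part_iff level_pair by (auto simp: odd_dist_def odd_end_def)

lemma closed_part_bounds:
  "(x, y) \<in> closed_cell (part q (i, j)) \<Longrightarrow> of_int i \<le> x \<and> x \<le> of_int i + 1 \<and> of_int j \<le> y \<and> y \<le> of_int j + 1"
  by (auto simp: part_def split: if_splits)

lemma share_edge_vertical:
  "share_edge (closed_cell (part q (i, j))) (closed_cell (part q' (i + 1, j))) \<longleftrightarrow>
    (if even i then q \<and> q' else q = q' \<and> (q \<longrightarrow> \<not> first_node (i + 1, odd_end j)))" (is "?L \<longleftrightarrow> ?R")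
proof
  assume ?L
  then obtain x y x' y' where *: "(x, y) \<noteq> (x', y')"
    "(x, y) \<in> closed_cell (part q (i, j))" "(x, y) \<in> closed_cell (part q' (i + 1, j))"
    "(x', y') \<in> closed_cell (part q (i, j))" "(x', y') \<in> closed_cell (part q' (i + 1, j))"
    unfolding share_edge_parts_iff by fastforce
  have x: "x = of_int i + 1" "x' = of_int i + 1"
    using closed_part_bounds[OF *(2)] closed_part_bounds[OF *(3)]
      closed_part_bounds[OF *(4)] closed_part_bounds[OF *(5)] by simp_all
  have "odd_dist j y \<noteq> odd_dist j y'"
    using *(1) x by (auto simp: odd_dist_def)
  then show ?R
    using *(2-5) unfolding x vertical_side by (auto split: if_splits)
next
  assume R: ?R
  \<comment> \<open>The midpoint and one end of the side are common to both parts: the end away from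
    the node for quadrilaterals, the node's end for triangles.\<close>
  define y where "y t = (if odd j then of_int j + t else of_int j + 1 - t)" for t :: real
  have y: "odd_dist j (y t) = t" for t
    by (simp add: y_def odd_dist_def)
  have "(of_int i + 1, y (1 / 2)) \<in> closed_cell (part q (i, j))" "(of_int i + 1, y (1 / 2)) \<in> closed_cell (part q' (i + 1, j))"
    "(of_int i + 1, y (if q then 1 else 0)) \<in> closed_cell (part q (i, j))"
    "(of_int i + 1, y (if q then 1 else 0)) \<in> closed_cell (part q' (i + 1, j))"
    using R unfolding vertical_side y by (auto split: if_splits)
  moreover have "y (1 / 2) \<noteq> y (if q then 1 else 0)"
    by (simp add: y_def)
  ultimately show ?L
    unfolding share_edge_parts_iff by blast
qed

lemma share_edge_horizontal:
  "share_edge (closed_cell (part q (i, j))) (closed_cell (part q' (i, j + 1))) \<longleftrightarrow>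
    (if odd j then q \<and> q' else q = q' \<and> (q \<longrightarrow> first_node (even_end i, j + 1)))" (is "?L \<longleftrightarrow> ?R")
proof
  assume ?L
  then obtain x y x' y' where *: "(x, y) \<noteq> (x', y')"
    "(x, y) \<in> closed_cell (part q (i, j))" "(x, y) \<in> closed_cell (part q' (i, j + 1))"
    "(x', y') \<in> closed_cell (part q (i, j))" "(x', y') \<in> closed_cell (part q' (i, j + 1))"
    unfolding share_edge_parts_iff by fastforce
  have y: "y = of_int j + 1" "y' = of_int j + 1"
    using closed_part_bounds[OF *(2)] closed_part_bounds[OF *(3)]
      closed_part_bounds[OF *(4)] closed_part_bounds[OF *(5)] by simp_all
  have "even_dist i x \<noteq> even_dist i x'"
    using *(1) y by (auto simp: even_dist_def)
  then show ?R
    using *(2-5) unfolding y horizontal_side by (auto split: if_splits)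
next
  assume R: ?R
  define x where "x t = (if even i then of_int i + t else of_int i + 1 - t)" for t :: real
  have x: "even_dist i (x t) = t" for t
    by (simp add: x_def even_dist_def)
  have "(x (1 / 2), of_int j + 1) \<in> closed_cell (part q (i, j))" "(x (1 / 2), of_int j + 1) \<in> closed_cell (part q' (i, j + 1))"
    "(x (if q then 1 else 0), of_int j + 1) \<in> closed_cell (part q (i, j))"
    "(x (if q then 1 else 0), of_int j + 1) \<in> closed_cell (part q' (i, j + 1))"
    using R unfolding horizontal_side x by (auto split: if_splits)
  moreover have "x (1 / 2) \<noteq> x (if q then 1 else 0)"
    by (simp add: x_def)
  ultimately show ?L
    unfolding share_edge_parts_iff by blast
qed

lemma share_edge_same_square: "share_edge (closed_cell (part True s)) (closed_cell (part False s))"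
proof -
  obtain i j where s: "s = (i, j)"
    by fastforce
  define p where "p = at_dist (i, j)"
  have mem: "p u v \<in> closed_cell (part q (i, j)) \<longleftrightarrow> 0 \<le> u \<and> u \<le> 1 \<and> 0 \<le> v \<and> v \<le> 1 \<and>
      (if q then 1 \<le> level (i, j) (p u v) else level (i, j) (p u v) \<le> 1)" for q u v
    unfolding p_def at_dist_def case_prod_conv mem_closed_part_iff
    by (simp add: even_dist_def odd_dist_def)
  show ?thesis
  proof (cases "first_node (even_end i, odd_end j)")
    case True
    then have "p (1 / 2) 0 \<in> closed_cell (part q (i, j))" "p 0 1 \<in> closed_cell (part q (i, j))" for q
      unfolding mem unfolding p_def level_at_dist by simp_all
    moreover have "p (1 / 2) 0 \<noteq> p 0 1"
      by (simp add: p_def at_dist_def)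
    ultimately show ?thesis
      unfolding s share_edge_parts_iff by blast
  next
    case False
    then have "p 0 (1 / 2) \<in> closed_cell (part q (i, j))" "p 1 0 \<in> closed_cell (part q (i, j))" for q
      unfolding mem unfolding p_def level_at_dist by simp_all
    moreover have "p 0 (1 / 2) \<noteq> p 1 0"
      by (simp add: p_def at_dist_def)
    ultimately show ?thesis
      unfolding s share_edge_parts_iff by blast
  qed
qed

text \<open>Squares that differ in both coordinates meet in at most a corner, which cannot hold two
  distinct points.\<close>

lemma share_edge_squares:
  assumes "share_edge (closed_cell (part q (i, j))) (closed_cell (part q' (i', j')))"
  shows "i = i' \<and> (j = j' \<or> j' = j + 1 \<or> j = j' + 1) \<or> j = j' \<and> (i' = i + 1 \<or> i = i' + 1)"
proof -
  obtain x y x' y' where *: "(x, y) \<noteq> (x', y')"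
    "(x, y) \<in> closed_cell (part q (i, j))" "(x, y) \<in> closed_cell (part q' (i', j'))"
    "(x', y') \<in> closed_cell (part q (i, j))" "(x', y') \<in> closed_cell (part q' (i', j'))"
    using assms unfolding share_edge_parts_iff by fastforce
  note b = closed_part_bounds[OF *(2)] closed_part_bounds[OF *(3)]
      closed_part_bounds[OF *(4)] closed_part_bounds[OF *(5)]
  have close: "a = a' \<or> (a' = a + 1 \<or> a = a' + 1) \<and> t = t'"
    if "of_int a \<le> t" "t \<le> of_int a + 1" "of_int a' \<le> t" "t \<le> of_int a' + 1"
      "of_int a \<le> t'" "t' \<le> of_int a + 1" "of_int a' \<le> t'" "t' \<le> of_int a' + 1" for a a' :: int and t t' :: real
  proof -
    have "of_int a \<le> (of_int (a' + 1) :: real)" "of_int a' \<le> (of_int (a + 1) :: real)"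
      using that by simp_all
    then consider "a = a'" | "a' = a + 1" | "a = a' + 1"
      unfolding of_int_le_iff by linarith
    then show ?thesis
    proof cases
      case 2
      then have "t = of_int a + 1" "t' = of_int a + 1"
        using that by simp_all
      then show ?thesis
        using 2 by simp
    next
      case 3
      then have "t = of_int a' + 1" "t' = of_int a' + 1"
        using that by simp_all
      then show ?thesis
        using 3 by simp
    qed simp
  qed
  have "i = i' \<or> (i' = i + 1 \<or> i = i' + 1) \<and> x = x'"
    by (rule close) (use b in simp_all)
  moreover have "j = j' \<or> (j' = j + 1 \<or> j = j' + 1) \<and> y = y'"
    by (rule close) (use b in simp_all)
  moreover have "x \<noteq> x' \<or> y \<noteq> y'"
    using *(1) by simp
  ultimately show ?thesis
    by argo
qed

lemma part_simps [simp]: "part True = Inl" "part False = Inr"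
  by (auto simp: part_def)

lemma part_exhaust:
  obtains q i j where "k = part q (i, j)"
  by (cases k rule: cell_exhaust) (metis part_simps)+

lemma dual_edges_eq: "replaced.dual_edges =
    {{k, k'} | k k'. k \<noteq> k' \<and> share_edge (closed_cell k) (closed_cell k')}"
  unfolding replaced.dual_edges_def closure_cell ..

section \<open>The dual graph as a union of blocks at the odd vertices\<close>

text \<open>At a replaced node: the 4-cycle of triangles, the four legs joining each triangle to the
  quadrilateral of its square, and the two pairs of quadrilaterals that still share half a segment.
  At the other odd vertices no triangle occurs and the quadrilaterals form a full 4-cycle.\<close>

definition block_edges :: "vertex \<Rightarrow> (square + square) set set" where
  "block_edges n = (if even (fst n)
     then (`) Inr ` star_edges n \<union> (\<lambda>s. {Inl s, Inr s}) ` star n \<union>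
       (`) Inl ` (if first_node n then {left n, right n} else {up n, down n})
     else (`) Inl ` star_edges n)"

definition odd_vertices :: "vertex set" where
  "odd_vertices = {(a, b). odd (a + b)}"

lemma node_odd_vertex: "(even_end i, odd_end j) \<in> odd_vertices"
  by (simp add: odd_vertices_def even_end_def odd_end_def)

lemma node_star: "(i, j) \<in> star (even_end i, odd_end j)"
  by (simp add: star_iff even_end_def odd_end_def)

lemma vertical_pair:
  "b = j \<or> b = j + 1 \<Longrightarrow> {(i, j), (i + 1, j)} \<in> {up (i + 1, b), down (i + 1, b)}"
  by (auto simp: up_def down_def)

lemma horizontal_pair:
  "a = i \<or> a = i + 1 \<Longrightarrow> {(i, j), (i, j + 1)} \<in> {left (a, j + 1), right (a, j + 1)}"
  by (auto simp: left_def right_def)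

lemma even_end_parity [simp]: "even (even_end i)" "odd (odd_end j)"
  by (simp_all add: even_end_def odd_end_def)

lemma block_edges_intros:
  "odd a \<Longrightarrow> f \<in> star_edges (a, b) \<Longrightarrow> Inl ` f \<in> block_edges (a, b)"
  "even a \<Longrightarrow> f \<in> star_edges (a, b) \<Longrightarrow> Inr ` f \<in> block_edges (a, b)"
  "even a \<Longrightarrow> s \<in> star (a, b) \<Longrightarrow> {Inl s, Inr s} \<in> block_edges (a, b)"
  "even a \<Longrightarrow> first_node (a, b) \<Longrightarrow> f \<in> {left (a, b), right (a, b)} \<Longrightarrow> Inl ` f \<in> block_edges (a, b)"
  "even a \<Longrightarrow> \<not> first_node (a, b) \<Longrightarrow> f \<in> {up (a, b), down (a, b)} \<Longrightarrow> Inl ` f \<in> block_edges (a, b)"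
  unfolding block_edges_def by auto

lemma vertical_edge_in_block:
  assumes "if even i then q \<and> q' else q = q' \<and> (q \<longrightarrow> \<not> first_node (i + 1, odd_end j))"
  shows "{part q (i, j), part q' (i + 1, j)} \<in> \<Union>(block_edges ` odd_vertices)"
proof (cases "even i")
  case True
  \<comment> \<open>The endpoint of the shared side with even \<open>b\<close>: since
    \<open>i + 1\<close> is odd, its coordinate sum is odd and it is not a node.\<close>
  define b where "b = (if even j then j else j + 1)"
  have vertex: "(i + 1, b) \<in> odd_vertices"
    using True by (simp add: odd_vertices_def b_def)
  have "{(i, j), (i + 1, j)} \<in> {up (i + 1, b), down (i + 1, b)}"
    by (rule vertical_pair) (simp add: b_def)
  then have "{(i, j), (i + 1, j)} \<in> star_edges (i + 1, b)"
    unfolding star_edges_def by blast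
  then have "Inl ` {(i, j), (i + 1, j)} \<in> block_edges (i + 1, b)"
    using True by (intro block_edges_intros) simp_all
  moreover have "{part q (i, j), part q' (i + 1, j)} = Inl ` {(i, j), (i + 1, j)}"
    using True assms by simp
  ultimately show ?thesis
    using UN_I[OF vertex] by metis
next
  case False
  then have q: "q' = q" "q \<Longrightarrow> \<not> first_node (i + 1, odd_end j)"
    using assms by simp_all
  have vertex: "(i + 1, odd_end j) \<in> odd_vertices"
    using False by (simp add: odd_vertices_def odd_end_def)
  have "{(i, j), (i + 1, j)} \<in> {up (i + 1, odd_end j), down (i + 1, odd_end j)}"
    by (rule vertical_pair) (simp add: odd_end_def)
  note pair = this
  then have star: "{(i, j), (i + 1, j)} \<in> star_edges (i + 1, odd_end j)"
    unfolding star_edges_def by blast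
  have "part q ` {(i, j), (i + 1, j)} \<in> block_edges (i + 1, odd_end j)"
  proof (cases q)
    case True
    then show ?thesis
      using pair q False by (simp only: part_simps) (rule block_edges_intros(5); simp)
  next
    case False
    then show ?thesis
      using star \<open>\<not> (even i)\<close> by (simp only: part_simps) (rule block_edges_intros(2); simp)
  qed
  moreover have "{part q (i, j), part q' (i + 1, j)} = part q ` {(i, j), (i + 1, j)}"
    using q by simp
  ultimately show ?thesis
    using UN_I[OF vertex] by metis
qed

lemma horizontal_edge_in_block:
  assumes "if odd j then q \<and> q' else q = q' \<and> (q \<longrightarrow> first_node (even_end i, j + 1))"
  shows "{part q (i, j), part q' (i, j + 1)} \<in> \<Union>(block_edges ` odd_vertices)"
proof (cases "odd j")
  case True
  \<comment> \<open>The endpoint with odd \<open>a\<close>: since \<open>j + 1\<close> is even, its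
    coordinate sum is odd and it is not a node.\<close>
  define a where "a = (if odd i then i else i + 1)"
  have vertex: "(a, j + 1) \<in> odd_vertices"
    using True by (simp add: odd_vertices_def a_def)
  have "{(i, j), (i, j + 1)} \<in> {left (a, j + 1), right (a, j + 1)}"
    by (rule horizontal_pair) (simp add: a_def)
  then have "{(i, j), (i, j + 1)} \<in> star_edges (a, j + 1)"
    unfolding star_edges_def by blast
  then have "Inl ` {(i, j), (i, j + 1)} \<in> block_edges (a, j + 1)"
    by (intro block_edges_intros) (simp_all add: a_def)
  moreover have "{part q (i, j), part q' (i, j + 1)} = Inl ` {(i, j), (i, j + 1)}"
    using True assms by simp
  ultimately show ?thesis
    using UN_I[OF vertex] by metis
next
  case False
  then have q: "q' = q" "q \<Longrightarrow> first_node (even_end i, j + 1)"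
    using assms by simp_all
  have vertex: "(even_end i, j + 1) \<in> odd_vertices"
    using False by (simp add: odd_vertices_def even_end_def)
  have "{(i, j), (i, j + 1)} \<in> {left (even_end i, j + 1), right (even_end i, j + 1)}"
    by (rule horizontal_pair) (simp add: even_end_def)
  note pair = this
  then have star: "{(i, j), (i, j + 1)} \<in> star_edges (even_end i, j + 1)"
    unfolding star_edges_def by blast
  have "part q ` {(i, j), (i, j + 1)} \<in> block_edges (even_end i, j + 1)"
  proof (cases q)
    case True
    then show ?thesis
      using pair q by (simp only: part_simps) (rule block_edges_intros(4); simp)
  next
    case False
    then show ?thesis
      using star by (simp only: part_simps) (rule block_edges_intros(2); simp)
  qed
  moreover have "{part q (i, j), part q' (i, j + 1)} = part q ` {(i, j), (i, j + 1)}"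
    using q by simp
  ultimately show ?thesis
    using UN_I[OF vertex] by metis
qed

lemma share_edge_in_block:
  assumes "share_edge (closed_cell (part q (i, j))) (closed_cell (part q' (i', j')))"
    "part q (i, j) \<noteq> part q' (i', j')"
  shows "{part q (i, j), part q' (i', j')} \<in> \<Union>(block_edges ` odd_vertices)"
proof -
  consider "i = i'" "j = j'" | "i' = i + 1" "j' = j" | "i = i' + 1" "j' = j"
    | "i' = i" "j' = j + 1" | "i' = i" "j = j' + 1"
    using share_edge_squares[OF assms(1)] by argo
  then show ?thesis
  proof cases
    case 1
    then have "q' \<longleftrightarrow> \<not> q"
      using assms(2) 1 by (cases q; cases q') simp_all
    then have "{part q (i, j), part q' (i', j')} = {Inl (i, j), Inr (i, j)}"
      using 1 by (cases q) auto
    also have "\<dots> \<in> block_edges (even_end i, odd_end j)"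
      using node_star by (intro block_edges_intros) simp_all
    finally show ?thesis
      using node_odd_vertex by blast
  next
    case 2
    then show ?thesis
      using assms(1) vertical_edge_in_block share_edge_vertical by simp
  next
    case 3
    have "{part q' (i', j'), part q (i' + 1, j')} \<in> \<Union>(block_edges ` odd_vertices)"
      using assms(1) unfolding 3 share_edge_commute[of "closed_cell (part q (i' + 1, j))"]
      unfolding share_edge_vertical by (rule vertical_edge_in_block)
    then show ?thesis
      using 3 by (simp add: insert_commute)
  next
    case 4
    then show ?thesis
      using assms(1) horizontal_edge_in_block share_edge_horizontal by simp
  next
    case 5
    have "{part q' (i', j'), part q (i', j' + 1)} \<in> \<Union>(block_edges ` odd_vertices)"
      using assms(1) unfolding 5 share_edge_commute[of "closed_cell (part q (i, j' + 1))"]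
      unfolding share_edge_horizontal by (rule horizontal_edge_in_block)
    then show ?thesis
      using 5 by (simp add: insert_commute)
  qed
qed

lemma dual_edge_intro:
  "k \<noteq> k' \<Longrightarrow> share_edge (closed_cell k) (closed_cell k') \<Longrightarrow> {k, k'} \<in> replaced.dual_edges"
  unfolding dual_edges_eq by blast

lemma vertical_edge_in_dual:
  assumes "if even i then q else q \<longrightarrow> \<not> first_node (i + 1, odd_end j)"
  shows "part q ` {(i, j), (i + 1, j)} \<in> replaced.dual_edges"
proof -
  have "share_edge (closed_cell (part q (i, j))) (closed_cell (part q (i + 1, j)))"
    unfolding share_edge_vertical using assms by simp
  then show ?thesis
    using dual_edge_intro by (simp add: part_inject)
qed

lemma horizontal_edge_in_dual:
  assumes "if odd j then q else q \<longrightarrow> first_node (even_end i, j + 1)"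
  shows "part q ` {(i, j), (i, j + 1)} \<in> replaced.dual_edges"
proof -
  have "share_edge (closed_cell (part q (i, j))) (closed_cell (part q (i, j + 1)))"
    unfolding share_edge_horizontal using assms by simp
  then show ?thesis
    using dual_edge_intro by (simp add: part_inject)
qed

lemma star_edge_in_dual:
  assumes "odd (a + b)" "odd a \<Longrightarrow> q"
  shows "(q \<longrightarrow> odd a \<or> \<not> first_node (a, b)) \<Longrightarrow> e \<in> {up (a, b), down (a, b)} \<Longrightarrow> part q ` e \<in> replaced.dual_edges"
    and "(q \<longrightarrow> odd a \<or> first_node (a, b)) \<Longrightarrow> e \<in> {left (a, b), right (a, b)} \<Longrightarrow> part q ` e \<in> replaced.dual_edges"
proof -
  have eqs: "up (a, b) = {(a - 1, b), (a - 1 + 1, b)}" "down (a, b) = {(a - 1, b - 1), (a - 1 + 1, b - 1)}"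
    "left (a, b) = {(a - 1, b - 1), (a - 1, b - 1 + 1)}" "right (a, b) = {(a, b - 1), (a, b - 1 + 1)}"
    by (auto simp: up_def down_def left_def right_def)
  show "part q ` e \<in> replaced.dual_edges"
    if "q \<longrightarrow> odd a \<or> \<not> first_node (a, b)" "e \<in> {up (a, b), down (a, b)}"
  proof -
    have "part q ` {(a - 1, c), (a - 1 + 1, c)} \<in> replaced.dual_edges" if "c = b \<or> c = b - 1" for c
      by (rule vertical_edge_in_dual)
        (use \<open>q \<longrightarrow> odd a \<or> \<not> first_node (a, b)\<close> assms that in \<open>auto simp: odd_end_def\<close>)
    then show ?thesis
      using that(2) unfolding eqs by blast
  qed
  show "part q ` e \<in> replaced.dual_edges"
    if "q \<longrightarrow> odd a \<or> first_node (a, b)" "e \<in> {left (a, b), right (a, b)}"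
  proof -
    have "part q ` {(c, b - 1), (c, b - 1 + 1)} \<in> replaced.dual_edges" if "c = a \<or> c = a - 1" for c
      by (rule horizontal_edge_in_dual)
        (use \<open>q \<longrightarrow> odd a \<or> first_node (a, b)\<close> assms that in \<open>auto simp: even_end_def\<close>)
    then show ?thesis
      using that(2) unfolding eqs by blast
  qed
qed

lemma block_edges_even_cases:
  assumes "even a" "e \<in> block_edges (a, b)"
  obtains f where "f \<in> star_edges (a, b)" "e = Inr ` f" | s where "s \<in> star (a, b)" "e = {Inl s, Inr s}"
  | f where "f \<in> {left (a, b), right (a, b)}" "first_node (a, b)" "e = Inl ` f"
  | f where "f \<in> {up (a, b), down (a, b)}" "\<not> first_node (a, b)" "e = Inl ` f"
proof -
  consider "e \<in> (`) Inr ` star_edges (a, b)" | "e \<in> (\<lambda>s. {Inl s, Inr s}) ` star (a, b)"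
    | "e \<in> (`) Inl ` (if first_node (a, b) then {left (a, b), right (a, b)} else {up (a, b), down (a, b)})"
    using assms unfolding block_edges_def by auto
  then show thesis
  proof cases
    case 1
    then show thesis
      using that(1) by (elim imageE)
  next
    case 2
    then show thesis
      using that(2) by (elim imageE)
  next
    case 3
    then obtain f where f: "f \<in> (if first_node (a, b) then {left (a, b), right (a, b)} else {up (a, b), down (a, b)})"
      "e = Inl ` f"
      by (elim imageE)
    show thesis
    proof (cases "first_node (a, b)")
      case True
      then show thesis
        using that(3)[OF _ True f(2)] f(1) by simp
    next
      case False
      then show thesis
        using that(4)[OF _ False f(2)] f(1) by simp
    qed
  qed
qed

lemma block_edges_odd_cases:
  assumes "odd a" "e \<in> block_edges (a, b)"
  obtains f where "f \<in> star_edges (a, b)" "e = Inl ` f"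
  using assms unfolding block_edges_def fst_conv by (simp only: if_False) (elim imageE)

lemma block_edges_subset_dual:
  assumes "odd (a + b)" "e \<in> block_edges (a, b)"
  shows "e \<in> replaced.dual_edges"
proof -
  have leg: "{Inl s, Inr s} \<in> replaced.dual_edges" for s
    using dual_edge_intro[of "Inl s" "Inr s"] share_edge_same_square[of s] by simp
  note star = star_edge_in_dual[OF assms(1)]
  show ?thesis
  proof (cases "even a")
    case True
    from this assms(2) show ?thesis
    proof (cases rule: block_edges_even_cases)
      case (1 f)
      then show ?thesis
        using star[of False f] True by (auto simp: star_edges_def)
    next
      case 2
      then show ?thesis
        using leg by simp
    next
      case (3 f)
      then show ?thesis
        using star(2)[of True f] True by simp
    next
      case (4 f)
      then show ?thesis
        using star(1)[of True f] True by simp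
    qed
  next
    case False
    then obtain f where "f \<in> star_edges (a, b)" "e = Inl ` f"
      using assms(2) by (rule block_edges_odd_cases)
    then show ?thesis
      using star[of True f] False by (auto simp: star_edges_def)
  qed
qed

text \<open>An adjacency across a unit segment is filed under the endpoint with odd coordinate sum,
  an adjacency inside a square under the node of that square.\<close>

lemma dual_edges_eq_blocks: "replaced.dual_edges = \<Union>(block_edges ` odd_vertices)"
proof (intro equalityI subsetI)
  fix e assume "e \<in> replaced.dual_edges"
  then obtain k k' where k: "e = {k, k'}" "k \<noteq> k'" "share_edge (closed_cell k) (closed_cell k')"
    unfolding dual_edges_eq by blast
  obtain q i j where 1: "k = part q (i, j)"
    by (rule part_exhaust)
  obtain q' i' j' where 2: "k' = part q' (i', j')"
    by (rule part_exhaust)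
  show "e \<in> \<Union>(block_edges ` odd_vertices)"
    using k share_edge_in_block[of q i j q' i' j'] unfolding 1 2 by simp
next
  fix e assume "e \<in> \<Union>(block_edges ` odd_vertices)"
  then obtain a b where "odd (a + b)" "e \<in> block_edges (a, b)"
    by (auto simp: odd_vertices_def)
  then show "e \<in> replaced.dual_edges"
    by (rule block_edges_subset_dual)
qed

subsection \<open>The cells of the region\<close>

lemma mem_interior_diamond:
  assumes "\<bar>x - (real m - 1)\<bar> + \<bar>y - 1\<bar> < real m"
  shows "(x, y) \<in> interior (diamond m)"
proof -
  let ?D = "{p :: plane. \<bar>fst p - (real m - 1)\<bar> + \<bar>snd p - 1\<bar> < real m}"
  have "open ?D"
    by (intro open_Collect_less continuous_intros)
  moreover have "?D \<subseteq> diamond m"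
    by (auto simp: diamond_def)
  ultimately have "?D \<subseteq> interior (diamond m)"
    by (rule interior_maximal[rotated])
  then show ?thesis
    using assms by auto
qed

text \<open>On a unit interval with integer ends the distance to an integer \<open>p\<close> is
  affine with slope \<open>e\<close> of absolute value 1, measured from the replaced end;
  \<open>2 * i + 1 - even_end i\<close> is the other end.\<close>

lemma even_dist_interpolate:
  assumes "0 < even_dist i x" "even_dist i x < 1"
  obtains e :: int where "e = 1 \<or> e = -1" "\<bar>2 * i + 1 - even_end i - p\<bar> = \<bar>even_end i - p\<bar> + e"
    "\<bar>x - of_int p\<bar> = of_int \<bar>even_end i - p\<bar> + of_int e * even_dist i x"
proof (cases "even i")
  case True
  show thesis
  proof (cases "p \<le> i")
    case True
    then have "of_int p \<le> (of_int i :: real)"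
      by simp
    then show thesis
      using that[of 1] \<open>even i\<close> True assms by (simp add: even_end_def even_dist_def)
  next
    case False
    then have "of_int (i + 1) \<le> (of_int p :: real)"
      unfolding of_int_le_iff by simp
    then show thesis
      using that[of "-1"] \<open>even i\<close> False assms by (simp add: even_end_def even_dist_def)
  qed
next
  case False
  show thesis
  proof (cases "p \<le> i")
    case True
    then have "of_int p \<le> (of_int i :: real)"
      by simp
    then show thesis
      using that[of "-1"] \<open>odd i\<close> True assms by (simp add: even_end_def even_dist_def)
  next
    case False
    then have "of_int (i + 1) \<le> (of_int p :: real)"
      unfolding of_int_le_iff by simp
    then show thesis
      using that[of 1] \<open>odd i\<close> False assms by (simp add: even_end_def even_dist_def)
  qed
qed

lemma odd_dist_interpolate:
  assumes "0 < odd_dist j y" "odd_dist j y < 1"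
  obtains e :: int where "e = 1 \<or> e = -1" "\<bar>2 * j + 1 - odd_end j - p\<bar> = \<bar>odd_end j - p\<bar> + e"
    "\<bar>y - of_int p\<bar> = of_int \<bar>odd_end j - p\<bar> + of_int e * odd_dist j y"
proof -
  have eqs: "odd_dist j y = even_dist (j + 1) (y + 1)" "odd_end j = even_end (j + 1) - 1"
    by (simp_all add: odd_dist_def even_dist_def odd_end_def even_end_def)
  obtain e :: int where "e = 1 \<or> e = -1"
    "\<bar>2 * (j + 1) + 1 - even_end (j + 1) - (p + 1)\<bar> = \<bar>even_end (j + 1) - (p + 1)\<bar> + e"
    "\<bar>y + 1 - of_int (p + 1)\<bar> = of_int \<bar>even_end (j + 1) - (p + 1)\<bar> + of_int e * even_dist (j + 1) (y + 1)"
    using even_dist_interpolate[of "j + 1" "y + 1" "p + 1"] assms unfolding eqs by metis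
  then show thesis
    using that[of e] unfolding eqs by (simp add: algebra_simps)
qed

text \<open>The two corners of a square with odd coordinate sum are the replaced one and the one
  opposite to it.\<close>

lemma mem_aztec_corners:
  "(i, j) \<in> aztec False p r \<longleftrightarrow> \<bar>even_end i - p\<bar> + \<bar>odd_end j - 1\<bar> \<le> r \<or>
    \<bar>2 * i + 1 - even_end i - p\<bar> + \<bar>2 * j + 1 - odd_end j - 1\<bar> \<le> r"
  unfolding mem_aztec_iff by (cases "even i"; cases "even j") (auto simp: even_end_def odd_end_def)

lemma mem_aztec_even_node:
  "(i, j) \<in> \<Union>(star ` aztec_even False p r) \<longleftrightarrow> \<bar>even_end i - p\<bar> + \<bar>odd_end j - 1\<bar> \<le> r"
  unfolding mem_aztec_parts_iff by (cases "even i"; cases "even j") (auto simp: even_end_def odd_end_def)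

text \<open>A point with \<open>s + t < 1\<close> has taxicab distance less than 1 to the replaced
  corner, and one with \<open>s + t > 1\<close> to the opposite corner; the triangle inequality does
  the rest.\<close>

lemma at_dist_interior_diamond:
  assumes "0 < s" "s < 1" "0 < t" "t < 1"
    and "\<bar>even_end i - (int m - 1)\<bar> + \<bar>odd_end j - 1\<bar> \<le> int m - 1 \<and> s + t < 1 \<or>
      \<bar>2 * i + 1 - even_end i - (int m - 1)\<bar> + \<bar>2 * j + 1 - odd_end j - 1\<bar> \<le> int m - 1 \<and> s + t > 1"
  shows "at_dist (i, j) s t \<in> interior (diamond m)"
proof -
  define x y where "x = fst (at_dist (i, j) s t)" and "y = snd (at_dist (i, j) s t)"
  have st: "even_dist i x = s" "odd_dist j y = t"
    by (simp_all add: x_def y_def at_dist_def even_dist_def odd_dist_def)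
  obtain e where e: "e = 1 \<or> e = -1" "\<bar>2 * i + 1 - even_end i - (int m - 1)\<bar> = \<bar>even_end i - (int m - 1)\<bar> + e"
    "\<bar>x - of_int (int m - 1)\<bar> = of_int \<bar>even_end i - (int m - 1)\<bar> + of_int e * s"
    using even_dist_interpolate[of i x "int m - 1"] assms(1,2) unfolding st by metis
  obtain f where f: "f = 1 \<or> f = -1" "\<bar>2 * j + 1 - odd_end j - 1\<bar> = \<bar>odd_end j - 1\<bar> + f"
    "\<bar>y - of_int 1\<bar> = of_int \<bar>odd_end j - 1\<bar> + of_int f * t"
    using odd_dist_interpolate[of j y 1] assms(3,4) unfolding st by metis
  define A B where "A = \<bar>even_end i - (int m - 1)\<bar>" and "B = \<bar>odd_end j - 1\<bar>"
  have "of_int (A + B) + of_int e * s + of_int f * t < real m"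
  proof -
    have "A + B \<le> int m - 1 \<and> s + t < 1 \<or> A + e + (B + f) \<le> int m - 1 \<and> s + t > 1"
      using assms(5) unfolding e(2) f(2) A_def B_def .
    then have "of_int (A + B) \<le> real m - 1 \<and> s + t < 1 \<or> of_int (A + B + e + f) \<le> real m - 1 \<and> s + t > 1"
    proof
      assume "A + B \<le> int m - 1 \<and> s + t < 1"
      then have "of_int (A + B) \<le> (of_int (int m - 1) :: real) \<and> s + t < 1"
        unfolding of_int_le_iff .
      then show ?thesis by simp
    next
      assume "A + e + (B + f) \<le> int m - 1 \<and> s + t > 1"
      then have "of_int (A + B + e + f) \<le> (of_int (int m - 1) :: real) \<and> s + t > 1"
        unfolding of_int_le_iff by (simp add: algebra_simps)
      then show ?thesis by simp
    qed
    then show ?thesis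
      using e(1) f(1) assms(1-4) by auto
  qed
  then have "(x, y) \<in> interior (diamond m)"
    using e(3) f(3) unfolding A_def[symmetric] B_def[symmetric] by (intro mem_interior_diamond) simp
  then show ?thesis
    by (simp add: x_def y_def)
qed

text \<open>By parity a corner with odd coordinate sum is never at distance exactly \<open>m\<close>
  from the centre, so beyond \<open>m - 1\<close> means at least \<open>m + 1\<close>. If this holds
  for both such corners, the open square misses the diamond. A triangle stays within distance less
  than 1 of its node, so for it the node alone decides.\<close>

lemma cell_meets_diamond_imp:
  assumes p: "p \<in> cell (part q (i, j))" "p \<in> diamond m"
  shows "if q then (i, j) \<in> aztec False (int m - 1) (int m - 1)
    else (i, j) \<in> \<Union>(star ` aztec_even False (int m - 1) (int m - 1))"
proof -
  define x y where "x = fst p" and "y = snd p"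
  have xy: "0 < even_dist i x" "even_dist i x < 1" "0 < odd_dist j y" "odd_dist j y < 1"
    using p(1) by (auto simp: part_def x_def y_def even_dist_def odd_dist_def split: if_splits)
  have le: "\<bar>x - of_int (int m - 1)\<bar> + \<bar>y - of_int 1\<bar> \<le> real m"
    using p(2) by (auto simp: diamond_def x_def y_def)
  obtain e where e: "e = 1 \<or> e = -1" "\<bar>2 * i + 1 - even_end i - (int m - 1)\<bar> = \<bar>even_end i - (int m - 1)\<bar> + e"
    "\<bar>x - of_int (int m - 1)\<bar> = of_int \<bar>even_end i - (int m - 1)\<bar> + of_int e * even_dist i x"
    using even_dist_interpolate[OF xy(1,2), of "int m - 1"] by metis
  obtain f where f: "f = 1 \<or> f = -1" "\<bar>2 * j + 1 - odd_end j - 1\<bar> = \<bar>odd_end j - 1\<bar> + f"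
    "\<bar>y - of_int 1\<bar> = of_int \<bar>odd_end j - 1\<bar> + of_int f * odd_dist j y"
    using odd_dist_interpolate[OF xy(3,4), of 1] by metis
  define A B where "A = \<bar>even_end i - (int m - 1)\<bar>" and "B = \<bar>odd_end j - 1\<bar>"
  have "even (A + B) \<longleftrightarrow> even (int m - 1)"
    unfolding A_def B_def by (simp add: even_end_def odd_end_def)
  then have "even (A + B) \<noteq> even (int m)"
    by simp
  moreover have "even (A + B + e + f) = even (A + B)"
    using e(1) f(1) by auto
  ultimately have parity: "A + B \<noteq> int m" "A + B + e + f \<noteq> int m"
    by metis+
  have ineq: "of_int A + of_int B + of_int e * even_dist i x + of_int f * odd_dist j y \<le> real m"
    using le unfolding e(3) f(3) A_def[symmetric] B_def[symmetric] by simp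
  show ?thesis
  proof (cases q)
    case True
    have "A + B \<le> int m - 1 \<or> A + B + e + f \<le> int m - 1"
    proof (rule ccontr)
      assume "\<not> ?thesis"
      then have "int m + 1 \<le> A + B" "int m + 1 \<le> A + B + e + f"
        using parity by linarith+
      then have "of_int (int m + 1) \<le> (of_int (A + B) :: real)" "of_int (int m + 1) \<le> (of_int (A + B + e + f) :: real)"
        by (simp_all only: of_int_le_iff)
      then show False
        using ineq xy e(1) f(1) by auto
    qed
    then show ?thesis
      unfolding mem_aztec_corners e(2) f(2) A_def B_def using True by (auto simp: algebra_simps)
  next
    case False
    have "level (i, j) (x, y) < 1"
      using p(1) False by (simp add: x_def y_def)
    then have "even_dist i x + odd_dist j y < 1"
      using xy unfolding level_pair by (auto split: if_splits)
    then have "of_int (A + B) < (of_int (int m + 1) :: real)"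
      using ineq xy e(1) f(1) by auto
    then have "A + B \<le> int m - 1"
      unfolding of_int_less_iff using parity by linarith
    then show ?thesis
      unfolding mem_aztec_even_node A_def B_def using False by simp
  qed
qed

text \<open>On the boundary a square whose node lies outside the smaller radius contributes its
  quadrilateral but not its triangle. Every triangle of the region thus comes with its full
  4-cycle.\<close>

definition region_cells :: "nat \<Rightarrow> (square + square) set" where
  "region_cells m = Inl ` aztec False (int m - 1) (int m - 1) \<union>
     Inr ` \<Union>(star ` aztec_even False (int m - 1) (int m - 1))"

lemma cell_meets_diamond_iff:
  "cell k \<inter> interior (diamond m) \<noteq> {} \<longleftrightarrow> k \<in> region_cells m"
proof
  obtain q i j where k: "k = part q (i, j)"
    by (rule part_exhaust)
  assume "cell k \<inter> interior (diamond m) \<noteq> {}"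
  then obtain p where "p \<in> cell (part q (i, j))" "p \<in> diamond m"
    using interior_subset k by blast
  then show "k \<in> region_cells m"
    using cell_meets_diamond_imp[of p q i j m] unfolding k region_cells_def by (cases q) auto
next
  assume "k \<in> region_cells m"
  then consider i j where "k = Inl (i, j)" "(i, j) \<in> aztec False (int m - 1) (int m - 1)"
    | i j where "k = Inr (i, j)" "(i, j) \<in> \<Union>(star ` aztec_even False (int m - 1) (int m - 1))"
    unfolding region_cells_def by (metis UnE imageE surj_pair)
  then show "cell k \<inter> interior (diamond m) \<noteq> {}"
  proof cases
    case 1
    \<comment> \<open>The value \<open>9 / 20\<close> lies between \<open>1 / 3\<close> and
      \<open>1 / 2\<close>: level above 1, yet \<open>s + t < 1\<close>, on the side of the node.
      The value \<open>3 / 4\<close> has \<open>s + t > 1\<close>, on the side of the opposite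
      corner.\<close>
    let ?s = "if \<bar>even_end i - (int m - 1)\<bar> + \<bar>odd_end j - 1\<bar> \<le> int m - 1 then 9 / 20 else 3 / 4 :: real"
    have "at_dist (i, j) ?s ?s \<in> cell k"
      unfolding 1(1) by (subst at_dist_in_cell) (simp_all add: level_at_dist)
    moreover have "at_dist (i, j) ?s ?s \<in> interior (diamond m)"
      using 1(2) unfolding mem_aztec_corners by (intro at_dist_interior_diamond) auto
    ultimately show ?thesis
      by blast
  next
    case 2
    have "at_dist (i, j) (1 / 4) (1 / 4) \<in> cell k"
      unfolding 2(1) by (subst at_dist_in_cell) (simp_all add: level_at_dist)
    moreover have "at_dist (i, j) (1 / 4) (1 / 4) \<in> interior (diamond m)"
      using 2(2) unfolding mem_aztec_even_node by (intro at_dist_interior_diamond) auto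
    ultimately show ?thesis
      by blast
  qed
qed

lemma num_tilings_region:
  "num_tilings replaced_lattice (region_S1 m) = card (matchings replaced.dual_edges (region_cells m))"
proof -
  have "region_S1 m = replaced.cells_union (region_cells m)"
    unfolding region_S1_def replaced.union_of_regions_meeting[OF open_interior] cell_meets_diamond_iff
    by simp
  then show ?thesis
    by (simp add: replaced.num_tilings_eq)
qed

subsection \<open>Eliminating the triangles\<close>

text \<open>Urban renewal: the four triangles \<open>Inr p, \<dots>, Inr s\<close> are traded for a factor 2 and for the weights \<open>1/2\<close> and \<open>3/2 = 1 + 1/2\<close>.\<close>

lemma block_matching_sum:
  assumes "distinct [p, q, r, s]" "S \<subseteq> {p, q, r, s}"
    and w: "w {p, q} = 1 / 2" "w {r, s} = 1 / 2" "w {q, r} = 3 / 2" "w {p, s} = 3 / 2"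
  shows "matching_sum
      ({{Inr p, Inr q}, {Inr q, Inr r}, {Inr r, Inr s}, {Inr p, Inr s}} \<union>
       {{Inl p, Inr p}, {Inl q, Inr q}, {Inl r, Inr r}, {Inl s, Inr s}} \<union>
       {{Inl q, Inl r}, {Inl p, Inl s}}) (\<lambda>_. 1) (Inl ` S \<union> {Inr p, Inr q, Inr r, Inr s}) =
    2 * matching_sum {{p, q}, {q, r}, {r, s}, {p, s}} w S"
proof -
  have d: "p \<noteq> q" "p \<noteq> r" "p \<noteq> s" "q \<noteq> p" "q \<noteq> r" "q \<noteq> s" "r \<noteq> p" "r \<noteq> q" "r \<noteq> s" "s \<noteq> p" "s \<noteq> q" "s \<noteq> r"
    using assms(1) by auto
  show ?thesis
    using assms(2)
    by (cases rule: subset4_cases)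
      (simp_all add: matching_sum_insert matching_sum_no_edges d doubleton_eq_iff insert_Diff_if w)
qed

text \<open>The triangles have neighbours only inside the block and must all be covered there;
  \<open>S\<close> is the set of quadrilaterals not covered from other blocks.\<close>

lemma block_edges_even_sum:
  assumes "first_node n \<or> second_node n" "S \<subseteq> star n"
  shows "matching_sum (block_edges n) (\<lambda>_. 1) (Inl ` S \<union> Inr ` star n) =
    2 * matching_sum (star_edges n) (wt (3 / 2) (1 / 2) 1) S"
proof -
  obtain a b where n: "n = (a, b)"
    by fastforce
  define p q r s where "p = (a - 1, b)" and "q = (a, b)" and "r = (a, b - 1)" and "s = (a - 1, b - 1)"
  have pqrs: "distinct [p, q, r, s]" "star n = {p, q, r, s}"
    by (auto simp: p_def q_def r_def s_def n star_def)
  have edges: "up n = {p, q}" "right n = {q, r}" "down n = {r, s}" "left n = {p, s}"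
    by (simp_all add: p_def q_def r_def s_def n up_def right_def down_def left_def)
  have star_edges: "star_edges n = {{p, q}, {q, r}, {r, s}, {p, s}}"
    unfolding star_edges_def edges ..
  have even: "even (fst n)" and odd: "odd (a + b)"
    using assms(1) first_node_odd[of a b] second_node_odd[of a b] n by auto
  have block: "block_edges n = {{Inr p, Inr q}, {Inr q, Inr r}, {Inr r, Inr s}, {Inr p, Inr s}} \<union>
      {{Inl p, Inr p}, {Inl q, Inr q}, {Inl r, Inr r}, {Inl s, Inr s}} \<union>
      (`) Inl ` (if first_node n then {left n, right n} else {up n, down n})"
    unfolding block_edges_def star_edges pqrs(2) using even by (simp del: Un_insert_left)
  show ?thesis
  proof (cases "first_node n")
    case True
    have "matching_sum (block_edges n) (\<lambda>_. 1) (Inl ` S \<union> {Inr p, Inr q, Inr r, Inr s}) =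
        2 * matching_sum {{p, q}, {q, r}, {r, s}, {p, s}} (wt (3 / 2) (1 / 2) 1) S"
      using block_matching_sum[of p q r s S "wt (3 / 2) (1 / 2) 1"] pqrs assms(2) True
        wt_star[OF odd, of "3 / 2" "1 / 2" 1] unfolding n[symmetric] edges block
      by (simp add: insert_commute del: Un_insert_left)
    then show ?thesis
      unfolding pqrs(2) star_edges by simp
  next
    case False
    \<comment> \<open>At a node of the second kind the quadrilaterals meet across \<open>up\<close>
      and \<open>down\<close>, so the cyclic order is turned by one place.\<close>
    have "matching_sum (block_edges n) (\<lambda>_. 1) (Inl ` S \<union> {Inr q, Inr r, Inr s, Inr p}) =
        2 * matching_sum {{q, r}, {r, s}, {s, p}, {q, p}} (wt (3 / 2) (1 / 2) 1) S"
    proof -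
      have sets: "block_edges n = {{Inr q, Inr r}, {Inr r, Inr s}, {Inr s, Inr p}, {Inr q, Inr p}} \<union>
       {{Inl q, Inr q}, {Inl r, Inr r}, {Inl s, Inr s}, {Inl p, Inr p}} \<union>
       {{Inl r, Inl s}, {Inl q, Inl p}}"
        unfolding block edges using False by (auto simp: insert_commute)
      show ?thesis
        unfolding sets
      proof (rule block_matching_sum)
        show "distinct [q, r, s, p]" "S \<subseteq> {q, r, s, p}"
          using pqrs assms(2) by auto
        show "wt (3 / 2) (1 / 2) 1 {q, r} = 1 / 2" "wt (3 / 2) (1 / 2) 1 {s, p} = 1 / 2"
          "wt (3 / 2) (1 / 2) 1 {r, s} = 3 / 2" "wt (3 / 2) (1 / 2) 1 {q, p} = 3 / 2"
          using wt_star[OF odd, of "3 / 2" "1 / 2" 1] False assms(1) unfolding n[symmetric] edges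
          by (simp_all add: insert_commute)
      qed
    qed
    moreover have "{Inr q, Inr r, Inr s, Inr p} = (Inr ` star n :: (square + square) set)"
      unfolding pqrs(2) by auto
    moreover have "star_edges n = {{q, r}, {r, s}, {s, p}, {q, p}}"
      unfolding star_edges by (auto simp: insert_commute)
    ultimately show ?thesis
      by (simp only:)
  qed
qed

lemma block_edges_odd_sum:
  assumes "odd a" "even b"
  shows "matching_sum (block_edges (a, b)) (\<lambda>_. 1) (Inl ` S) =
    matching_sum (star_edges (a, b)) (wt h v 1) S"
proof -
  have odd: "odd (a + b)" "\<not> first_node (a, b)" "\<not> second_node (a, b)"
    using assms first_node_odd second_node_odd by auto
  have "matching_sum (block_edges (a, b)) (\<lambda>_. 1) (Inl ` S) = matching_sum (star_edges (a, b)) (\<lambda>_. 1) S"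
    using assms matching_sum_image[of Inl "star_edges (a, b)" "\<lambda>_. 1" S] by (simp add: block_edges_def)
  also have "\<dots> = matching_sum (star_edges (a, b)) (wt h v 1) S"
    using odd by (intro matching_sum_cong) (auto simp: star_edges_def wt_star)
  finally show ?thesis .
qed

definition block_cells :: "vertex \<Rightarrow> (square + square) set" where
  "block_cells n = Inl ` star n \<union> (if even (fst n) then Inr ` star n else {})"

lemma finite_block_cells: "finite (block_cells n)"
  by (simp add: block_cells_def)

lemma block_edges_subset: "block_edges n \<subseteq> Pow (block_cells n) - {{}}"
proof
  fix e assume e: "e \<in> block_edges n"
  have star: "f \<subseteq> star n \<and> f \<noteq> {}" if "f \<in> star_edges n" for f
    using that star_edges_subset by blast
  obtain a b where n: "n = (a, b)"
    by fastforce
  show "e \<in> Pow (block_cells n) - {{}}"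
  proof (cases "even a")
    case True
    from this e[unfolded n] show ?thesis
    proof (cases rule: block_edges_even_cases)
      case (1 f)
      then show ?thesis
        using star[of f] True unfolding n block_cells_def by auto
    next
      case (2 s)
      then show ?thesis
        using True unfolding n block_cells_def by auto
    next
      case (3 f)
      then show ?thesis
        using star[of f] True unfolding n block_cells_def star_edges_def by auto
    next
      case (4 f)
      then show ?thesis
        using star[of f] True unfolding n block_cells_def star_edges_def by auto
    qed
  next
    case False
    then obtain f where "f \<in> star_edges (a, b)" "e = Inl ` f"
      using e[unfolded n] by (rule block_edges_odd_cases)
    then show ?thesis
      using star[of f] False unfolding n block_cells_def by auto
  qed
qed

text \<open>An edge between quadrilaterals determines its odd vertex by \<open>edge_in_aztec\<close>
  and \<open>star_edges_unique\<close>; an edge with a triangle determines it as the node of that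
  triangle.\<close>

lemma block_edge_in_region:
  assumes "odd (a + b)" "e \<in> block_edges (a, b)" "e \<subseteq> region_cells m"
  shows "(a, b) \<in> aztec_vertices False (int m - 1) (int m - 1)"
proof -
  let ?r = "int m - 1"
  have Inl: "f \<subseteq> aztec False ?r ?r" if "Inl ` f \<subseteq> region_cells m" for f
    using that unfolding region_cells_def by auto
  have Inl_edge: ?thesis if f: "f \<in> star_edges (a, b)" "Inl ` f \<subseteq> region_cells m" for f
  proof -
    have "f \<in> grid_edges"
      using f(1) star_edges_subset_grid by (rule subsetD[rotated])
    then obtain n where n: "n \<in> aztec_vertices False ?r ?r" "f \<in> star_edges n"
      using edge_in_aztec Inl[OF f(2)] unfolding UN_iff by metis
    obtain c d where "n = (c, d)"
      by fastforce
    then show ?thesis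
      using n f(1) star_edges_unique[of f a b c d] assms(1) by (simp add: aztec_vertices_def)
  qed
  have Inr_node: ?thesis if ij: "even a" "(i, j) \<in> star (a, b)" "Inr (i, j) \<in> region_cells m" for i j
  proof -
    have "(i, j) \<in> \<Union>(star ` aztec_even False ?r ?r)"
      using ij(3) unfolding region_cells_def by auto
    then have "\<bar>even_end i - ?r\<bar> + \<bar>odd_end j - 1\<bar> \<le> ?r"
      unfolding mem_aztec_even_node .
    moreover have "even_end i = a" "odd_end j = b"
      using ij(1,2) assms(1) unfolding star_iff even_end_def odd_end_def by auto
    ultimately show ?thesis
      using assms(1) by (simp add: aztec_vertices_def)
  qed
  show ?thesis
  proof (cases "even a")
    case True
    from this assms(2) show ?thesis
    proof (cases rule: block_edges_even_cases)
      case (1 f)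
      obtain i j where ij: "(i, j) \<in> f"
        using 1(1) star_edges_subset[of "(a, b)"] by fastforce
      moreover have "(i, j) \<in> star (a, b)"
        using ij 1(1) star_edges_subset[of "(a, b)"] by blast
      ultimately show ?thesis
        using 1 assms(3) Inr_node[OF True, of i j] by blast
    next
      case (2 s)
      then show ?thesis
        using assms(3) Inr_node[OF True, of "fst s" "snd s"] by simp
    next
      case (3 f)
      then show ?thesis
        using assms(3) Inl_edge[of f] by (auto simp: star_edges_def)
    next
      case (4 f)
      then show ?thesis
        using assms(3) Inl_edge[of f] by (auto simp: star_edges_def)
    qed
  next
    case False
    then obtain f where "f \<in> star_edges (a, b)" "e = Inl ` f"
      using assms(2) by (rule block_edges_odd_cases)
    then show ?thesis
      using assms(3) Inl_edge[of f] by simp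
  qed
qed

text \<open>Triangles belong to a single block, so the two families share only the quadrilaterals
  over \<open>VA \<inter> VB\<close>. The expansion for the cells therefore has the same index set
  as the one for the weighted Aztec diamond, and the two are compared block by block.\<close>

lemma matchings_region:
  "real (card (matchings replaced.dual_edges (region_cells m))) = tiling_number m"
proof -
  define r where "r = int m - 1"
  define A B where "A = aztec_even False r r" and "B = aztec_odd False r r"
  define VA VB where "VA = \<Union>(star ` A)" and "VB = \<Union>(star ` B)"
  have AB: "finite A" "finite B" "aztec_vertices False r r = A \<union> B"
    unfolding A_def B_def by (simp_all add: aztec_vertices_split)
  have A: "even a \<and> odd b" if "(a, b) \<in> A" for a b
    using that by (auto simp: A_def aztec_even_def aztec_vertices_def)
  have B: "odd a \<and> even b" if "(a, b) \<in> B" for a b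
    using that by (auto simp: B_def aztec_odd_def aztec_vertices_def)
  have A': "even (fst n)" if "n \<in> A" for n
    using A[of "fst n" "snd n"] that by simp
  have B': "odd (fst n)" if "n \<in> B" for n
    using B[of "fst n" "snd n"] that by simp
  have cells: "\<Union>(block_cells ` A) = Inl ` VA \<union> Inr ` VA" "\<Union>(block_cells ` B) = Inl ` VB"
    using A' B' unfolding block_cells_def VA_def VB_def by (auto simp: image_UN)
  have region: "region_cells m = \<Union>(block_cells ` A) \<union> \<Union>(block_cells ` B)"
    unfolding cells region_cells_def r_def[symmetric] aztec_split[of False r r]
      A_def[symmetric] B_def[symmetric] VA_def[symmetric] VB_def[symmetric] by (simp only: image_Un Un_ac)
  have inter: "\<Union>(block_cells ` A) \<inter> \<Union>(block_cells ` B) = Inl ` (VA \<inter> VB)"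
    unfolding cells by auto
  have star_dis: "disjoint_family_on star A" "disjoint_family_on star B"
    unfolding A_def B_def by (rule disjoint_stars)+
  have "block_cells n \<inter> block_cells n' = {}" if "star n \<inter> star n' = {}" for n n'
    using that unfolding block_cells_def by auto
  then have dis: "disjoint_family_on block_cells A" "disjoint_family_on block_cells B"
    using star_dis unfolding disjoint_family_on_def by simp_all
  have edges_dis: "\<Union>(block_edges ` A) \<inter> \<Union>(block_edges ` B) = {}"
  proof -
    have False if e: "e \<in> block_edges n" "e \<in> block_edges n'" "n \<in> A" "n' \<in> B" for e n n'
    proof -
      obtain a b c d where n: "n = (a, b)" "n' = (c, d)"
        by fastforce
      have c: "odd c" and a: "even a"
        using A B e(3,4) n by auto
      obtain f where f: "f \<in> star_edges (c, d)" "e = Inl ` f"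
        using c e(2)[unfolded n] by (rule block_edges_odd_cases)
      have "f \<noteq> {}"
        using f(1) star_edges_subset[of "(c, d)"] by blast
      have "f \<in> star_edges (a, b)"
        using a e(1)[unfolded n]
      proof (cases rule: block_edges_even_cases)
        case (1 g)
        then show ?thesis
          using f(2) \<open>f \<noteq> {}\<close> by auto
      next
        case (2 s)
        then show ?thesis
          using f(2) by auto
      next
        case (3 g)
        then have "f = g"
          using f(2) by (simp add: inj_image_eq_iff)
        then show ?thesis
          using 3 by (auto simp: star_edges_def)
      next
        case (4 g)
        then have "f = g"
          using f(2) by (simp add: inj_image_eq_iff)
        then show ?thesis
          using 4 by (auto simp: star_edges_def)
      qed
      then have "f \<in> (\<Union>n\<in>A. star_edges n) \<inter> (\<Union>n\<in>B. star_edges n)"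
        using f(1) e(3,4) n by blast
      then show False
        unfolding A_def B_def disjoint_star_edges by simp
    qed
    then show ?thesis
      by blast
  qed
  have "real (card (matchings replaced.dual_edges (region_cells m))) =
      matching_sum replaced.dual_edges (\<lambda>_. 1) (region_cells m)"
    by (simp add: matching_sum_one)
  also have "\<dots> = matching_sum (\<Union>n\<in>A \<union> B. block_edges n) (\<lambda>_. 1) (region_cells m)"
  proof (rule matching_sum_cong)
    fix e assume e: "e \<subseteq> region_cells m"
    show "e \<in> replaced.dual_edges \<longleftrightarrow> e \<in> (\<Union>n\<in>A \<union> B. block_edges n)"
      unfolding dual_edges_eq_blocks AB(3)[symmetric]
    proof
      assume "e \<in> \<Union>(block_edges ` odd_vertices)"
      then obtain a b where "odd (a + b)" "e \<in> block_edges (a, b)"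
        by (auto simp: odd_vertices_def)
      then show "e \<in> \<Union>(block_edges ` aztec_vertices False r r)"
        using block_edge_in_region[OF _ _ e] unfolding r_def by blast
    next
      have "aztec_vertices False r r \<subseteq> odd_vertices"
        by (auto simp: aztec_vertices_def odd_vertices_def)
      then show "e \<in> \<Union>(block_edges ` odd_vertices)" if "e \<in> \<Union>(block_edges ` aztec_vertices False r r)"
        using that by blast
    qed
  qed simp
  also have "\<dots> = (\<Sum>S\<in>Pow (Inl ` (VA \<inter> VB)).
      (\<Prod>n\<in>A. matching_sum (block_edges n) (\<lambda>_. 1) (block_cells n - (Inl ` (VA \<inter> VB) - S))) *
      (\<Prod>n\<in>B. matching_sum (block_edges n) (\<lambda>_. 1) (block_cells n - S)))"
    unfolding region inter[symmetric]
    by (rule matching_sum_block_union) (rule AB dis edges_dis block_edges_subset finite_block_cells)+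
  also have "\<dots> = (\<Sum>S\<in>Pow (VA \<inter> VB).
      (\<Prod>n\<in>A. matching_sum (block_edges n) (\<lambda>_. 1) (block_cells n - (Inl ` (VA \<inter> VB) - Inl ` S))) *
      (\<Prod>n\<in>B. matching_sum (block_edges n) (\<lambda>_. 1) (block_cells n - Inl ` S)))"
    unfolding image_Pow_surj[OF refl, of Inl, symmetric]
    by (subst sum.reindex) (auto simp: inj_on_def inj_image_eq_iff)
  \<comment> \<open>Urban renewal inside each term: every block at a node becomes twice a weighted
    star, every other block a star of unit weights.\<close>
  also have "\<dots> = (\<Sum>S\<in>Pow (VA \<inter> VB).
      (\<Prod>n\<in>A. 2 * matching_sum (star_edges n) (wt (3 / 2) (1 / 2) 1) (star n - (VA \<inter> VB - S))) *
      (\<Prod>n\<in>B. matching_sum (star_edges n) (wt (3 / 2) (1 / 2) 1) (star n - S)))"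
  proof (intro sum.cong arg_cong2[of _ _ _ _ "(*)"] prod.cong refl)
    fix S n assume n: "n \<in> A"
    have "block_cells n - (Inl ` (VA \<inter> VB) - Inl ` S) = Inl ` (star n - (VA \<inter> VB - S)) \<union> Inr ` star n"
      using A'[OF n] by (auto simp: block_cells_def)
    moreover have "first_node n \<or> second_node n"
      using A[of "fst n" "snd n"] n first_or_second[of "fst n" "snd n"] by simp
    ultimately show "matching_sum (block_edges n) (\<lambda>_. 1) (block_cells n - (Inl ` (VA \<inter> VB) - Inl ` S)) =
        2 * matching_sum (star_edges n) (wt (3 / 2) (1 / 2) 1) (star n - (VA \<inter> VB - S))"
      using block_edges_even_sum[of n "star n - (VA \<inter> VB - S)"] by simp
  next
    fix S n assume n: "n \<in> B"
    have "block_cells n - Inl ` S = Inl ` (star n - S)"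
      using B'[OF n] by (auto simp: block_cells_def)
    then show "matching_sum (block_edges n) (\<lambda>_. 1) (block_cells n - Inl ` S) =
        matching_sum (star_edges n) (wt (3 / 2) (1 / 2) 1) (star n - S)"
      using block_edges_odd_sum[of "fst n" "snd n"] B[of "fst n" "snd n"] n by simp
  qed
  also have "\<dots> = 2 ^ card A * (\<Sum>S\<in>Pow (VA \<inter> VB).
      (\<Prod>n\<in>A. matching_sum (star_edges n) (wt (3 / 2) (1 / 2) 1) (star n - (VA \<inter> VB - S))) *
      (\<Prod>n\<in>B. matching_sum (star_edges n) (wt (3 / 2) (1 / 2) 1) (star n - S)))"
    by (simp add: prod.distrib sum_distrib_left mult.assoc)
  \<comment> \<open>The same expansion read backwards, now with stars as blocks, reassembles the
    Aztec diamond.\<close>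
  also have "(\<Sum>S\<in>Pow (VA \<inter> VB).
      (\<Prod>n\<in>A. matching_sum (star_edges n) (wt (3 / 2) (1 / 2) 1) (star n - (VA \<inter> VB - S))) *
      (\<Prod>n\<in>B. matching_sum (star_edges n) (wt (3 / 2) (1 / 2) 1) (star n - S))) =
      matching_sum (\<Union>n\<in>A \<union> B. star_edges n) (wt (3 / 2) (1 / 2) 1) (VA \<union> VB)"
    unfolding VA_def VB_def
    by (rule matching_sum_block_union[symmetric])
      (rule AB star_dis disjoint_star_edges[of False r r, folded A_def B_def] star_edges_subset finite_star)+
  also have "\<dots> = aztec_sum m (3 / 2) (1 / 2) 1"
    unfolding aztec_sum_def r_def[symmetric] A_def B_def VA_def VB_def aztec_split[symmetric]
    by (rule matching_sum_aztec[symmetric]) simp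
  also have "card A = (m\<^sup>2 + 1) div 2"
    unfolding A_def by (rule card_aztec_even) (simp add: r_def)
  finally show ?thesis
    by (simp add: tiling_number_def)
qed

lemma num_tilings_S1: "real (num_tilings replaced_lattice (region_S1 m)) = tiling_number m"
  unfolding num_tilings_region by (rule matchings_region)

theorem theorem5p1:
  fixes n :: nat
  shows "num_tilings replaced_lattice (region_S1 (4 * n)) =
           7 ^ (n * (2 * n - 1)) * 37 ^ (n * (2 * n + 1)) \<and>
         num_tilings replaced_lattice (region_S1 (4 * n + 1)) =
           5 * 7 ^ (2 * n ^ 2) * 37 ^ (2 * n * (n + 1)) \<and>
         num_tilings replaced_lattice (region_S1 (4 * n + 2)) =
           7 ^ (n * (2 * n + 1)) * 37 ^ ((n + 1) * (2 * n + 1)) \<and>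
         num_tilings replaced_lattice (region_S1 (4 * n + 3)) =
           2 * 7 ^ (2 * n * (n + 1)) * 37 ^ (2 * n * (n + 2) + 2)"
proof -
  have *: "num_tilings replaced_lattice (region_S1 m) = k" if "tiling_number m = real k" for m k
    using num_tilings_S1[of m] that by simp
  show ?thesis
    by (intro conjI; rule *; simp only: tiling_number_eq of_nat_mult of_nat_power of_nat_numeral)
qed

end
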